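(* Let $T>0$. Assume that $\nu>0$ and $v\in L^1(0,T;C_b^{1,\alpha}(\mathbb{R}^n,\mathbb{R}^n))$ for some $\alpha\in(0,1)$. Let $(X_s(t;x))_{0\le s\le t\le T}$ be a stochastic flow corresponding to the SDE $$dX_s(t;x)=v(t,X_s(t;x))\,dt+\sqrt{2\nu}\,dW(t),\ t\in[s,T],\qquad X_s(s;x)=x.$$ Assume that $F_0\in C^2(\mathbb{R}^n)$ and let $F\in C^{1,2}([0,T]\times\mathbb{R}^n,\mathbb{R}^n)$ be a solution of the linear equation $$\frac{\partial F(t)}{\partial t}=-\nu AF+\mathrm{P}\big((v(T-t)\nabla)F-\nabla F\,v(T-t)\big),\ t\in(0,T),\qquad F(0)=F_0.$$ Then for any closed loop $\Gamma$ of class $C^1$ in $\mathbb{R}^n$ and any $s\in[0,T]$ the process $(M_s(t))_{t\in[T-s,T]}$ defined by $$M_s(t)=\int_{X_{T-s}(t;\Gamma)}\sum_{k=1}^nF^k(T-t,x)\,dx_k,\qquad t\in[T-s,T],$$ is a local martingale.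
   Context: $W$ is a standard $\mathbb{R}^n$-valued Wiener process on a complete filtered probability space $(\Omega,\mathcal{F},\{\mathcal{F}_t\}_{t\ge0},\mathbb{P})$. $C_b^{k,\alpha}$ denotes functions with bounded derivatives up to order $k$ and $\alpha$-Hölder $k$-th derivatives. $\mathrm{P}$ is the Helmholtz projection onto divergence-free vector fields on $\mathbb{R}^n$ and $A=-\mathrm{P}\triangle$ is the Stokes operator. $((v\nabla)F)^k=\sum_jv^j\frac{\partial F^k}{\partial x_j}$, $(\nabla F\,v)^k=\sum_jv^j\frac{\partial F^j}{\partial x_k}$. $X_{T-s}(t;\Gamma)$ is the closed loop obtained by composing $\Gamma$ with $X_{T-s}(t;\cdot)$. *)

theory Defs
  imports "HOL-Probability.Probability"
begin

section \<open>Differential calculus on $R^n$\<close>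

definition partial :: "'n::finite \<Rightarrow> (real^'n \<Rightarrow> 'b::real_normed_vector) \<Rightarrow> real^'n \<Rightarrow> 'b" where
  "partial j f x = frechet_derivative f (at x) (axis j 1)"

primrec Ck :: "nat \<Rightarrow> (real^'n::finite \<Rightarrow> 'b::real_normed_vector) \<Rightarrow> bool" where
  "Ck 0 f \<longleftrightarrow> continuous_on UNIV f"
| "Ck (Suc k) f \<longleftrightarrow> (\<forall>x. f differentiable (at x)) \<and> (\<forall>j. Ck k (partial j f))"

definition laplacian :: "(real^'n::finite \<Rightarrow> 'b::real_normed_vector) \<Rightarrow> real^'n \<Rightarrow> 'b" where
  "laplacian f x = (\<Sum>j\<in>UNIV. partial j (partial j f) x)"

text \<open>The two first-order terms $(v\nabla)F$ and $\nabla F\,v$; in the second one the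
  differentiation index is the free index.\<close>

definition advect :: "(real^'n::finite \<Rightarrow> real^'n) \<Rightarrow> (real^'n \<Rightarrow> real^'n) \<Rightarrow> real^'n \<Rightarrow> real^'n" where
  "advect v F x = (\<chi> k. \<Sum>j\<in>UNIV. v x $ j * partial j F x $ k)"

definition nabla_apply :: "(real^'n::finite \<Rightarrow> real^'n) \<Rightarrow> (real^'n \<Rightarrow> real^'n) \<Rightarrow> real^'n \<Rightarrow> real^'n" where
  "nabla_apply F v x = (\<chi> k. \<Sum>j\<in>UNIV. v x $ j * partial k F x $ j)"

text \<open>$C^{1,2}([0,T]\times R^n)$; the time derivative is one-sided at the end points.\<close>

definition time_deriv :: "real \<Rightarrow> (real \<Rightarrow> real^'n::finite \<Rightarrow> 'b::real_normed_vector) \<Rightarrow> real \<Rightarrow> real^'n \<Rightarrow> 'b" where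
  "time_deriv T F t x = vector_derivative (\<lambda>r. F r x) (at t within {0..T})"

definition C12 :: "real \<Rightarrow> (real \<Rightarrow> real^'n::finite \<Rightarrow> 'b::real_normed_vector) \<Rightarrow> bool" where
  "C12 T F \<longleftrightarrow>
     (\<forall>x. \<forall>t\<in>{0..T}. (\<lambda>r. F r x) differentiable (at t within {0..T})) \<and>
     (\<forall>t\<in>{0..T}. Ck 2 (F t)) \<and>
     continuous_on ({0..T} \<times> UNIV) (\<lambda>(t, x). F t x) \<and>
     continuous_on ({0..T} \<times> UNIV) (\<lambda>(t, x). time_deriv T F t x) \<and>
     (\<forall>i. continuous_on ({0..T} \<times> UNIV) (\<lambda>(t, x). partial i (F t) x)) \<and>
     (\<forall>i j. continuous_on ({0..T} \<times> UNIV) (\<lambda>(t, x). partial i (partial j (F t)) x))"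


section \<open>The space $L^1(0,T;C_b^{1,\alpha})$\<close>

definition Cb1_norm :: "real \<Rightarrow> (real^'n::finite \<Rightarrow> real^'n) \<Rightarrow> ennreal" where
  "Cb1_norm \<alpha> f =
     (SUP x. ennreal (norm (f x))) +
     (SUP x. ennreal (onorm (frechet_derivative f (at x)))) +
     (SUP (x, y)\<in>{(x, y). x \<noteq> y}.
        ennreal (onorm (\<lambda>u. frechet_derivative f (at x) u - frechet_derivative f (at y) u)
                 / dist x y powr \<alpha>))"

definition Cb1 :: "real \<Rightarrow> (real^'n::finite \<Rightarrow> real^'n) set" where
  "Cb1 \<alpha> = {f. Ck 1 f \<and> Cb1_norm \<alpha> f < \<infinity>}"

text \<open>Bochner integrability. The space \<open>Cb1 \<alpha>\<close> is not separable, so strong measurability is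
  stated through almost everywhere approximation by simple functions.\<close>

definition L1_Cb1 :: "real \<Rightarrow> real \<Rightarrow> (real \<Rightarrow> real^'n::finite \<Rightarrow> real^'n) \<Rightarrow> bool" where
  "L1_Cb1 T \<alpha> v \<longleftrightarrow>
     (AE t in lebesgue_on {0<..<T}. v t \<in> Cb1 \<alpha>) \<and>
     (\<exists>s :: nat \<Rightarrow> real \<Rightarrow> real^'n \<Rightarrow> real^'n.
        (\<forall>k. simple_function (lebesgue_on {0<..<T}) (s k) \<and> (\<forall>t. s k t \<in> Cb1 \<alpha>)) \<and>
        (AE t in lebesgue_on {0<..<T}. (\<lambda>k. Cb1_norm \<alpha> (\<lambda>x. v t x - s k t x)) \<longlonglongrightarrow> 0)) \<and>
     (\<integral>\<^sup>+ t. Cb1_norm \<alpha> (v t) \<partial>lebesgue_on {0<..<T}) < \<infinity>"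


section \<open>Helmholtz projection and Stokes operator\<close>

definition L2_field :: "(real^'n::finite \<Rightarrow> real^'n) \<Rightarrow> bool" where
  "L2_field u \<longleftrightarrow> u \<in> borel_measurable lborel \<and> integrable lborel (\<lambda>x. (norm (u x))\<^sup>2)"

definition test_function :: "(real^'n::finite \<Rightarrow> real) \<Rightarrow> bool" where
  "test_function \<phi> \<longleftrightarrow> (\<forall>k. Ck k \<phi>) \<and> (\<exists>K. compact K \<and> (\<forall>x. x \<notin> K \<longrightarrow> \<phi> x = 0))"

definition L2_solenoidal :: "(real^'n::finite \<Rightarrow> real^'n) \<Rightarrow> bool" where
  "L2_solenoidal u \<longleftrightarrow> L2_field u \<and>
     (\<forall>\<phi>. test_function \<phi> \<longrightarrow> (\<integral>x. (\<Sum>j\<in>UNIV. u x $ j * partial j \<phi> x) \<partial>lborel) = 0)"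

text \<open>\<open>helmholtz u w\<close>: \<open>w\<close> represents $\mathrm{P}u$, the orthogonal projection in $L^2$ onto the
  closed subspace of divergence-free fields. It is a relation because $\mathrm{P}u$ is determined
  only up to null sets. \<open>stokes u w\<close>: \<open>w\<close> represents $Au = -\mathrm{P}\triangle u$.\<close>

definition helmholtz :: "(real^'n::finite \<Rightarrow> real^'n) \<Rightarrow> (real^'n \<Rightarrow> real^'n) \<Rightarrow> bool" where
  "helmholtz u w \<longleftrightarrow> L2_field u \<and> L2_solenoidal w \<and>
     (\<forall>h. L2_solenoidal h \<longrightarrow> (\<integral>x. (u x - w x) \<bullet> h x \<partial>lborel) = 0)"

definition stokes :: "(real^'n::finite \<Rightarrow> real^'n) \<Rightarrow> (real^'n \<Rightarrow> real^'n) \<Rightarrow> bool" where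
  "stokes u w \<longleftrightarrow> helmholtz (laplacian u) (\<lambda>x. - w x)"

text \<open>The equation holds for almost every \<open>t\<close>, since \<open>v\<close> is given only up to null sets of times,
  and at each such \<open>t\<close> as an identity of $L^2$ classes.\<close>

definition vector_advection_solution ::
  "real \<Rightarrow> real \<Rightarrow> (real \<Rightarrow> real^'n::finite \<Rightarrow> real^'n) \<Rightarrow> (real^'n \<Rightarrow> real^'n) \<Rightarrow>
   (real \<Rightarrow> real^'n \<Rightarrow> real^'n) \<Rightarrow> bool" where
  "vector_advection_solution T \<nu> v F0 F \<longleftrightarrow>
     F 0 = F0 \<and>
     (AE t in lebesgue_on {0<..<T}. \<exists>a p.
        stokes (F t) a \<and>
        helmholtz (\<lambda>x. advect (v (T - t)) (F t) x - nabla_apply (F t) (v (T - t)) x) p \<and>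
        (AE x in lborel. time_deriv T F t x = - \<nu> *\<^sub>R a x + p x))"


section \<open>Stochastic basis, Wiener process and local martingales\<close>

locale complete_filtered_prob_space = prob_space M + complete_measure M
  for M :: "'a measure" +
  fixes \<F> :: "real \<Rightarrow> 'a measure"
  assumes filtration_subalgebra: "\<And>t. 0 \<le> t \<Longrightarrow> subalgebra M (\<F> t)"
    and filtration_mono: "\<And>s t. 0 \<le> s \<Longrightarrow> s \<le> t \<Longrightarrow> sets (\<F> s) \<subseteq> sets (\<F> t)"
    and filtration_complete: "null_sets M \<subseteq> sets (\<F> 0)"

definition wiener_process ::
  "'a measure \<Rightarrow> (real \<Rightarrow> 'a measure) \<Rightarrow> (real \<Rightarrow> 'a \<Rightarrow> real^'n::finite) \<Rightarrow> bool" where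
  "wiener_process M \<F> W \<longleftrightarrow>
     (\<forall>t\<ge>0. W t \<in> borel_measurable (\<F> t)) \<and>
     (AE \<omega> in M. W 0 \<omega> = 0) \<and>
     (AE \<omega> in M. continuous_on {0..} (\<lambda>t. W t \<omega>)) \<and>
     (\<forall>s t. 0 \<le> s \<and> s < t \<longrightarrow>
        distributed M lborel (\<lambda>\<omega>. W t \<omega> - W s \<omega>)
          (\<lambda>x. ennreal (\<Prod>i\<in>UNIV. normal_density 0 (sqrt (t - s)) (x $ i))) \<and>
        prob_space.indep_set M (sets (\<F> s))
          (sets (vimage_algebra (space M) (\<lambda>\<omega>. W t \<omega> - W s \<omega>) borel)))"

definition martingale_on ::
  "'a measure \<Rightarrow> (real \<Rightarrow> 'a measure) \<Rightarrow> real set \<Rightarrow> (real \<Rightarrow> 'a \<Rightarrow> real) \<Rightarrow> bool" where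
  "martingale_on M \<F> I Y \<longleftrightarrow>
     (\<forall>t\<in>I. Y t \<in> borel_measurable (\<F> t) \<and> integrable M (Y t)) \<and>
     (\<forall>s\<in>I. \<forall>t\<in>I. s \<le> t \<longrightarrow> (AE \<omega> in M. real_cond_exp M (\<F> s) (Y t) \<omega> = Y s \<omega>))"

definition cadlag_on :: "real \<Rightarrow> real \<Rightarrow> (real \<Rightarrow> real) \<Rightarrow> bool" where
  "cadlag_on a b f \<longleftrightarrow>
     (\<forall>t\<in>{a..<b}. (f \<longlongrightarrow> f t) (at_right t)) \<and>
     (\<forall>t\<in>{a<..b}. \<exists>l. (f \<longlongrightarrow> l) (at_left t))"

text \<open>Local martingale on the compact interval \<open>[a,b]\<close>: an adapted, almost surely cadlag process
  with a localizing sequence. The index set being closed, the localizing stopping times have to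
  reach \<open>b\<close> rather than merely converge to it.\<close>

definition local_martingale_on ::
  "'a measure \<Rightarrow> (real \<Rightarrow> 'a measure) \<Rightarrow> real \<Rightarrow> real \<Rightarrow> (real \<Rightarrow> 'a \<Rightarrow> real) \<Rightarrow> bool" where
  "local_martingale_on M \<F> a b Y \<longleftrightarrow>
     (\<forall>t\<in>{a..b}. Y t \<in> borel_measurable (\<F> t)) \<and>
     (AE \<omega> in M. cadlag_on a b (\<lambda>t. Y t \<omega>)) \<and>
     (\<exists>\<tau> :: nat \<Rightarrow> 'a \<Rightarrow> real.
        (\<forall>k. stopping_time \<F> (\<tau> k) \<and> (\<forall>\<omega>. \<tau> k \<omega> \<in> {a..b})) \<and>
        (AE \<omega> in M. incseq (\<lambda>k. \<tau> k \<omega>)) \<and>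
        (AE \<omega> in M. \<exists>k. \<tau> k \<omega> = b) \<and>
        (\<forall>k. martingale_on M \<F> {a..b} (\<lambda>t \<omega>. Y (min t (\<tau> k \<omega>)) \<omega>)))"


section \<open>The stochastic flow\<close>

definition C1_diffeo :: "(real^'n::finite \<Rightarrow> real^'n) \<Rightarrow> bool" where
  "C1_diffeo f \<longleftrightarrow> bij f \<and> Ck 1 f \<and> Ck 1 (inv f)"

definition flow_domain :: "real \<Rightarrow> (real \<times> real \<times> (real^'n::finite)) set" where
  "flow_domain T = {(s, t, x). 0 \<le> s \<and> s \<le> t \<and> t \<le> T}"

text \<open>\<open>X s t x \<omega>\<close> is $X_s(t;x)(\omega)$. A stochastic flow (of $C^1$-diffeomorphisms, in the
  usual sense of Kunita) of the SDE $dX = v(t,X)dt + \sqrt{2\nu}dW$. As the noise is additive,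
  the SDE needs no stochastic integral.\<close>

definition stochastic_flow ::
  "'a measure \<Rightarrow> (real \<Rightarrow> 'a measure) \<Rightarrow> (real \<Rightarrow> 'a \<Rightarrow> real^'n::finite) \<Rightarrow> real \<Rightarrow> real \<Rightarrow>
   (real \<Rightarrow> real^'n \<Rightarrow> real^'n) \<Rightarrow> (real \<Rightarrow> real \<Rightarrow> real^'n \<Rightarrow> 'a \<Rightarrow> real^'n) \<Rightarrow> bool" where
  "stochastic_flow M \<F> W T \<nu> v X \<longleftrightarrow>
     (\<forall>s t x. 0 \<le> s \<and> s \<le> t \<and> t \<le> T \<longrightarrow> X s t x \<in> borel_measurable (\<F> t)) \<and>
     (\<forall>s\<in>{0..T}. \<forall>x. AE \<omega> in M. \<forall>t\<in>{s..T}.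
        set_integrable lebesgue {s..t} (\<lambda>r. v r (X s r x \<omega>)) \<and>
        X s t x \<omega> = x + (LINT r:{s..t}|lebesgue. v r (X s r x \<omega>))
                     + sqrt (2 * \<nu>) *\<^sub>R (W t \<omega> - W s \<omega>)) \<and>
     (AE \<omega> in M. \<forall>s t. 0 \<le> s \<and> s \<le> t \<and> t \<le> T \<longrightarrow> C1_diffeo (\<lambda>x. X s t x \<omega>)) \<and>
     (AE \<omega> in M. continuous_on (flow_domain T) (\<lambda>(s, t, x). X s t x \<omega>)) \<and>
     (AE \<omega> in M. \<forall>j. continuous_on (flow_domain T) (\<lambda>(s, t, x). partial j (\<lambda>y. X s t y \<omega>) x)) \<and>
     (AE \<omega> in M. \<forall>s x. 0 \<le> s \<and> s \<le> T \<longrightarrow> X s s x \<omega> = x) \<and>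
     (AE \<omega> in M. \<forall>s u t x. 0 \<le> s \<and> s \<le> u \<and> u \<le> t \<and> t \<le> T \<longrightarrow>
        X s t x \<omega> = X u t (X s u x \<omega>) \<omega>)"


section \<open>Loops and circulation\<close>

text \<open>A loop is parametrized by \<open>[0,1]\<close>; derivatives at the end points are one-sided and are not
  required to match.\<close>

definition C1_loop :: "(real \<Rightarrow> real^'n::finite) \<Rightarrow> bool" where
  "C1_loop \<Gamma> \<longleftrightarrow> pathfinish \<Gamma> = pathstart \<Gamma> \<and>
     (\<exists>D. (\<forall>u\<in>{0..1}. (\<Gamma> has_vector_derivative D u) (at u within {0..1})) \<and>
          continuous_on {0..1} D)"

definition line_integral :: "(real \<Rightarrow> real^'n::finite) \<Rightarrow> (real^'n \<Rightarrow> real^'n) \<Rightarrow> real" where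
  "line_integral \<Gamma> G =
     integral {0..1} (\<lambda>u. \<Sum>k\<in>UNIV. G (\<Gamma> u) $ k * vector_derivative \<Gamma> (at u within {0..1}) $ k)"

end

theory Submission
  imports Defs
begin

text \<open>Write $a = T - s$, $x_t(u) = X_a(t;\Gamma(u))$, $G(t) = F(T-t)$ and $\sigma = \sqrt{2\nu}$. The noise is
additive, so $x_t(u) - \sigma (W_t - W_a)$ is absolutely continuous in $t$ with velocity $v(t, x_t(u))$,
and the increments $x_t(u') - x_t(u)$ contain no noise at all. The circulation
$\oint G(t)\cdot dx_t$ is the limit of the Riemann--Stieltjes sums
$R_m(t) = \sum_{j<m} G(t, x_t(u_j)) \cdot (x_t(u_{j+1}) - x_t(u_j))$, $u_j = j/m$, and each $R_m$
is a finite sum of products of a $C^{1,2}$ function of one particle with an absolutely continuous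
weight. For such a product an elementary form of Ito's formula is enough (\<open>stopped_ito_formula\<close>): up to
a martingale, $R_m$ is the time integral of
$$\sum_{j<m} \big(\partial_t G + \nu\triangle G + (v\nabla)G\big)(x_j)\cdot(x_{j+1}-x_j)
   + G(x_j)\cdot(v(x_{j+1}) - v(x_j)).$$

Because the loop is closed, summation by parts moves the last difference from $v$ to $G$, and as $m
\to \infty$ the sum converges to the circulation of $q = \partial_t G + \nu\triangle G + (v\nabla) G
- \nabla G\,v$ around the transported loop (\<open>riemann_drift_limit\<close>). By the equation for
$F$, the continuous field $q$ is for almost every $t$ an $L^2$ field minus its Helmholtz projection,
hence orthogonal to every divergence-free $L^2$ field. Testing with the divergence-free field
obtained by smearing the tangent current of a loop over a small ball shows that $q$ has zero
circulation around every closed loop (\<open>circulation_of_helmholtz_defect\<close>). So the drift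
vanishes in the limit, and the circulation is a local martingale.

The localization is by the exit times of $W - W_a$ from balls. Since $v$ is bounded and Lipschitz
with an integrable constant, the particles stay in a fixed ball before such an exit time, and
Gronwall's inequality bounds the spread of neighbouring particles by a deterministic constant. All
limits below are therefore taken by dominated convergence.\<close>

section \<open>First and second order expansions on compact sets\<close>

lemma has_derivative_partial:
  fixes f :: "real^'n::finite \<Rightarrow> 'b::real_normed_vector"
  assumes "f differentiable (at x)"
  shows "(f has_derivative (\<lambda>h. \<Sum>j\<in>UNIV. (h $ j) *\<^sub>R partial j f x)) (at x)"
proof -
  have D: "(f has_derivative frechet_derivative f (at x)) (at x)"
    using assms frechet_derivative_works by blast
  interpret linear "frechet_derivative f (at x)"
    using assms by (rule linear_frechet_derivative)
  have "frechet_derivative f (at x) h = (\<Sum>j\<in>UNIV. (h $ j) *\<^sub>R partial j f x)" for h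
  proof -
    have "h = (\<Sum>j\<in>UNIV. (h $ j) *\<^sub>R axis j 1)"
      using basis_expansion[of h] by (simp add: scalar_mult_eq_scaleR)
    then have "frechet_derivative f (at x) h = frechet_derivative f (at x) (\<Sum>j\<in>UNIV. (h $ j) *\<^sub>R axis j 1)"
      by simp
    then show ?thesis by (simp add: sum scale partial_def)
  qed
  then have "frechet_derivative f (at x) = (\<lambda>h. \<Sum>j\<in>UNIV. (h $ j) *\<^sub>R partial j f x)" by blast
  with D show ?thesis by simp
qed

lemma norm_matrix_vector_mult_le:
  fixes A :: "real^'n::finite^'m::finite"
  shows "norm (A *v x) \<le> norm A * norm x"
proof -
  have "(norm (A *v x))\<^sup>2 = (\<Sum>i\<in>UNIV. (A $ i \<bullet> x)\<^sup>2)"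
    by (simp only: norm_vec_def[of "A *v x"] L2_set_def) (simp add: sum_nonneg matrix_vector_mult_def inner_vec_def)
  also have "\<dots> \<le> (\<Sum>i\<in>UNIV. (norm (A $ i))\<^sup>2 * (norm x)\<^sup>2)"
    by (intro sum_mono) (metis Cauchy_Schwarz_ineq2 abs_ge_zero power2_abs power_mono power_mult_distrib)
  also have "\<dots> = (norm A * norm x)\<^sup>2"
    by (simp only: norm_vec_def[of A] L2_set_def power_mult_distrib) (simp add: sum_distrib_right sum_nonneg)
  finally show ?thesis by (meson mult_nonneg_nonneg norm_ge_zero power2_le_imp_le)
qed

lemma abs_quadratic_form_le:
  fixes A :: "real^'n::finite^'n"
  shows "\<bar>h \<bullet> (A *v h)\<bar> \<le> norm A * (norm h)\<^sup>2"
proof -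
  have "\<bar>h \<bullet> (A *v h)\<bar> \<le> norm h * (norm A * norm h)"
    by (meson Cauchy_Schwarz_ineq2 mult_left_mono norm_ge_zero norm_matrix_vector_mult_le order_trans)
  then show ?thesis by (simp add: power2_eq_square algebra_simps)
qed

text \<open>The scalar $C^{1,2}$ functions to which the formula is applied are the components of the reversed
field $F(T-t)$. The locale keeps all derivatives as explicit functions, so that no derivative
operator occurs in the estimates.\<close>

locale space_time_C12 =
  fixes a b :: real
    and f :: "real \<Rightarrow> real^'n::finite \<Rightarrow> real"
    and f\<^sub>t :: "real \<Rightarrow> real^'n \<Rightarrow> real"
    and Df :: "real \<Rightarrow> real^'n \<Rightarrow> real^'n"
    and D2f :: "real \<Rightarrow> real^'n \<Rightarrow> real^'n^'n"
  assumes deriv_t: "\<And>t x. t \<in> {a..b} \<Longrightarrow> ((\<lambda>r. f r x) has_real_derivative f\<^sub>t t x) (at t within {a..b})"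
    and deriv_x: "\<And>t x. t \<in> {a..b} \<Longrightarrow> (f t has_derivative (\<lambda>h. Df t x \<bullet> h)) (at x)"
    and deriv_xx: "\<And>t x. t \<in> {a..b} \<Longrightarrow> (Df t has_derivative (\<lambda>h. D2f t x *v h)) (at x)"
    and cont_f: "continuous_on ({a..b} \<times> UNIV) (\<lambda>(t, x). f t x)"
    and cont_t: "continuous_on ({a..b} \<times> UNIV) (\<lambda>(t, x). f\<^sub>t t x)"
    and cont_x: "continuous_on ({a..b} \<times> UNIV) (\<lambda>(t, x). Df t x)"
    and cont_xx: "continuous_on ({a..b} \<times> UNIV) (\<lambda>(t, x). D2f t x)"
begin

text \<open>The derivatives are merely continuous on the unbounded strip; all estimates are made uniform by
restricting the space variable to a ball of fixed radius \<open>R\<close>.\<close>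

lemma uniform_modulus:
  fixes k :: "real \<Rightarrow> real^'n \<Rightarrow> 'c::real_normed_vector"
  assumes "continuous_on ({a..b} \<times> UNIV) (\<lambda>(t, x). k t x)" "\<epsilon> > 0"
  obtains \<delta> where "\<delta> > 0"
    "\<And>t t' x x'. \<lbrakk>t \<in> {a..b}; t' \<in> {a..b}; norm x \<le> R; norm x' \<le> R; \<bar>t' - t\<bar> < \<delta>; norm (x' - x) < \<delta>\<rbrakk>
       \<Longrightarrow> norm (k t' x' - k t x) \<le> \<epsilon>"
proof -
  have "uniformly_continuous_on ({a..b} \<times> cball 0 R) (\<lambda>(t, x). k t x)"
    by (intro compact_uniformly_continuous compact_Times continuous_on_subset[OF assms(1)]) auto
  from uniformly_continuous_onE[OF this \<open>\<epsilon> > 0\<close>] obtain d where d: "d > 0"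
    "\<And>p q. p \<in> {a..b} \<times> cball 0 R \<Longrightarrow> q \<in> {a..b} \<times> cball 0 R \<Longrightarrow> dist q p < d \<Longrightarrow>
       dist (case q of (t, x) \<Rightarrow> k t x) (case p of (t, x) \<Rightarrow> k t x) < \<epsilon>" by metis
  show thesis
  proof (rule that[of "d / 2"])
    fix t t' :: real and x x' :: "real^'n"
    assume *: "t \<in> {a..b}" "t' \<in> {a..b}" "norm x \<le> R" "norm x' \<le> R" "\<bar>t' - t\<bar> < d / 2" "norm (x' - x) < d / 2"
    have "dist (t', x') (t, x) \<le> \<bar>t' - t\<bar> + norm (x' - x)"
      using norm_Pair_le[of "t' - t" "x' - x"] by (simp add: dist_norm)
    then have "dist (t', x') (t, x) < d" using * by linarith
    then have "dist (k t' x') (k t x) < \<epsilon>"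
      using d(2)[of "(t, x)" "(t', x')"] * by (auto simp: dist_norm)
    then show "norm (k t' x' - k t x) \<le> \<epsilon>" by (simp add: dist_norm)
  qed (use d in auto)
qed

lemma bounded_on_cball:
  fixes k :: "real \<Rightarrow> real^'n \<Rightarrow> 'c::real_normed_vector"
  assumes "continuous_on ({a..b} \<times> UNIV) (\<lambda>(t, x). k t x)"
  obtains C where "C > 0" "\<And>t x. t \<in> {a..b} \<Longrightarrow> norm x \<le> R \<Longrightarrow> norm (k t x) \<le> C"
proof -
  have "compact ((\<lambda>(t, x). k t x) ` ({a..b} \<times> cball 0 R))"
    by (intro compact_continuous_image compact_Times continuous_on_subset[OF assms(1)]) auto
  then obtain C where "\<And>y. y \<in> (\<lambda>(t, x). k t x) ` ({a..b} \<times> cball 0 R) \<Longrightarrow> norm y \<le> C"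
    using compact_imp_bounded bounded_iff by metis
  then have "norm (k t x) \<le> max 1 C" if "t \<in> {a..b}" "norm x \<le> R" for t x
    using that by (force intro: max.coboundedI2)
  then show thesis by (intro that[of "max 1 C"]) auto
qed

text \<open>The derivatives are frozen at the third point \<open>(t, x)\<close>, whereas the increment runs from
\<open>x''\<close> to \<open>x'\<close>. In a time step from \<open>t\<close> to \<open>t'\<close>,
\<open>x''\<close> will be the particle after the noise and before the drift has acted, so \<open>x'
- x''\<close> is the pure drift displacement.\<close>

lemma first_order_expansion:
  assumes "\<epsilon> > 0"
  obtains \<delta> where "\<delta> > 0"
    "\<And>t t' x x' x''. \<lbrakk>t \<in> {a..b}; t' \<in> {a..b}; norm x \<le> R; norm x' \<le> R; norm x'' \<le> R;
        \<bar>t' - t\<bar> < \<delta>; norm (x' - x) < \<delta>; norm (x'' - x) < \<delta>\<rbrakk>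
      \<Longrightarrow> \<bar>f t' x' - f t x'' - f\<^sub>t t x * (t' - t) - Df t x \<bullet> (x' - x'')\<bar> \<le> \<epsilon> * (\<bar>t' - t\<bar> + norm (x' - x''))"
proof -
  obtain d1 where d1: "d1 > 0"
    "\<And>t t' x x'. \<lbrakk>t \<in> {a..b}; t' \<in> {a..b}; norm x \<le> R; norm x' \<le> R; \<bar>t' - t\<bar> < d1; norm (x' - x) < d1\<rbrakk>
       \<Longrightarrow> norm (f\<^sub>t t' x' - f\<^sub>t t x) \<le> \<epsilon>"
    using uniform_modulus[OF cont_t assms, where R=R] by metis
  obtain d2 where d2: "d2 > 0"
    "\<And>t t' x x'. \<lbrakk>t \<in> {a..b}; t' \<in> {a..b}; norm x \<le> R; norm x' \<le> R; \<bar>t' - t\<bar> < d2; norm (x' - x) < d2\<rbrakk>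
       \<Longrightarrow> norm (Df t' x' - Df t x) \<le> \<epsilon>"
    using uniform_modulus[OF cont_x assms, where R=R] by metis
  show thesis
  proof (rule that[of "min d1 d2"])
    fix t t' :: real and x x' x'' :: "real^'n"
    assume *: "t \<in> {a..b}" "t' \<in> {a..b}" "norm x \<le> R" "norm x' \<le> R" "norm x'' \<le> R"
      "\<bar>t' - t\<bar> < min d1 d2" "norm (x' - x) < min d1 d2" "norm (x'' - x) < min d1 d2"
    have seg: "closed_segment t t' \<subseteq> {a..b}" using * by (simp add: closed_segment_subset)
    have segd: "\<bar>r - t\<bar> < d1" if "r \<in> closed_segment t t'" for r
      using that * by (auto simp: closed_segment_eq_real_ivl split: if_splits)
    have "norm ((f t' x' - f\<^sub>t t x * t') - (f t x' - f\<^sub>t t x * t)) \<le> \<epsilon> * norm (t' - t)"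
    proof (rule field_differentiable_bound[where S="closed_segment t t'" and f'="\<lambda>r. f\<^sub>t r x' - f\<^sub>t t x"])
      fix r assume r: "r \<in> closed_segment t t'"
      show "((\<lambda>r. f r x' - f\<^sub>t t x * r) has_real_derivative f\<^sub>t r x' - f\<^sub>t t x) (at r within closed_segment t t')"
        using r seg by (auto intro!: derivative_eq_intros DERIV_subset[OF deriv_t[of r x'] seg])
      show "norm (f\<^sub>t r x' - f\<^sub>t t x) \<le> \<epsilon>" using d1(2)[of t r x x'] segd[OF r] r seg * by auto
    qed auto
    then have 1: "\<bar>f t' x' - f t x' - f\<^sub>t t x * (t' - t)\<bar> \<le> \<epsilon> * \<bar>t' - t\<bar>" by (simp add: algebra_simps)
    have sub: "closed_segment x'' x' \<subseteq> cball 0 R \<inter> ball x d2"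
      using * by (intro closed_segment_subset) (auto simp: dist_norm norm_minus_commute intro: convex_Int)
    have "norm ((f t x' - Df t x \<bullet> x') - (f t x'' - Df t x \<bullet> x'')) \<le> \<epsilon> * norm (x' - x'')"
    proof (rule differentiable_bound[where S="closed_segment x'' x'" and f'="\<lambda>y h. Df t y \<bullet> h - Df t x \<bullet> h"])
      fix y assume y: "y \<in> closed_segment x'' x'"
      show "((\<lambda>x'. f t x' - Df t x \<bullet> x') has_derivative (\<lambda>h. Df t y \<bullet> h - Df t x \<bullet> h)) (at y within closed_segment x'' x')"
        by (auto intro!: derivative_eq_intros has_derivative_at_withinI[OF deriv_x] *)
      have "norm (Df t y - Df t x) \<le> \<epsilon>"
        using d2(2)[of t t x y] subsetD[OF sub y] * d2(1) by (auto simp: dist_norm norm_minus_commute)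
      then show "onorm (\<lambda>h. Df t y \<bullet> h - Df t x \<bullet> h) \<le> \<epsilon>"
        by (intro onorm_bound) (use assms in \<open>auto simp: inner_diff_left[symmetric] intro!: order_trans[OF Cauchy_Schwarz_ineq2] mult_right_mono\<close>)
    qed auto
    then have 2: "\<bar>f t x' - f t x'' - Df t x \<bullet> (x' - x'')\<bar> \<le> \<epsilon> * norm (x' - x'')"
      by (simp add: inner_diff_right algebra_simps)
    have eq: "f t' x' - f t x'' - f\<^sub>t t x * (t' - t) - Df t x \<bullet> (x' - x'')
       = (f t' x' - f t x' - f\<^sub>t t x * (t' - t)) + (f t x' - f t x'' - Df t x \<bullet> (x' - x''))" by simp
    show "\<bar>f t' x' - f t x'' - f\<^sub>t t x * (t' - t) - Df t x \<bullet> (x' - x'')\<bar> \<le> \<epsilon> * (\<bar>t' - t\<bar> + norm (x' - x''))"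
      unfolding eq distrib_left using 1 2 by linarith
  qed (use d1 d2 in auto)
qed

lemma lipschitz_on_cball:
  obtains C where "C > 0"
    "\<And>t t' x x'. \<lbrakk>t \<in> {a..b}; t' \<in> {a..b}; norm x \<le> R; norm x' \<le> R\<rbrakk>
      \<Longrightarrow> \<bar>f t' x' - f t x\<bar> \<le> C * (\<bar>t' - t\<bar> + norm (x' - x))"
proof -
  obtain C1 where C1: "C1 > 0" "\<And>t x. t \<in> {a..b} \<Longrightarrow> norm x \<le> R \<Longrightarrow> norm (f\<^sub>t t x) \<le> C1"
    using bounded_on_cball[OF cont_t, where R=R] by metis
  obtain C2 where C2: "C2 > 0" "\<And>t x. t \<in> {a..b} \<Longrightarrow> norm x \<le> R \<Longrightarrow> norm (Df t x) \<le> C2"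
    using bounded_on_cball[OF cont_x, where R=R] by metis
  show thesis
  proof (rule that[of "max C1 C2"])
    fix t t' :: real and x x' :: "real^'n"
    assume *: "t \<in> {a..b}" "t' \<in> {a..b}" "norm x \<le> R" "norm x' \<le> R"
    have seg: "closed_segment t t' \<subseteq> {a..b}" using * by (simp add: closed_segment_subset)
    have "norm (f t' x' - f t x') \<le> C1 * norm (t' - t)"
      by (rule field_differentiable_bound[where S="closed_segment t t'" and f'="\<lambda>r. f\<^sub>t r x'"])
        (use seg * C1 in \<open>auto intro!: DERIV_subset[OF deriv_t seg]\<close>)
    then have 1: "\<bar>f t' x' - f t x'\<bar> \<le> max C1 C2 * \<bar>t' - t\<bar>"
      by (auto intro: order_trans[OF _ mult_right_mono])
    have sub: "closed_segment x x' \<subseteq> cball 0 R"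
      using * by (intro closed_segment_subset) auto
    have "norm (f t x' - f t x) \<le> C2 * norm (x' - x)"
    proof (rule differentiable_bound[where S="closed_segment x x'" and f'="\<lambda>y h. Df t y \<bullet> h"])
      fix y assume y: "y \<in> closed_segment x x'"
      then have "norm (Df t y) \<le> C2" using C2 * sub by auto
      then show "onorm (\<lambda>h. Df t y \<bullet> h) \<le> C2"
        by (intro onorm_bound) (use C2 in \<open>auto intro!: order_trans[OF Cauchy_Schwarz_ineq2] mult_right_mono\<close>)
    qed (use * in \<open>auto intro!: has_derivative_at_withinI[OF deriv_x]\<close>)
    then have 2: "\<bar>f t x' - f t x\<bar> \<le> max C1 C2 * norm (x' - x)"
      by (auto intro: order_trans[OF _ mult_right_mono])
    have eq: "f t' x' - f t x = (f t' x' - f t x') + (f t x' - f t x)" by simp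
    show "\<bar>f t' x' - f t x\<bar> \<le> max C1 C2 * (\<bar>t' - t\<bar> + norm (x' - x))"
      unfolding eq distrib_left using 1 2 by linarith
  qed (use C1 in auto)
qed

text \<open>Taylor's theorem with remainder $o(|h|^2)$, made global on the ball: for large \<open>h\<close> the
remainder is only bounded by a multiple of $|h|^2$, and there $|h|^2 \le |h|^4/\delta^2$. The fourth
power is harmless for Gaussian increments, whose fourth moment is of second order in the time step.\<close>

lemma second_order_expansion:
  assumes "\<epsilon> > 0"
  obtains C where "C > 0"
    "\<And>t x h. \<lbrakk>t \<in> {a..b}; norm x \<le> R; norm (x + h) \<le> R\<rbrakk>
      \<Longrightarrow> \<bar>f t (x + h) - f t x - Df t x \<bullet> h - h \<bullet> (D2f t x *v h) / 2\<bar> \<le> \<epsilon> * (norm h)\<^sup>2 + C * norm h ^ 4"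
proof -
  obtain d where d: "d > 0"
    "\<And>t t' x x'. \<lbrakk>t \<in> {a..b}; t' \<in> {a..b}; norm x \<le> R; norm x' \<le> R; \<bar>t' - t\<bar> < d; norm (x' - x) < d\<rbrakk>
       \<Longrightarrow> norm (D2f t' x' - D2f t x) \<le> \<epsilon>"
    using uniform_modulus[OF cont_xx assms, where R=R] by metis
  obtain C0 where C0: "C0 > 0" "\<And>t x. t \<in> {a..b} \<Longrightarrow> norm x \<le> R \<Longrightarrow> norm (D2f t x) \<le> C0"
    using bounded_on_cball[OF cont_xx, where R=R] by metis
  have key: "\<bar>f t (x + h) - f t x - Df t x \<bullet> h - h \<bullet> (D2f t x *v h) / 2\<bar> \<le> K * (norm h)\<^sup>2"
    if t: "t \<in> {a..b}" and xR: "norm x \<le> R" "norm (x + h) \<le> R"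
      and K: "\<And>\<theta>. \<theta> \<in> {0..1} \<Longrightarrow> norm (D2f t (x + \<theta> *\<^sub>R h) - D2f t x) \<le> K" for t x h K
  proof -
    have K0: "0 \<le> K" using K[of 0] by simp
    have line: "((\<lambda>\<theta>. x + \<theta> *\<^sub>R h) has_derivative (\<lambda>\<eta>. \<eta> *\<^sub>R h)) (at \<theta> within {0..1})" for \<theta> :: real
      by (auto intro!: derivative_eq_intros)
    \<comment> \<open>the remainder is estimated by two applications of the mean value inequality along the segment\<close>
    have g1: "((\<lambda>\<theta>. Df t (x + \<theta> *\<^sub>R h) - \<theta> *\<^sub>R (D2f t x *v h)) has_derivative
        (\<lambda>\<eta>. D2f t (x + \<theta> *\<^sub>R h) *v (\<eta> *\<^sub>R h) - \<eta> *\<^sub>R (D2f t x *v h))) (at \<theta> within {0..1})" for \<theta> :: real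
      by (intro has_derivative_diff has_derivative_compose[OF line deriv_xx[OF t]])
        (auto intro!: derivative_eq_intros)
    have d1: "norm ((Df t (x + \<theta> *\<^sub>R h) - \<theta> *\<^sub>R (D2f t x *v h)) - (Df t (x + 0 *\<^sub>R h) - 0 *\<^sub>R (D2f t x *v h)))
        \<le> (K * norm h) * norm (\<theta> - 0)" if "\<theta> \<in> {0..1}" for \<theta>
    proof (rule differentiable_bound[OF _ g1])
      fix \<eta> :: real assume "\<eta> \<in> {0..1}"
      then have "norm (D2f t (x + \<eta> *\<^sub>R h) *v h - D2f t x *v h) \<le> K * norm h"
        by (metis (no_types, opaque_lifting) K matrix_vector_mult_diff_rdistrib mult_right_mono norm_ge_zero norm_matrix_vector_mult_le order_trans)
      moreover have "D2f t (x + \<eta> *\<^sub>R h) *v (e *\<^sub>R h) - e *\<^sub>R (D2f t x *v h) = e *\<^sub>R (D2f t (x + \<eta> *\<^sub>R h) *v h - D2f t x *v h)" for e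
        by (simp add: matrix_vector_mult_scaleR scaleR_diff_right)
      moreover have "norm (e *\<^sub>R (D2f t (x + \<eta> *\<^sub>R h) *v h - D2f t x *v h)) \<le> K * norm h * norm e" for e :: real
        using mult_right_mono[OF calculation(1), of "norm e"] by (simp add: mult.commute)
      ultimately show "onorm (\<lambda>e. D2f t (x + \<eta> *\<^sub>R h) *v (e *\<^sub>R h) - e *\<^sub>R (D2f t x *v h)) \<le> K * norm h"
        by (intro onorm_bound) (use K0 in auto)
    qed (use that in auto)
    have g0: "((\<lambda>\<theta>. f t (x + \<theta> *\<^sub>R h) - \<theta> * (Df t x \<bullet> h) - \<theta>\<^sup>2 / 2 * (h \<bullet> (D2f t x *v h))) has_derivative
        (\<lambda>\<eta>. Df t (x + \<theta> *\<^sub>R h) \<bullet> (\<eta> *\<^sub>R h) - \<eta> * (Df t x \<bullet> h) - \<eta> * \<theta> * (h \<bullet> (D2f t x *v h)))) (at \<theta> within {0..1})" for \<theta> :: real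
      by (intro has_derivative_diff has_derivative_compose[OF line deriv_x[OF t]])
        (auto intro!: derivative_eq_intros simp: field_simps)
    have "norm ((f t (x + 1 *\<^sub>R h) - 1 * (Df t x \<bullet> h) - 1\<^sup>2 / 2 * (h \<bullet> (D2f t x *v h)))
        - (f t (x + 0 *\<^sub>R h) - 0 * (Df t x \<bullet> h) - 0\<^sup>2 / 2 * (h \<bullet> (D2f t x *v h)))) \<le> (K * (norm h)\<^sup>2) * norm (1 - 0 :: real)"
    proof (rule differentiable_bound[OF _ g0])
      fix \<theta> :: real assume th: "\<theta> \<in> {0..1}"
      have "norm (Df t (x + \<theta> *\<^sub>R h) - Df t x - \<theta> *\<^sub>R (D2f t x *v h)) \<le> K * norm h * \<theta>"
        using d1[OF th] th by (simp add: algebra_simps)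
      also have "\<dots> \<le> K * norm h" using th K0 by (simp add: mult_left_le)
      finally have "\<bar>(Df t (x + \<theta> *\<^sub>R h) - Df t x - \<theta> *\<^sub>R (D2f t x *v h)) \<bullet> h\<bar> \<le> K * norm h * norm h"
        by (meson Cauchy_Schwarz_ineq2 mult_right_mono norm_ge_zero order_trans)
      moreover have "Df t (x + \<theta> *\<^sub>R h) \<bullet> (e *\<^sub>R h) - e * (Df t x \<bullet> h) - e * \<theta> * (h \<bullet> (D2f t x *v h))
        = ((Df t (x + \<theta> *\<^sub>R h) - Df t x - \<theta> *\<^sub>R (D2f t x *v h)) \<bullet> h) * e" for e
        by (simp add: inner_diff_left algebra_simps inner_commute)
      moreover have "\<bar>((Df t (x + \<theta> *\<^sub>R h) - Df t x - \<theta> *\<^sub>R (D2f t x *v h)) \<bullet> h) * e\<bar> \<le> K * (norm h)\<^sup>2 * \<bar>e\<bar>" for e :: real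
        using mult_right_mono[OF calculation(1), of "\<bar>e\<bar>"] by (simp add: abs_mult power2_eq_square mult.assoc)
      ultimately show "onorm (\<lambda>e. Df t (x + \<theta> *\<^sub>R h) \<bullet> (e *\<^sub>R h) - e * (Df t x \<bullet> h) - e * \<theta> * (h \<bullet> (D2f t x *v h))) \<le> K * (norm h)\<^sup>2"
        by (intro onorm_bound) (use K0 in auto)
    qed auto
    then show ?thesis by (simp add: algebra_simps)
  qed
  show thesis
  proof (rule that[of "2 * C0 / d\<^sup>2"])
    fix t :: real and x h :: "real^'n"
    assume *: "t \<in> {a..b}" "norm x \<le> R" "norm (x + h) \<le> R"
    have in_ball: "norm (x + \<theta> *\<^sub>R h) \<le> R" if "\<theta> \<in> {0..1}" for \<theta>
    proof -
      have "closed_segment x (x + h) \<subseteq> cball 0 R" using * by (intro closed_segment_subset) auto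
      moreover have "x + \<theta> *\<^sub>R h \<in> closed_segment x (x + h)"
        using that by (auto simp: in_segment algebra_simps intro!: exI[of _ \<theta>])
      ultimately show ?thesis by auto
    qed
    show "\<bar>f t (x + h) - f t x - Df t x \<bullet> h - h \<bullet> (D2f t x *v h) / 2\<bar> \<le> \<epsilon> * (norm h)\<^sup>2 + (2 * C0 / d\<^sup>2) * norm h ^ 4"
    proof (cases "norm h < d")
      case True
      have "norm (\<theta> *\<^sub>R h) < d" if "\<theta> \<in> {0..1}" for \<theta>
        using that True mult_left_le_one_le[of "norm h" \<theta>] by auto
      then have "norm (D2f t (x + \<theta> *\<^sub>R h) - D2f t x) \<le> \<epsilon>" if "\<theta> \<in> {0..1}" for \<theta>
        using d(2)[of t t x "x + \<theta> *\<^sub>R h"] * in_ball[OF that] d(1) that by auto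
      from key[OF * this] have "\<bar>f t (x + h) - f t x - Df t x \<bullet> h - h \<bullet> (D2f t x *v h) / 2\<bar> \<le> \<epsilon> * (norm h)\<^sup>2" .
      moreover have "0 \<le> (2 * C0 / d\<^sup>2) * norm h ^ 4" using C0 by simp
      ultimately show ?thesis by linarith
    next
      case False
      have "norm (D2f t (x + \<theta> *\<^sub>R h) - D2f t x) \<le> 2 * C0" if "\<theta> \<in> {0..1}" for \<theta>
        using norm_triangle_ineq4[of "D2f t (x + \<theta> *\<^sub>R h)" "D2f t x"] C0(2)[OF *(1) in_ball[OF that]] C0(2)[OF *(1,2)] by linarith
      from key[OF * this] have 1: "\<bar>f t (x + h) - f t x - Df t x \<bullet> h - h \<bullet> (D2f t x *v h) / 2\<bar> \<le> 2 * C0 * (norm h)\<^sup>2" .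
      have "d\<^sup>2 \<le> (norm h)\<^sup>2" using False d(1) by (intro power_mono) auto
      then have "2 * C0 * (norm h)\<^sup>2 * d\<^sup>2 \<le> 2 * C0 * (norm h)\<^sup>2 * (norm h)\<^sup>2"
        using C0(1) by (intro mult_left_mono) auto
      then have "2 * C0 * (norm h)\<^sup>2 \<le> (2 * C0 / d\<^sup>2) * norm h ^ 4"
        using d(1) by (simp add: field_simps power2_eq_square power4_eq_xxxx)
      moreover have "0 \<le> \<epsilon> * (norm h)\<^sup>2" using assms by simp
      ultimately show ?thesis using 1 by linarith
    qed
  qed (use C0 d in auto)
qed

end

section \<open>Circulation as a limit of Riemann--Stieltjes sums\<close>

lemma integral_uniform_partition:
  fixes f :: "real \<Rightarrow> 'b::banach"
  assumes f: "f integrable_on {a..b}" and h: "0 \<le> h" "a + real N * h \<le> b" and n: "n \<le> N"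
  shows "integral {a..a + real n * h} f = (\<Sum>i<n. integral {a + real i * h..a + real (Suc i) * h} f)"
  using n
proof (induction n)
  case (Suc n)
  have "real (Suc n) * h \<le> real N * h" using Suc.prems h by (intro mult_right_mono) auto
  then have "{a..a + real (Suc n) * h} \<subseteq> {a..b}" using h by auto
  then have i: "f integrable_on {a..a + real (Suc n) * h}" by (rule integrable_on_subinterval[OF f])
  have "integral {a..a + real n * h} f + integral {a + real n * h..a + real (Suc n) * h} f
      = integral {a..a + real (Suc n) * h} f"
    by (rule Henstock_Kurzweil_Integration.integral_combine[OF _ _ i]) (use h in \<open>auto intro!: mult_right_mono\<close>)
  then show ?case using Suc by simp
qed simp

lemma line_integral_eq:
  fixes \<gamma> :: "real \<Rightarrow> real^'n::finite"
  assumes "\<And>u. u \<in> {0..1} \<Longrightarrow> (\<gamma> has_vector_derivative D u) (at u within {0..1})"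
  shows "line_integral \<gamma> h = integral {0..1} (\<lambda>u. h (\<gamma> u) \<bullet> D u)"
  unfolding line_integral_def
proof (rule Henstock_Kurzweil_Integration.integral_cong)
  fix u :: real assume u: "u \<in> {0..1}"
  then have "vector_derivative \<gamma> (at u within {0..1}) = D u"
    using vector_derivative_within_cbox[of 0 1 u \<gamma> "D u"] assms[OF u] by auto
  then show "(\<Sum>k\<in>UNIV. h (\<gamma> u) $ k * vector_derivative \<gamma> (at u within {0..1}) $ k) = h (\<gamma> u) \<bullet> D u"
    by (simp add: inner_vec_def)
qed

locale C1_curve =
  fixes \<gamma> D :: "real \<Rightarrow> real^'n::finite"
  assumes deriv: "\<And>u. u \<in> {0..1} \<Longrightarrow> (\<gamma> has_vector_derivative D u) (at u within {0..1})"
    and cont_D: "continuous_on {0..1} D"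
begin

lemma cont: "continuous_on {0..1} \<gamma>"
  unfolding continuous_on_eq_continuous_within using deriv has_vector_derivative_continuous by blast

lemma lipschitz:
  obtains L where "L > 0" "\<And>u u'. \<lbrakk>u \<in> {0..1}; u' \<in> {0..1}\<rbrakk> \<Longrightarrow> norm (\<gamma> u' - \<gamma> u) \<le> L * \<bar>u' - u\<bar>"
proof -
  have "bounded (D ` {0..1})"
    by (intro compact_imp_bounded compact_continuous_image cont_D) auto
  then obtain L where L: "\<And>u. u \<in> {0..1} \<Longrightarrow> norm (D u) \<le> L" by (meson bounded_iff imageI)
  have L0: "L \<ge> 0" using order_trans[OF norm_ge_zero L[of 0]] by simp
  show thesis
  proof (rule that[of "L + 1"])
    fix u u' :: real assume u: "u \<in> {0..1}" "u' \<in> {0..1}"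
    have "norm (\<gamma> u' - \<gamma> u) \<le> L * norm (u' - u)"
    proof (rule differentiable_bound[where S="{0..1}" and f'="\<lambda>u h. h *\<^sub>R D u"])
      fix w :: real assume w: "w \<in> {0..1}"
      show "(\<gamma> has_derivative (\<lambda>h. h *\<^sub>R D w)) (at w within {0..1})"
        using deriv[OF w] by (simp add: has_vector_derivative_def)
      show "onorm (\<lambda>h. h *\<^sub>R D w) \<le> L" by (intro onorm_bound) (use L[OF w] L0 in \<open>auto simp: mult.commute[of L] intro!: mult_left_mono\<close>)
    qed (use u in auto)
    then show "norm (\<gamma> u' - \<gamma> u) \<le> (L + 1) * \<bar>u' - u\<bar>" by (simp add: algebra_simps)
  qed (use L0 in auto)
qed

lemma grid_in_unit: "j \<le> m \<Longrightarrow> real j / real m \<in> {0..1}"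
  by (auto simp: divide_simps)

text \<open>On each subinterval the increment of the curve is the integral of its derivative, so the sum differs
from the line integral by an integral in which \<open>h\<close> is evaluated at a wrong point at
distance at most \<open>1/m\<close>; uniform continuity of \<open>h \<circ> \<gamma>\<close> makes
this small.\<close>

lemma riemann_stieltjes:
  assumes h: "continuous_on UNIV h"
  shows "(\<lambda>m. \<Sum>j<m. h (\<gamma> (real j / real m)) \<bullet> (\<gamma> (real (Suc j) / real m) - \<gamma> (real j / real m)))
    \<longlonglongrightarrow> line_integral \<gamma> h"
proof (rule LIMSEQ_I)
  fix e :: real assume e: "e > 0"
  have ch: "continuous_on {0..1} (\<lambda>u. h (\<gamma> u))"
    using continuous_on_compose2[OF h cont] by auto
  have "bounded (D ` {0..1})"
    by (intro compact_imp_bounded compact_continuous_image cont_D) auto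
  then obtain L where "\<And>u. u \<in> {0..1} \<Longrightarrow> norm (D u) \<le> L" by (meson bounded_iff imageI)
  then obtain L where L: "L > 0" "\<And>u. u \<in> {0..1} \<Longrightarrow> norm (D u) \<le> L"
    by (meson max.coboundedI2 max.strict_coboundedI1 zero_less_one)
  have "uniformly_continuous_on {0..1} (\<lambda>u. h (\<gamma> u))"
    by (rule compact_uniformly_continuous[OF ch]) auto
  moreover have "e / (2 * L) > 0" using e L by simp
  ultimately obtain d where d: "d > 0"
    "\<And>u u'. u \<in> {0..1} \<Longrightarrow> u' \<in> {0..1} \<Longrightarrow> dist u' u < d \<Longrightarrow> dist (h (\<gamma> u')) (h (\<gamma> u)) < e / (2 * L)"
    by (metis uniformly_continuous_onE)
  obtain m0 :: nat where m0: "m0 > 0" "1 / real m0 < d"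
    using d(1) by (metis nat_approx_posE of_nat_0_less_iff zero_less_Suc)
  let ?S = "\<lambda>m. \<Sum>j<m. h (\<gamma> (real j / real m)) \<bullet> (\<gamma> (real (Suc j) / real m) - \<gamma> (real j / real m))"
  have int: "(\<lambda>u. h (\<gamma> u) \<bullet> D u) integrable_on {0..1}"
    by (intro integrable_continuous_interval continuous_on_inner ch cont_D)
  show "\<exists>no. \<forall>m\<ge>no. norm (?S m - line_integral \<gamma> h) < e"
  proof (intro exI[of _ m0] allI impI)
    fix m assume m: "m \<ge> m0"
    have mpos: "m > 0" using m m0 by simp
    have "1 / real m \<le> 1 / real m0" using m m0 by (auto simp: divide_simps)
    then have md: "1 / real m < d" using m0 by simp
    have "integral {0..0 + real m * (1 / real m)} (\<lambda>u. h (\<gamma> u) \<bullet> D u)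
        = (\<Sum>j<m. integral {0 + real j * (1 / real m)..0 + real (Suc j) * (1 / real m)} (\<lambda>u. h (\<gamma> u) \<bullet> D u))"
      by (rule integral_uniform_partition[OF int, of _ m]) (use mpos in auto)
    then have eq: "line_integral \<gamma> h = (\<Sum>j<m. integral {real j / real m..real (Suc j) / real m} (\<lambda>u. h (\<gamma> u) \<bullet> D u))"
      using mpos line_integral_eq[OF deriv] by simp
    have step: "norm (h (\<gamma> (real j / real m)) \<bullet> (\<gamma> (real (Suc j) / real m) - \<gamma> (real j / real m))
         - integral {real j / real m..real (Suc j) / real m} (\<lambda>u. h (\<gamma> u) \<bullet> D u)) \<le> e / 2 * (1 / real m)"
      if j: "j < m" for j
    proof -
      let ?u = "real j / real m" and ?u' = "real (Suc j) / real m"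
      have uu: "?u \<in> {0..1}" "?u' \<in> {0..1}" using j grid_in_unit[of j m] grid_in_unit[of "Suc j" m] by auto
      have le: "?u \<le> ?u'" by (simp add: divide_right_mono)
      have sub: "{?u..?u'} \<subseteq> {0..1}" using uu by auto
      have "(D has_integral (\<gamma> ?u' - \<gamma> ?u)) {?u..?u'}"
        by (rule fundamental_theorem_of_calculus[OF le], rule has_vector_derivative_within_subset[OF deriv sub])
          (rule subsetD[OF sub])
      then have "((\<lambda>u. h (\<gamma> ?u) \<bullet> D u) has_integral h (\<gamma> ?u) \<bullet> (\<gamma> ?u' - \<gamma> ?u)) {?u..?u'}"
        using has_integral_linear[OF _ bounded_linear_inner_right, of D] by (simp add: o_def)
      moreover have "((\<lambda>u. h (\<gamma> u) \<bullet> D u) has_integral integral {?u..?u'} (\<lambda>u. h (\<gamma> u) \<bullet> D u)) {?u..?u'}"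
        using integrable_on_subinterval[OF int sub] by (rule integrable_integral)
      ultimately have "((\<lambda>u. h (\<gamma> ?u) \<bullet> D u - h (\<gamma> u) \<bullet> D u) has_integral
          (h (\<gamma> ?u) \<bullet> (\<gamma> ?u' - \<gamma> ?u) - integral {?u..?u'} (\<lambda>u. h (\<gamma> u) \<bullet> D u))) {?u..?u'}"
        by (rule has_integral_diff)
      then have "norm (h (\<gamma> ?u) \<bullet> (\<gamma> ?u' - \<gamma> ?u) - integral {?u..?u'} (\<lambda>u. h (\<gamma> u) \<bullet> D u))
           \<le> e / 2 * measure lborel {?u..?u'}"
      proof (rule has_integral_bound_real[rotated 2, where S="{}"])
        fix w assume w: "w \<in> {?u..?u'} - {}"
        then have w': "w \<in> {0..1}" using subsetD[OF sub, of w] by simp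
        have "\<bar>?u - w\<bar> \<le> 1 / real m" using w by (auto simp: add_divide_distrib)
        then have "norm (h (\<gamma> ?u) - h (\<gamma> w)) \<le> e / (2 * L)"
          using d(2)[OF w' uu(1)] md by (auto simp: dist_norm dist_real_def)
        then have "norm (h (\<gamma> ?u) - h (\<gamma> w)) * norm (D w) \<le> e / (2 * L) * L"
          using L w' e by (intro mult_mono) auto
        moreover have "norm ((h (\<gamma> ?u) - h (\<gamma> w)) \<bullet> D w) \<le> norm (h (\<gamma> ?u) - h (\<gamma> w)) * norm (D w)"
          by (simp add: Cauchy_Schwarz_ineq2)
        ultimately show "norm (h (\<gamma> ?u) \<bullet> D w - h (\<gamma> w) \<bullet> D w) \<le> e / 2"
          using L by (simp add: inner_diff_left)
      qed (use e in auto)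
      then show ?thesis using le by (simp add: add_divide_distrib)
    qed
    have "norm (?S m - line_integral \<gamma> h) \<le> (\<Sum>j<m. e / 2 * (1 / real m))"
      unfolding eq sum_subtractf[symmetric] by (intro order_trans[OF norm_sum] sum_mono step) simp
    also have "\<dots> < e" using mpos e by simp
    finally show "norm (?S m - line_integral \<gamma> h) < e" .
  qed
qed

end

section \<open>Fields orthogonal to all solenoidal fields have no circulation\<close>

lemma L2_inner_integrable:
  assumes u: "L2_field u" and w: "L2_field w"
  shows "integrable lborel (\<lambda>x. u x \<bullet> w x)"
proof (rule Bochner_Integration.integrable_bound)
  show "integrable lborel (\<lambda>x. (norm (u x))\<^sup>2 + (norm (w x))\<^sup>2)"
    using u w by (auto simp: L2_field_def)
  show "(\<lambda>x. u x \<bullet> w x) \<in> borel_measurable lborel"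
    using u w by (auto simp: L2_field_def)
  have "\<bar>u x \<bullet> w x\<bar> \<le> (norm (u x))\<^sup>2 + (norm (w x))\<^sup>2" for x
  proof -
    have "\<bar>u x \<bullet> w x\<bar> \<le> norm (u x) * norm (w x)" by (rule Cauchy_Schwarz_ineq2)
    also have "\<dots> \<le> 2 * (norm (u x) * norm (w x))" by simp
    also have "\<dots> \<le> (norm (u x))\<^sup>2 + (norm (w x))\<^sup>2"
      using sum_squares_bound[of "norm (u x)" "norm (w x)"] by (simp add: mult.assoc)
    finally show ?thesis .
  qed
  then show "AE x in lborel. norm (u x \<bullet> w x) \<le> norm ((norm (u x))\<^sup>2 + (norm (w x))\<^sup>2)" by auto
qed

lemma integrable_bounded_support:
  fixes k :: "'x::euclidean_space \<Rightarrow> 'b::{banach, second_countable_topology}"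
  assumes "k \<in> borel_measurable borel" "\<And>x. norm x > R \<Longrightarrow> k x = 0" "\<And>x. norm (k x) \<le> C"
  shows "integrable lborel k"
proof -
  have "integrable lborel (\<lambda>x::'x. indicator (cball 0 R) x *\<^sub>R C :: real)"
    using emeasure_bounded_finite[OF bounded_cball, of "0::'x" R]
    by (intro integrable_scaleR_left) (auto simp: integrable_indicator_iff)
  then show ?thesis
  proof (rule Bochner_Integration.integrable_bound)
    show "k \<in> borel_measurable lborel" using assms(1) by simp
    show "AE x in lborel. norm (k x) \<le> norm (indicator (cball 0 R) x *\<^sub>R C)"
    proof (intro AE_I2)
      fix x show "norm (k x) \<le> norm (indicator (cball 0 R) x *\<^sub>R C)"
        using assms(2)[of x] assms(3)[of x] by (auto simp: indicator_def)
    qed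
  qed
qed

lemma lborel_integral_translation:
  fixes k :: "'x::euclidean_space \<Rightarrow> 'b::{banach, second_countable_topology}"
  assumes [measurable]: "k \<in> borel_measurable borel"
  shows "(\<integral>x. k x \<partial>lborel) = (\<integral>x. k (c + x) \<partial>lborel)"
proof -
  have "(\<integral>x. k x \<partial>lborel) = (\<integral>x. k x \<partial>distr lborel borel ((+) c))" by (simp add: lborel_distr_plus)
  also have "\<dots> = (\<integral>x. k (c + x) \<partial>lborel)" by (rule integral_distr) simp_all
  finally show ?thesis .
qed

context C1_curve
begin

text \<open>The curve and its tangent are extended by zero so that integrals over the parameter can be taken
over the whole line and Fubini's theorem applies to Lebesgue measure directly.\<close>

definition "\<gamma>\<^sub>0 u = indicator {0..1} u *\<^sub>R \<gamma> u"
definition "D\<^sub>0 u = indicator {0..1} u *\<^sub>R D u"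

text \<open>The current of integration along the curve, convolved with the indicator function of a ball.
Solenoidal fields are defined weakly, so this bounded field with compact support is an admissible
test field although it is not smooth.\<close>

definition smeared_tangent :: "real \<Rightarrow> real^'n \<Rightarrow> real^'n" where
  "smeared_tangent \<epsilon> x = (\<integral>u. indicator (ball 0 \<epsilon>) (x - \<gamma>\<^sub>0 u) *\<^sub>R D\<^sub>0 u \<partial>lborel)"

lemma measurable_extensions [measurable]: "\<gamma>\<^sub>0 \<in> borel_measurable borel" "D\<^sub>0 \<in> borel_measurable borel"
  unfolding \<gamma>\<^sub>0_def[abs_def] D\<^sub>0_def[abs_def]
  by (auto intro!: borel_measurable_continuous_on_indicator cont cont_D)

lemma bounds:
  obtains C where "C > 0" "\<And>u. norm (\<gamma>\<^sub>0 u) \<le> C" "\<And>u. norm (D\<^sub>0 u) \<le> C"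
proof -
  have "bounded (\<gamma> ` {0..1})" "bounded (D ` {0..1})"
    by (auto intro!: compact_imp_bounded compact_continuous_image cont cont_D)
  then obtain C1 C2 where "\<And>u. u \<in> {0..1} \<Longrightarrow> norm (\<gamma> u) \<le> C1" "\<And>u. u \<in> {0..1} \<Longrightarrow> norm (D u) \<le> C2"
    unfolding bounded_iff by (meson imageI)
  then have "norm (\<gamma>\<^sub>0 u) \<le> max 1 (max C1 C2)" "norm (D\<^sub>0 u) \<le> max 1 (max C1 C2)" for u
    by (auto simp: \<gamma>\<^sub>0_def D\<^sub>0_def indicator_def intro: max.coboundedI1 max.coboundedI2)
  then show thesis by (intro that[of "max 1 (max C1 C2)"]) auto
qed

lemma translate: "C1_curve (\<lambda>u. z + \<gamma> u) D"
  by unfold_locales (auto intro!: derivative_eq_intros deriv cont_D simp: has_vector_derivative_def[symmetric])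

lemma line_integral_translate:
  assumes q: "continuous_on UNIV q"
  shows "line_integral (\<lambda>u. z + \<gamma> u) q = (\<integral>u. q (z + \<gamma>\<^sub>0 u) \<bullet> D\<^sub>0 u \<partial>lborel)"
proof -
  interpret T: C1_curve "\<lambda>u. z + \<gamma> u" D by (rule translate)
  have "continuous_on {0..1} (\<lambda>u. q (z + \<gamma> u) \<bullet> D u)"
    by (intro continuous_on_inner continuous_on_compose2[OF q T.cont] cont_D) auto
  then have "set_integrable lborel {0..1} (\<lambda>u. q (z + \<gamma> u) \<bullet> D u)"
    unfolding set_integrable_def by (intro borel_integrable_compact) auto
  then have "(LINT u:{0..1}|lborel. q (z + \<gamma> u) \<bullet> D u) = integral {0..1} (\<lambda>u. q (z + \<gamma> u) \<bullet> D u)"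
    by (rule set_borel_integral_eq_integral)
  moreover have "(LINT u:{0..1}|lborel. q (z + \<gamma> u) \<bullet> D u) = (\<integral>u. q (z + \<gamma>\<^sub>0 u) \<bullet> D\<^sub>0 u \<partial>lborel)"
    unfolding set_lebesgue_integral_def
    by (intro Bochner_Integration.integral_cong) (auto simp: \<gamma>\<^sub>0_def D\<^sub>0_def indicator_def)
  ultimately show ?thesis using line_integral_eq[OF T.deriv, of q] by simp
qed

text \<open>Pairing a field with the smeared current averages its circulation over the translates of the curve:
this is Fubini's theorem and the translation invariance of Lebesgue measure.\<close>

lemma smeared_pairing:
  fixes q :: "real^'n \<Rightarrow> real^'n"
  assumes q: "continuous_on UNIV q" and \<epsilon>: "\<epsilon> > 0"
  shows "(\<integral>x. q x \<bullet> smeared_tangent \<epsilon> x \<partial>lborel)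
       = (\<integral>z. indicator (ball 0 \<epsilon>) z * line_integral (\<lambda>u. z + \<gamma> u) q \<partial>lborel)"
proof -
  obtain C where C: "C > 0" "\<And>u. norm (\<gamma>\<^sub>0 u) \<le> C" "\<And>u. norm (D\<^sub>0 u) \<le> C" by (rule bounds) blast
  have [measurable]: "ball (0::real^'n) \<epsilon> \<in> sets borel" by simp
  have [measurable]: "q \<in> borel_measurable borel" using q by (rule borel_measurable_continuous_onI)
  have "compact (q ` cball 0 (\<epsilon> + C))" by (intro compact_continuous_image continuous_on_subset[OF q]) auto
  then obtain K where K: "\<And>x. norm x \<le> \<epsilon> + C \<Longrightarrow> norm (q x) \<le> K"
    using compact_imp_bounded bounded_iff by (metis imageI mem_cball_0)
  have K0: "K \<ge> 0" using order_trans[OF norm_ge_zero K[of 0]] C \<epsilon> by simp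
  have D0: "D\<^sub>0 u = 0" if "\<bar>u\<bar> > 1" for u using that by (auto simp: D\<^sub>0_def indicator_def)
  let ?k = "\<lambda>x u. indicator (ball 0 \<epsilon>) (x - \<gamma>\<^sub>0 u) * (q x \<bullet> D\<^sub>0 u) :: real"
  let ?l = "\<lambda>z u. indicator (ball 0 \<epsilon>) z * (q (z + \<gamma>\<^sub>0 u) \<bullet> D\<^sub>0 u) :: real"
  have nrm: "norm x > R \<or> \<bar>u\<bar> > 1" if "norm (x, u) > R + 1" for x :: "real^'n" and u :: real and R
    using that norm_Pair_le[of x u] by auto
  have inn: "\<bar>q y \<bullet> D\<^sub>0 u\<bar> \<le> K * C" if "norm y \<le> \<epsilon> + C" for y u
    using Cauchy_Schwarz_ineq2[of "q y" "D\<^sub>0 u"] mult_mono[OF K[OF that] C(3)[of u]] K0 by auto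
  have small: "norm x \<le> \<epsilon> + C" if "norm (x - \<gamma>\<^sub>0 u) < \<epsilon>" for x u
    using norm_triangle_sub[of x "\<gamma>\<^sub>0 u"] that C(2)[of u] by linarith
  have ik: "integrable (lborel \<Otimes>\<^sub>M lborel) (case_prod ?k)"
    unfolding lborel_prod
  proof (rule integrable_bounded_support[where R="\<epsilon> + C + 1" and C="K * C"])
    show "(\<lambda>(x, u). ?k x u) \<in> borel_measurable borel"
      unfolding borel_prod[symmetric] by measurable
    fix p :: "(real^'n) \<times> real"
    obtain x u where p: "p = (x, u)" by (cases p)
    show "case_prod ?k p = 0" if "norm p > \<epsilon> + C + 1"
      using nrm[OF that[unfolded p]] small[of x u] D0[of u] by (auto simp: p indicator_def)
    show "norm (case_prod ?k p) \<le> K * C"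
      using small[of x u] inn[of x u] K0 C(1) by (auto simp: p indicator_def)
  qed
  have il: "integrable (lborel \<Otimes>\<^sub>M lborel) (case_prod ?l)"
    unfolding lborel_prod
  proof (rule integrable_bounded_support[where R="\<epsilon> + 1" and C="K * C"])
    show "(\<lambda>(x, u). ?l x u) \<in> borel_measurable borel"
      unfolding borel_prod[symmetric] by measurable
    fix p :: "(real^'n) \<times> real"
    obtain x u where p: "p = (x, u)" by (cases p)
    show "case_prod ?l p = 0" if "norm p > \<epsilon> + 1"
      using nrm[OF that[unfolded p]] D0[of u] by (auto simp: p indicator_def)
    show "norm (case_prod ?l p) \<le> K * C"
      using small[of "x + \<gamma>\<^sub>0 u" u] inn[of "x + \<gamma>\<^sub>0 u" u] K0 C(1) by (auto simp: p indicator_def)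
  qed
  have intD: "integrable lborel (\<lambda>u. indicator (ball 0 \<epsilon>) (x - \<gamma>\<^sub>0 u) *\<^sub>R D\<^sub>0 u)" for x
    by (rule integrable_bounded_support[where R=1 and C=C])
      (use C D0 in \<open>auto simp: indicator_def\<close>)
  have "(\<integral>x. q x \<bullet> smeared_tangent \<epsilon> x \<partial>lborel) = (\<integral>x. (\<integral>u. ?k x u \<partial>lborel) \<partial>lborel)"
    unfolding smeared_tangent_def
    by (subst integral_inner_right[symmetric]) (use intD in \<open>auto simp: inner_scaleR_right\<close>)
  also have "\<dots> = (\<integral>u. (\<integral>x. ?k x u \<partial>lborel) \<partial>lborel)"
    using lborel_pair.Fubini_integral[OF ik] by simp
  also have "\<dots> = (\<integral>u. (\<integral>z. ?l z u \<partial>lborel) \<partial>lborel)"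
  proof (rule Bochner_Integration.integral_cong[OF refl])
    fix u
    show "(\<integral>x. ?k x u \<partial>lborel) = (\<integral>z. ?l z u \<partial>lborel)"
      using lborel_integral_translation[of "\<lambda>x. ?k x u" "\<gamma>\<^sub>0 u"] by (simp add: add.commute)
  qed
  also have "\<dots> = (\<integral>z. (\<integral>u. ?l z u \<partial>lborel) \<partial>lborel)"
    using lborel_pair.Fubini_integral[OF il] by simp
  also have "\<dots> = (\<integral>z. indicator (ball 0 \<epsilon>) z * line_integral (\<lambda>u. z + \<gamma> u) q \<partial>lborel)"
    by (simp add: line_integral_translate[OF q])
  finally show ?thesis .
qed

lemma line_integral_gradient:
  assumes closed: "\<gamma> 1 = \<gamma> 0" and d: "\<And>x. \<phi> differentiable (at x)"
  shows "line_integral \<gamma> (\<lambda>x. \<chi> j. partial j \<phi> x) = (0::real)"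
proof -
  have "((\<lambda>u. \<phi> (\<gamma> u)) has_vector_derivative (\<chi> j. partial j \<phi> (\<gamma> u)) \<bullet> D u) (at u within {0..1})" if "u \<in> {0..1}" for u
  proof -
    have "((\<lambda>u. \<phi> (\<gamma> u)) has_derivative (\<lambda>h. \<Sum>j\<in>UNIV. ((h *\<^sub>R D u) $ j) *\<^sub>R partial j \<phi> (\<gamma> u))) (at u within {0..1})"
      using has_derivative_compose[OF deriv[OF that, unfolded has_vector_derivative_def] has_derivative_partial[OF d]] .
    then show ?thesis
      by (simp add: has_vector_derivative_def inner_vec_def sum_distrib_left mult_ac)
  qed
  from fundamental_theorem_of_calculus[OF _ this]
  have "((\<lambda>u. (\<chi> j. partial j \<phi> (\<gamma> u)) \<bullet> D u) has_integral (\<phi> (\<gamma> 1) - \<phi> (\<gamma> 0))) {0..1}" by simp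
  then show ?thesis using closed line_integral_eq[OF deriv] by (simp add: integral_unique)
qed

text \<open>By \<open>smeared_pairing\<close>, pairing with a gradient gives an average of circulations of the
gradient around closed curves, all of which vanish.\<close>

lemma smeared_tangent_solenoidal:
  assumes closed: "\<gamma> 1 = \<gamma> 0" and \<epsilon>: "\<epsilon> > 0"
  shows "L2_solenoidal (smeared_tangent \<epsilon>)"
proof -
  obtain C where C: "C > 0" "\<And>u. norm (\<gamma>\<^sub>0 u) \<le> C" "\<And>u. norm (D\<^sub>0 u) \<le> C" by (rule bounds) blast
  have [measurable]: "ball (0::real^'n) \<epsilon> \<in> sets borel" by simp
  have [measurable]: "smeared_tangent \<epsilon> \<in> borel_measurable borel"
    unfolding smeared_tangent_def[abs_def] by measurable
  have bd: "norm (smeared_tangent \<epsilon> x) \<le> C" for x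
  proof -
    have "norm (smeared_tangent \<epsilon> x) \<le> (\<integral>u. indicator {0..1::real} u * C \<partial>lborel)"
      unfolding smeared_tangent_def
    proof (rule Bochner_Integration.integral_norm_bound_integral)
      show "integrable lborel (\<lambda>u. indicator (ball 0 \<epsilon>) (x - \<gamma>\<^sub>0 u) *\<^sub>R D\<^sub>0 u)"
      proof (rule integrable_bounded_support[where R=1 and C=C])
        show "(\<lambda>u. indicator (ball 0 \<epsilon>) (x - \<gamma>\<^sub>0 u) *\<^sub>R D\<^sub>0 u) \<in> borel_measurable borel" by measurable
        show "indicator (ball 0 \<epsilon>) (x - \<gamma>\<^sub>0 u) *\<^sub>R D\<^sub>0 u = 0" if "norm u > 1" for u
          using that by (auto simp: D\<^sub>0_def indicator_def)
        show "norm (indicator (ball 0 \<epsilon>) (x - \<gamma>\<^sub>0 u) *\<^sub>R D\<^sub>0 u) \<le> C" for u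
          using C(1) C(3)[of u] by (simp add: indicator_def)
      qed
      show "norm (indicator (ball 0 \<epsilon>) (x - \<gamma>\<^sub>0 u) *\<^sub>R D\<^sub>0 u) \<le> indicator {0..1} u * C" for u
        using C(1) C(3)[of u] by (cases "u \<in> {0..1}") (auto simp: D\<^sub>0_def indicator_def)
    qed auto
    then show ?thesis by simp
  qed
  have supp: "smeared_tangent \<epsilon> x = 0" if "norm x > \<epsilon> + C" for x
  proof -
    have "indicator (ball 0 \<epsilon>) (x - \<gamma>\<^sub>0 u) = (0::real)" for u
      using that C(2)[of u] norm_triangle_sub[of x "\<gamma>\<^sub>0 u"] by (auto simp: indicator_def)
    then show ?thesis by (simp add: smeared_tangent_def)
  qed
  have "integrable lborel (\<lambda>x. (norm (smeared_tangent \<epsilon> x))\<^sup>2)"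
    by (rule integrable_bounded_support[where R="\<epsilon> + C" and C="C\<^sup>2"])
      (use bd supp in \<open>auto intro!: power_mono\<close>)
  then have L2: "L2_field (smeared_tangent \<epsilon>)" by (simp add: L2_field_def)
  show ?thesis unfolding L2_solenoidal_def
  proof (intro conjI L2 allI impI)
    fix \<phi> :: "real^'n \<Rightarrow> real" assume "test_function \<phi>"
    then have "Ck (Suc 0) \<phi>" unfolding test_function_def by blast
    then have d: "\<And>x. \<phi> differentiable (at x)" and c: "\<And>j. continuous_on UNIV (partial j \<phi>)" by auto
    have c': "continuous_on UNIV (\<lambda>x. \<chi> j. partial j \<phi> x)" by (intro continuous_on_vec_lambda c)
    have "(\<integral>x. (\<Sum>j\<in>UNIV. smeared_tangent \<epsilon> x $ j * partial j \<phi> x) \<partial>lborel)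
       = (\<integral>x. (\<chi> j. partial j \<phi> x) \<bullet> smeared_tangent \<epsilon> x \<partial>lborel)"
      by (simp add: inner_vec_def mult.commute)
    also have "\<dots> = 0"
    proof -
      have "line_integral (\<lambda>u. z + \<gamma> u) (\<lambda>x. \<chi> j. partial j \<phi> x) = (0::real)" for z
        by (rule C1_curve.line_integral_gradient[OF translate]) (use closed d in auto)
      then show ?thesis by (subst smeared_pairing[OF c' \<epsilon>]) simp
    qed
    finally show "(\<integral>x. (\<Sum>j\<in>UNIV. smeared_tangent \<epsilon> x $ j * partial j \<phi> x) \<partial>lborel) = 0" .
  qed
qed

text \<open>The averages of the circulation over the translates by \<open>z\<close> with $|z| < \epsilon$ vanish
for every $\epsilon$. The circulation depends continuously on \<open>z\<close>, so it vanishes at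
\<open>z = 0\<close>.\<close>

lemma line_integral_zero_of_orthogonal:
  assumes closed: "\<gamma> 1 = \<gamma> 0" and q: "continuous_on UNIV q"
    and orth: "\<And>h. L2_solenoidal h \<Longrightarrow> (\<integral>x. q x \<bullet> h x \<partial>lborel) = 0"
  shows "line_integral \<gamma> q = 0"
proof (rule ccontr)
  define \<Lambda> where "\<Lambda> z = line_integral (\<lambda>u. z + \<gamma> u) q" for z
  assume "line_integral \<gamma> q \<noteq> 0"
  then have nz: "\<Lambda> 0 \<noteq> 0" by (simp add: \<Lambda>_def)
  have "continuous_on UNIV \<Lambda>"
  proof -
    have "continuous_on (UNIV \<times> cbox 0 1) (\<lambda>(z, u). q (z + \<gamma> u) \<bullet> D u)"
      unfolding split_beta
      by (intro continuous_on_inner continuous_on_compose2[OF q] continuous_on_add continuous_intros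
          continuous_on_compose2[OF cont] continuous_on_compose2[OF cont_D]) auto
    then have "continuous_on UNIV (\<lambda>z. integral (cbox 0 1) (\<lambda>u. q (z + \<gamma> u) \<bullet> D u))"
      by (rule integral_continuous_on_param)
    then show ?thesis
      using line_integral_eq[OF C1_curve.deriv[OF translate], of _ q] by (simp add: \<Lambda>_def[abs_def])
  qed
  then have "isCont \<Lambda> 0" by (simp add: continuous_on_eq_continuous_at)
  moreover have "\<bar>\<Lambda> 0\<bar> / 2 > 0" using nz by simp
  \<comment> \<open>on this ball the circulation of the translates is closer to its value at the centre than half of that value, so it cannot average to zero\<close>
  ultimately obtain \<epsilon> where \<epsilon>: "\<epsilon> > 0" "\<And>z. norm z < \<epsilon> \<Longrightarrow> \<bar>\<Lambda> z - \<Lambda> 0\<bar> < \<bar>\<Lambda> 0\<bar> / 2"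
    unfolding continuous_at_eps_delta by (metis dist_0_norm dist_norm norm_minus_commute real_norm_def diff_zero)
  have [measurable]: "\<Lambda> \<in> borel_measurable borel"
    using \<open>continuous_on UNIV \<Lambda>\<close> by (rule borel_measurable_continuous_onI)
  have z: "(\<integral>z. indicator (ball 0 \<epsilon>) z * \<Lambda> z \<partial>lborel) = 0"
    using smeared_pairing[OF q \<epsilon>(1)] orth[OF smeared_tangent_solenoidal[OF closed \<epsilon>(1)]] by (simp add: \<Lambda>_def)
  let ?B = "ball 0 \<epsilon> :: (real^'n) set"
  have vol: "measure lborel ?B > 0" using content_ball_pos[OF \<epsilon>(1), of "0::real^'n"] by simp
  have i1: "integrable lborel (\<lambda>z. indicator ?B z * (\<Lambda> z - \<Lambda> 0))"
    by (rule integrable_bounded_support[where R=\<epsilon> and C="\<bar>\<Lambda> 0\<bar> / 2"])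
      (use \<epsilon> in \<open>auto simp: indicator_def less_imp_le\<close>)
  have i2: "integrable lborel (\<lambda>z. indicator ?B z * c)" for c :: real
    by (rule integrable_bounded_support[where R=\<epsilon> and C="\<bar>c\<bar>"])
      (auto simp: indicator_def)
  have "(\<integral>z. indicator ?B z * (\<Lambda> z - \<Lambda> 0) \<partial>lborel) + (\<integral>z. indicator ?B z * \<Lambda> 0 \<partial>lborel)
      = (\<integral>z. indicator ?B z * \<Lambda> z \<partial>lborel)"
    by (subst Bochner_Integration.integral_add[OF i1 i2, symmetric]) (simp add: algebra_simps)
  then have eq: "(\<integral>z. indicator ?B z * (\<Lambda> z - \<Lambda> 0) \<partial>lborel) = - (measure lborel ?B * \<Lambda> 0)"
    using z by simp
  have "\<bar>\<integral>z. indicator ?B z * (\<Lambda> z - \<Lambda> 0) \<partial>lborel\<bar> \<le> (\<integral>z. indicator ?B z * (\<bar>\<Lambda> 0\<bar> / 2) \<partial>lborel)"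
    unfolding real_norm_def[symmetric]
    by (rule Bochner_Integration.integral_norm_bound_integral[OF i1 i2]) (use \<epsilon> in \<open>auto simp: indicator_def less_imp_le\<close>)
  then have "measure lborel ?B * \<bar>\<Lambda> 0\<bar> \<le> measure lborel ?B * (\<bar>\<Lambda> 0\<bar> / 2)"
    unfolding eq by (simp add: abs_mult)
  then have "\<bar>\<Lambda> 0\<bar> \<le> \<bar>\<Lambda> 0\<bar> / 2" unfolding mult_le_cancel_left_pos[OF vol] .
  then show False using nz by simp
qed

end

text \<open>Both contributions to the defect have the form $u - \mathrm{P}u$: the viscous term with $u =
\triangle G$, because $-w = \mathrm{P}\triangle G$, and the transport term with $u = A$. The
equation for \<open>G'\<close> holds almost everywhere only, but the defect is continuous, so its
circulation is determined by integrals against $L^2$ fields.\<close>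

lemma circulation_of_helmholtz_defect:
  fixes \<gamma> :: "real \<Rightarrow> real^'n::finite"
  assumes loop: "C1_loop \<gamma>"
    and st: "stokes G w" and he: "helmholtz A p" and eq: "AE x in lborel. G' x = - \<nu> *\<^sub>R w x + p x"
    and c: "continuous_on UNIV (laplacian G)" "continuous_on UNIV A" "continuous_on UNIV G'"
  shows "line_integral \<gamma> (\<lambda>x. \<nu> *\<^sub>R laplacian G x + A x - G' x) = 0"
proof -
  from loop obtain D where "\<And>u. u \<in> {0..1} \<Longrightarrow> (\<gamma> has_vector_derivative D u) (at u within {0..1})"
      "continuous_on {0..1} D" and closed: "\<gamma> 1 = \<gamma> 0"
    unfolding C1_loop_def pathfinish_def pathstart_def by blast
  then interpret C1_curve \<gamma> D by unfold_locales
  let ?q = "\<lambda>x. \<nu> *\<^sub>R laplacian G x + A x - G' x"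
  show ?thesis
  proof (rule line_integral_zero_of_orthogonal[OF closed])
    show "continuous_on UNIV ?q" by (intro continuous_intros c)
    fix h :: "real^'n \<Rightarrow> real^'n" assume h: "L2_solenoidal h"
    then have hL2: "L2_field h" by (simp add: L2_solenoidal_def)
    have L2: "L2_field (laplacian G)" "L2_field (\<lambda>x. - w x)" "L2_field A" "L2_field p"
      using st he by (auto simp: stokes_def helmholtz_def L2_solenoidal_def)
    note i = this[THEN L2_inner_integrable, OF hL2]
    have o1: "(\<integral>x. (laplacian G x - (- w x)) \<bullet> h x \<partial>lborel) = 0" and o2: "(\<integral>x. (A x - p x) \<bullet> h x \<partial>lborel) = 0"
      using st he h by (auto simp: stokes_def helmholtz_def)
    have i1: "integrable lborel (\<lambda>x. (laplacian G x - (- w x)) \<bullet> h x)"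
      unfolding inner_diff_left by (intro Bochner_Integration.integrable_diff i)
    have i2: "integrable lborel (\<lambda>x. (A x - p x) \<bullet> h x)"
      unfolding inner_diff_left by (intro Bochner_Integration.integrable_diff i)
    have [measurable]: "laplacian G \<in> borel_measurable borel" "A \<in> borel_measurable borel"
      "G' \<in> borel_measurable borel" "h \<in> borel_measurable borel"
      using c hL2 by (auto simp: L2_field_def intro: borel_measurable_continuous_onI)
    have "(\<integral>x. ?q x \<bullet> h x \<partial>lborel) = (\<integral>x. \<nu> * ((laplacian G x - (- w x)) \<bullet> h x) + (A x - p x) \<bullet> h x \<partial>lborel)"
    proof (rule integral_cong_AE)
      show "AE x in lborel. ?q x \<bullet> h x = \<nu> * ((laplacian G x - (- w x)) \<bullet> h x) + (A x - p x) \<bullet> h x"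
        using eq
      proof eventually_elim
        case (elim x)
        then have "p x = G' x + \<nu> *\<^sub>R w x" by simp
        then show ?case by (simp add: inner_diff_left inner_add_left algebra_simps)
      qed
      show "(\<lambda>x. \<nu> * ((laplacian G x - (- w x)) \<bullet> h x) + (A x - p x) \<bullet> h x) \<in> borel_measurable lborel"
        using i1 i2 by (intro borel_measurable_add borel_measurable_times borel_measurable_const) (auto dest: borel_measurable_integrable)
    qed simp
    also have "\<dots> = \<nu> * (\<integral>x. (laplacian G x - (- w x)) \<bullet> h x \<partial>lborel) + (\<integral>x. (A x - p x) \<bullet> h x \<partial>lborel)"
      by (subst Bochner_Integration.integral_add) (use i1 i2 in simp_all)
    also have "\<dots> = 0" using o1 o2 by simp
    finally show "(\<integral>x. ?q x \<bullet> h x \<partial>lborel) = 0" .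
  qed
qed

section \<open>Integrable Lipschitz bounds, Gronwall estimate and completeness\<close>

text \<open>Gronwall's inequality with an integrable rate \<open>g\<close>. The constant \<open>K\<close>
depends on \<open>g\<close> only. On an interval with $\int g \le 1/2$ the maximum of
\<open>\<phi>\<close> is at most twice its initial value; the whole interval is covered by finitely
many of these. The hypothesis is stated through bounds \<open>C\<close> for \<open>\<phi>\<close>
rather than through $\int g\phi$, so that no product with a merely continuous bound has to be
integrated.\<close>

lemma gronwall_partition:
  fixes g :: "real \<Rightarrow> real"
  assumes ab: "a \<le> b" and g: "g integrable_on {a..b}" "\<And>r. 0 \<le> g r"
  obtains K where "K > 0"
    "\<And>\<phi> t. \<lbrakk>continuous_on {a..b} \<phi>; \<And>r. r \<in> {a..b} \<Longrightarrow> 0 \<le> \<phi> r;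
        \<And>t t' C. \<lbrakk>a \<le> t; t \<le> t'; t' \<le> b; \<And>r. r \<in> {t..t'} \<Longrightarrow> \<phi> r \<le> C\<rbrakk> \<Longrightarrow> \<phi> t' \<le> \<phi> t + C * integral {t..t'} g;
        t \<in> {a..b}\<rbrakk> \<Longrightarrow> \<phi> t \<le> K * (\<phi> a :: real)"
proof -
  have "uniformly_continuous_on {a..b} (\<lambda>t. integral {a..t} g)"
    by (intro compact_uniformly_continuous indefinite_integral_continuous_1 g) auto
  then obtain d where d: "d > 0" "\<And>t t'. t \<in> {a..b} \<Longrightarrow> t' \<in> {a..b} \<Longrightarrow> dist t' t < d \<Longrightarrow>
      dist (integral {a..t'} g) (integral {a..t} g) < 1/2"
    by (rule uniformly_continuous_onE[of _ _ "1/2"]) auto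
  define \<delta> where "\<delta> = d / 2"
  have \<delta>: "\<delta> > 0" using d by (simp add: \<delta>_def)
  have small: "integral {t..t'} g \<le> 1/2" if "a \<le> t" "t \<le> t'" "t' \<le> b" "t' - t \<le> \<delta>" for t t'
  proof -
    have "integral {a..t} g + integral {t..t'} g = integral {a..t'} g"
      by (intro Henstock_Kurzweil_Integration.integral_combine integrable_on_subinterval[OF g(1)]) (use that in auto)
    moreover have "dist (integral {a..t'} g) (integral {a..t} g) < 1/2"
      by (rule d(2)) (use that \<delta> in \<open>auto simp: \<delta>_def dist_real_def\<close>)
    ultimately show ?thesis unfolding dist_real_def by linarith
  qed
  obtain N :: nat where N: "(b - a) / \<delta> \<le> real N" using real_arch_simple by blast
  show thesis
  proof (rule that[of "2 ^ Suc N"])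
    fix \<phi> :: "real \<Rightarrow> real" and t
    assume \<phi>: "continuous_on {a..b} \<phi>" "\<And>r. r \<in> {a..b} \<Longrightarrow> 0 \<le> \<phi> r"
      and inc: "\<And>t t' C. \<lbrakk>a \<le> t; t \<le> t'; t' \<le> b; \<And>r. r \<in> {t..t'} \<Longrightarrow> \<phi> r \<le> C\<rbrakk> \<Longrightarrow> \<phi> t' \<le> \<phi> t + C * integral {t..t'} g"
      and t: "t \<in> {a..b}"
    have dbl: "\<phi> t' \<le> 2 * \<phi> t" if tt: "a \<le> t" "t \<le> t'" "t' \<le> b" "t' - t \<le> \<delta>" for t t'
    proof -
      have "\<exists>r\<in>{t..t'}. \<forall>w\<in>{t..t'}. \<phi> w \<le> \<phi> r"
        by (rule continuous_attains_sup) (use tt in \<open>auto intro: continuous_on_subset[OF \<phi>(1)]\<close>)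
      then obtain r where r: "r \<in> {t..t'}" "\<And>w. w \<in> {t..t'} \<Longrightarrow> \<phi> w \<le> \<phi> r" by blast
      have "\<phi> r \<le> \<phi> t + \<phi> r * integral {t..r} g" by (rule inc) (use r tt in auto)
      also have "\<dots> \<le> \<phi> t + \<phi> r * (1/2)"
        by (intro add_left_mono mult_left_mono small) (use r tt \<phi>(2)[of r] in auto)
      finally have "\<phi> r \<le> 2 * \<phi> t" by simp
      then show ?thesis using r(2)[of t'] tt by auto
    qed
    have ind: "\<phi> t \<le> 2 ^ Suc n * \<phi> a" if "t \<in> {a..b}" "t \<le> a + real n * \<delta>" for n t
      using that
    proof (induction n arbitrary: t)
      case 0 then show ?case using \<phi>(2)[of a] ab by auto
    next
      case (Suc n)
      show ?case
      proof (cases "t \<le> a + \<delta>")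
        case True
        then have "\<phi> t \<le> 2 * \<phi> a" using Suc.prems by (intro dbl) auto
        also have "\<dots> \<le> 2 ^ Suc (Suc n) * \<phi> a" using \<phi>(2)[of a] ab one_le_power[of "2::real" "Suc n"]
          by (intro mult_right_mono) auto
        finally show ?thesis .
      next
        case False
        have "\<phi> t \<le> 2 * \<phi> (t - \<delta>)" using False Suc.prems \<delta> by (intro dbl) auto
        also have "\<dots> \<le> 2 * (2 ^ Suc n * \<phi> a)"
          using False Suc.prems \<delta> by (intro mult_left_mono Suc.IH) (auto simp: algebra_simps)
        finally show ?thesis by simp
      qed
    qed
    have "b - a \<le> real N * \<delta>" using N \<delta> by (simp add: field_simps)
    then show "\<phi> t \<le> 2 ^ Suc N * \<phi> a" using t by (intro ind) auto
  qed simp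
qed

lemma Cb1_bounds:
  fixes f :: "real^'n::finite \<Rightarrow> real^'n"
  assumes "f \<in> Cb1 \<alpha>"
  shows "ennreal (norm (f x)) \<le> Cb1_norm \<alpha> f"
    and "ennreal (norm (f x - f y) / norm (x - y)) \<le> Cb1_norm \<alpha> f"
    and "continuous_on UNIV f"
proof -
  show "ennreal (norm (f x)) \<le> Cb1_norm \<alpha> f"
    unfolding Cb1_norm_def by (intro add_increasing2 SUP_upper) auto
  from assms have d: "\<And>x. f differentiable (at x)" and fin: "Cb1_norm \<alpha> f < \<infinity>" by (auto simp: Cb1_def)
  then show "continuous_on UNIV f"
    by (auto simp: continuous_on_eq_continuous_at intro: differentiable_imp_continuous_within)
  have sup_le: "(SUP x. ennreal (onorm (frechet_derivative f (at x)))) \<le> Cb1_norm \<alpha> f"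
    unfolding Cb1_norm_def by (intro add_increasing2 add_increasing) auto
  define B where "B = enn2real (Cb1_norm \<alpha> f)"
  have B: "ennreal B = Cb1_norm \<alpha> f" using fin by (simp add: B_def)
  have on: "onorm (frechet_derivative f (at x)) \<le> B" for x
  proof -
    have "ennreal (onorm (frechet_derivative f (at x))) \<le> ennreal B"
      unfolding B by (rule order_trans[OF SUP_upper sup_le]) simp
    then show ?thesis by (simp add: B_def)
  qed
  have "norm (f x - f y) \<le> B * norm (x - y)"
    by (rule differentiable_bound[where S=UNIV and f'="\<lambda>x. frechet_derivative f (at x)"])
      (use d on in \<open>auto simp: frechet_derivative_works[symmetric]\<close>)
  then have "norm (f x - f y) / norm (x - y) \<le> B"
    by (cases "x = y") (auto simp: divide_simps B_def)
  then show "ennreal (norm (f x - f y) / norm (x - y)) \<le> Cb1_norm \<alpha> f"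
    unfolding B[symmetric] by (rule ennreal_leI)
qed

text \<open>The flow has its good properties only almost surely, but adaptedness is demanded for every
\<open>\<omega>\<close>. A sub-\<open>\<sigma>\<close>-algebra that contains the null sets of a
complete measure does not see the difference.\<close>

lemma measurable_cong_AE_complete:
  fixes f g :: "'x \<Rightarrow> 'b::topological_space"
  assumes "complete_measure M" and N: "space N = space M" "sets N \<subseteq> sets M" "null_sets M \<subseteq> sets N"
    and f: "f \<in> borel_measurable N" and ae: "AE x in M. f x = g x"
  shows "g \<in> borel_measurable N"
proof (rule measurableI)
  interpret complete_measure M by fact
  define Z where "Z = {x \<in> space M. f x \<noteq> g x}"
  have Z: "Z \<in> null_sets M" using ae unfolding AE_iff_null_sets Z_def .
  fix A :: "'b set" assume A: "A \<in> sets borel"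
  have "f -` A \<inter> space N \<in> sets N" using f A by (rule measurable_sets)
  moreover have "g -` A \<inter> Z \<in> null_sets M" using Z by (rule complete2[rotated]) auto
  ultimately have "(f -` A \<inter> space N - Z) \<union> (g -` A \<inter> Z) \<in> sets N"
    using Z N(3) by auto
  also have "(f -` A \<inter> space N - Z) \<union> (g -` A \<inter> Z) = g -` A \<inter> space N"
    using N(1) by (auto simp: Z_def)
  finally show "g -` A \<inter> space N \<in> sets N" .
qed simp

lemma measurable_AE_LIMSEQ_complete:
  fixes f :: "nat \<Rightarrow> 'x \<Rightarrow> 'b::{second_countable_topology, banach}"
  assumes "complete_measure M" and N: "space N = space M" "sets N \<subseteq> sets M" "null_sets M \<subseteq> sets N"
    and f: "\<And>n. f n \<in> borel_measurable N" and ae: "AE x in M. (\<lambda>n. f n x) \<longlonglongrightarrow> g x"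
  shows "g \<in> borel_measurable N"
proof (rule measurable_cong_AE_complete[OF assms(1-4)])
  show "(\<lambda>x. lim (\<lambda>n. f n x)) \<in> borel_measurable N" by (rule borel_measurable_lim_metric[OF f])
  show "AE x in M. lim (\<lambda>n. f n x) = g x" using ae by eventually_elim (rule limI)
qed

lemma complete_measure_lebesgue_on:
  assumes "S \<in> sets lebesgue"
  shows "complete_measure (lebesgue_on S)"
proof
  fix A B assume "A \<subseteq> B" "B \<in> null_sets (lebesgue_on S)"
  then have "A \<subseteq> S" "A \<in> null_sets lebesgue"
    using assms by (auto simp: null_sets_restrict_space intro: completion.complete2)
  then show "A \<in> sets (lebesgue_on S)" using assms by (auto simp: sets_restrict_space_iff null_sets_def)
qed

text \<open>The norm in the definition dominates the supremum norm, so the approximating simple functions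
converge pointwise in \<open>x\<close>.\<close>

lemma L1_Cb1_measurable:
  fixes v :: "real \<Rightarrow> real^'n::finite \<Rightarrow> real^'n"
  assumes "L1_Cb1 T \<alpha> v"
  shows "(\<lambda>t. v t x) \<in> borel_measurable (lebesgue_on {0<..<T})"
proof -
  from assms obtain s :: "nat \<Rightarrow> real \<Rightarrow> real^'n \<Rightarrow> real^'n" where
    s: "\<And>k. simple_function (lebesgue_on {0<..<T}) (s k)"
      "AE t in lebesgue_on {0<..<T}. (\<lambda>k. Cb1_norm \<alpha> (\<lambda>x. v t x - s k t x)) \<longlonglongrightarrow> 0"
    unfolding L1_Cb1_def by blast
  have m: "(\<lambda>t. s k t x) \<in> borel_measurable (lebesgue_on {0<..<T})" for k
    using simple_function_compose1[OF s(1), of "\<lambda>f. f x"] by (rule borel_measurable_simple_function)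
  have "AE t in lebesgue_on {0<..<T}. (\<lambda>k. s k t x) \<longlonglongrightarrow> v t x"
    using s(2)
  proof eventually_elim
    case (elim t)
    have "ennreal (norm (v t x - s k t x)) \<le> Cb1_norm \<alpha> (\<lambda>x. v t x - s k t x)" for k
      unfolding Cb1_norm_def by (intro add_increasing2 SUP_upper2[of x]) auto
    then have "(\<lambda>k. ennreal (norm (v t x - s k t x))) \<longlonglongrightarrow> 0"
      by (intro tendsto_sandwich[OF _ _ tendsto_const elim]) auto
    then have "(\<lambda>k. norm (v t x - s k t x)) \<longlonglongrightarrow> 0"
      by (simp add: ennreal_0[symmetric] del: ennreal_0)
    then have "(\<lambda>k. v t x - s k t x) \<longlonglongrightarrow> 0" by (simp add: tendsto_norm_zero_iff)
    then have "(\<lambda>k. v t x - (v t x - s k t x)) \<longlonglongrightarrow> v t x - 0" by (intro tendsto_diff tendsto_const)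
    then have "(\<lambda>k. s k t x) \<longlonglongrightarrow> v t x" by simp
    then show ?case .
  qed
  then show ?thesis
    by (rule measurable_AE_LIMSEQ_complete[rotated -1])
      (auto intro: m complete_measure_lebesgue_on simp: null_sets_def)
qed

text \<open>The function \<open>g\<close> is the larger of the supremum norm and the Lipschitz constant. Taken
over a countable dense set of points these are countable suprema of measurable functions of time,
whereas nothing is known about the measurability of the norm of \<open>v t\<close> itself.\<close>

lemma L1_Cb1_bound:
  fixes v :: "real \<Rightarrow> real^'n::finite \<Rightarrow> real^'n"
  assumes v: "L1_Cb1 T \<alpha> v"
  obtains g where "integrable (lebesgue_on {0<..<T}) g" "\<And>t. 0 \<le> g t"
    "AE t in lebesgue_on {0<..<T}. continuous_on UNIV (v t) \<and> (\<forall>x. norm (v t x) \<le> g t) \<and>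
        (\<forall>x y. norm (v t x - v t y) \<le> g t * norm (x - y))"
proof -
  let ?M = "lebesgue_on {0<..<T}"
  obtain Q :: "(real^'n) set" where Q: "countable Q" "\<And>U. open U \<Longrightarrow> U \<noteq> {} \<Longrightarrow> \<exists>d\<in>Q. d \<in> U"
    using countable_dense_setE by blast
  have [measurable]: "(\<lambda>t. v t x) \<in> borel_measurable ?M" for x by (rule L1_Cb1_measurable[OF v])
  define G where "G t = max (SUP x\<in>Q. ennreal (norm (v t x))) (SUP p\<in>Q \<times> Q. ennreal (norm (v t (fst p) - v t (snd p)) / norm (fst p - snd p)))" for t
  have Gm: "G \<in> borel_measurable ?M"
    unfolding G_def
    by (intro borel_measurable_max borel_measurable_SUP countable_SIGMA Q) measurable
  have AEv: "AE t in ?M. v t \<in> Cb1 \<alpha>" and fin: "(\<integral>\<^sup>+ t. Cb1_norm \<alpha> (v t) \<partial>?M) < \<infinity>"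
    using v by (auto simp: L1_Cb1_def)
  have Gle: "AE t in ?M. G t \<le> Cb1_norm \<alpha> (v t)"
    using AEv by eventually_elim (auto simp: G_def intro!: SUP_least Cb1_bounds)
  then have Gint: "(\<integral>\<^sup>+ t. G t \<partial>?M) < \<infinity>"
    using nn_integral_mono_AE[OF Gle] fin by (auto intro: le_less_trans)
  then have Gfin: "AE t in ?M. G t \<noteq> \<infinity>" using nn_integral_PInf_AE[OF Gm] by auto
  show thesis
  proof (rule that[of "\<lambda>t. enn2real (G t)"])
    show "integrable ?M (\<lambda>t. enn2real (G t))"
    proof (rule integrableI_nonneg)
      have "(\<integral>\<^sup>+ t. ennreal (enn2real (G t)) \<partial>?M) = (\<integral>\<^sup>+ t. G t \<partial>?M)"
        by (rule nn_integral_cong_AE) (use Gfin in eventually_elim, simp add: less_top)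
      then show "(\<integral>\<^sup>+ t. ennreal (enn2real (G t)) \<partial>?M) < \<infinity>" using Gint by simp
    qed (use Gm in auto)
    show "AE t in ?M. continuous_on UNIV (v t) \<and> (\<forall>x. norm (v t x) \<le> enn2real (G t)) \<and>
        (\<forall>x y. norm (v t x - v t y) \<le> enn2real (G t) * norm (x - y))"
      using AEv Gfin
    proof eventually_elim
      case (elim t)
      have c: "continuous_on UNIV (v t)" using elim(1) by (rule Cb1_bounds)
      have e: "ennreal (enn2real (G t)) = G t" using elim(2) by (simp add: less_top)
      have cl: "closure Q = UNIV"
      proof -
        have "x \<in> closure Q" for x
          unfolding closure_iff_nhds_not_empty using Q(2) by (metis disjoint_iff empty_iff interior_maximal interior_subset open_interior subset_iff)
        then show ?thesis by auto
      qed
      have 1: "norm (v t x) \<le> enn2real (G t)" for x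
      proof -
        have "norm (v t x) \<le> enn2real (G t)" if "x \<in> Q" for x
        proof -
          have "ennreal (norm (v t x)) \<le> ennreal (enn2real (G t))"
            unfolding e unfolding G_def by (intro max.coboundedI1 SUP_upper that)
          then show ?thesis by simp
        qed
        then show ?thesis
          by (intro continuous_le_on_closure[of Q "\<lambda>x. norm (v t x)" x]) (use c cl in \<open>auto intro!: continuous_intros continuous_on_subset[OF c]\<close>)
      qed
      have 2: "norm (v t x - v t y) \<le> enn2real (G t) * norm (x - y)" for x y
      proof -
        let ?k = "\<lambda>p. norm (v t (fst p) - v t (snd p)) - enn2real (G t) * norm (fst p - snd p)"
        have "?k p \<le> 0" if "p \<in> Q \<times> Q" for p
        proof (cases "fst p = snd p")
          case False
          have "ennreal (norm (v t (fst p) - v t (snd p)) / norm (fst p - snd p)) \<le> ennreal (enn2real (G t))"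
            unfolding e unfolding G_def by (intro max.coboundedI2 SUP_upper that)
          then have "norm (v t (fst p) - v t (snd p)) / norm (fst p - snd p) \<le> enn2real (G t)" by simp
          then show ?thesis using False by (simp add: field_simps)
        qed simp
        moreover have "continuous_on (closure (Q \<times> Q)) ?k"
          by (intro continuous_intros continuous_on_compose2[OF c]) auto
        moreover have "(x, y) \<in> closure (Q \<times> Q)" by (simp add: closure_Times cl)
        ultimately have "?k (x, y) \<le> 0" using continuous_le_on_closure[of "Q \<times> Q" ?k "(x, y)" 0] by blast
        then show ?thesis by simp
      qed
      show ?case using c 1 2 by blast
    qed
  qed simp
qed

section \<open>Moments and independence of Wiener increments\<close>

text \<open>Lebesgue measure on $R^n$ is the image of a product measure indexed by the standard basis;
reindexing the basis by the coordinate index gives Fubini's theorem for products of functions of one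
coordinate.\<close>

lemma lborel_integral_vec_prod:
  fixes f :: "'n::finite \<Rightarrow> real \<Rightarrow> real"
  assumes f: "\<And>i. integrable lborel (f i)"
  shows "integrable lborel (\<lambda>x::real^'n. \<Prod>i\<in>UNIV. f i (x $ i))"
    and "(\<integral>x. (\<Prod>i\<in>UNIV. f i (x $ i)) \<partial>(lborel :: (real^'n) measure)) = (\<Prod>i\<in>UNIV. \<integral>y. f i y \<partial>lborel)"
proof -
  let ?e = "\<lambda>i::'n. axis i (1::real)"
  have inj: "inj ?e" by (auto simp: inj_def axis_eq_axis)
  have Basis: "(Basis :: (real^'n) set) = range ?e" by (auto simp: Basis_vec_def)
  define g where "g b = f (inv ?e b)" for b :: "real^'n"
  have ge: "g (?e i) = f i" for i by (simp add: g_def inv_f_f[OF inj])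
  have gi: "integrable lborel (g b)" for b unfolding g_def by (rule f)
  have [measurable]: "f i \<in> borel_measurable borel" for i using f[of i] by auto
  interpret P: product_sigma_finite "\<lambda>_::real^'n. lborel :: real measure" ..
  let ?T = "\<lambda>p::real^'n \<Rightarrow> real. \<Sum>b\<in>Basis. p b *\<^sub>R b"
  have T: "?T \<in> borel_measurable (\<Pi>\<^sub>M b\<in>Basis. lborel)" by measurable
  have comp: "?T p $ i = p (?e i)" for p i
  proof -
    have ax: "?e j $ i = (if j = i then 1 else 0)" for j by (simp add: axis_def)
    have "?T p $ i = (\<Sum>j\<in>UNIV. p (?e j) * ?e j $ i)"
      unfolding Basis by (subst sum.reindex[OF inj]) simp
    also have "\<dots> = (\<Sum>j\<in>UNIV. if j = i then p (?e j) else 0)"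
      unfolding ax by (intro sum.cong) auto
    finally show ?thesis by simp
  qed
  have eq: "(\<Prod>i\<in>UNIV. f i (?T p $ i)) = (\<Prod>b\<in>Basis. g b (p b))" for p
    unfolding comp unfolding Basis by (subst prod.reindex[OF inj]) (simp add: ge)
  have m: "(\<lambda>x::real^'n. \<Prod>i\<in>UNIV. f i (x $ i)) \<in> borel_measurable borel" by measurable
  show "integrable lborel (\<lambda>x::real^'n. \<Prod>i\<in>UNIV. f i (x $ i))"
    unfolding lborel_eq[where 'a="real^'n"] by (subst integrable_distr_eq[OF T m]) (simp only: eq, intro P.product_integrable_prod gi, simp)
  have "(\<integral>x. (\<Prod>i\<in>UNIV. f i (x $ i)) \<partial>(lborel :: (real^'n) measure)) = (\<Prod>b\<in>Basis. \<integral>y. g b y \<partial>lborel)"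
    unfolding lborel_eq[where 'a="real^'n"]
    by (subst integral_distr[OF T m]) (simp only: eq, intro P.product_integral_prod gi, simp)
  also have "\<dots> = (\<Prod>i\<in>UNIV. \<integral>y. f i y \<partial>lborel)"
    unfolding Basis by (subst prod.reindex[OF inj]) (simp add: ge)
  finally show "(\<integral>x. (\<Prod>i\<in>UNIV. f i (x $ i)) \<partial>(lborel :: (real^'n) measure)) = (\<Prod>i\<in>UNIV. \<integral>y. f i y \<partial>lborel)" .
qed

lemma normal_moments:
  assumes "\<sigma> > 0"
  shows "(\<integral>y. normal_density 0 \<sigma> y * y ^ 0 \<partial>lborel) = 1"
    and "(\<integral>y. normal_density 0 \<sigma> y * y ^ 1 \<partial>lborel) = 0"
    and "(\<integral>y. normal_density 0 \<sigma> y * y ^ 2 \<partial>lborel) = \<sigma>\<^sup>2"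
    and "(\<integral>y. normal_density 0 \<sigma> y * y ^ 4 \<partial>lborel) = 3 * \<sigma> ^ 4"
proof -
  show "(\<integral>y. normal_density 0 \<sigma> y * y ^ 0 \<partial>lborel) = 1"
    using integral_normal_moment_even[OF assms, of 0 0] by simp
  show "(\<integral>y. normal_density 0 \<sigma> y * y ^ 1 \<partial>lborel) = 0"
    using integral_normal_moment_odd[OF assms, of 0 0] by simp
  show "(\<integral>y. normal_density 0 \<sigma> y * y ^ 2 \<partial>lborel) = \<sigma>\<^sup>2"
    using integral_normal_moment_even[OF assms, of 0 1] by (simp add: fact_numeral)
  show "(\<integral>y. normal_density 0 \<sigma> y * y ^ 4 \<partial>lborel) = 3 * \<sigma> ^ 4"
    using integral_normal_moment_even[OF assms, of 0 2] assms by (simp add: fact_numeral field_simps)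
qed

locale wiener_basis = complete_filtered_prob_space M \<F>
  for M :: "'a measure" and \<F> :: "real \<Rightarrow> 'a measure" +
  fixes W :: "real \<Rightarrow> 'a \<Rightarrow> real^'n::finite"
  assumes wiener: "wiener_process M \<F> W"
begin

lemma space_F: "0 \<le> t \<Longrightarrow> space (\<F> t) = space M" and sets_F: "0 \<le> t \<Longrightarrow> sets (\<F> t) \<subseteq> sets M"
  using filtration_subalgebra by (auto simp: subalgebra_def)

lemma F_measurable_mono: "\<lbrakk>0 \<le> s; s \<le> t; f \<in> measurable (\<F> s) N\<rbrakk> \<Longrightarrow> f \<in> measurable (\<F> t) N"
  using filtration_mono[of s t] space_F[of s] space_F[of t] by (auto simp: measurable_def)

lemma F_measurable_M: "\<lbrakk>0 \<le> s; f \<in> measurable (\<F> s) N\<rbrakk> \<Longrightarrow> f \<in> measurable M N"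
  using sets_F[of s] space_F[of s] by (auto simp: measurable_def)

lemma null_sets_F: "0 \<le> t \<Longrightarrow> null_sets M \<subseteq> sets (\<F> t)"
  using filtration_complete filtration_mono[of 0 t] by auto

lemma W_adapted: "0 \<le> t \<Longrightarrow> W t \<in> borel_measurable (\<F> t)"
  using wiener by (auto simp: wiener_process_def)

lemma increment_monomial:
  assumes st: "0 \<le> s" "s < t"
  shows "integrable M (\<lambda>\<omega>. \<Prod>i\<in>UNIV. (W t \<omega> - W s \<omega>) $ i ^ p i)"
    and "expectation (\<lambda>\<omega>. \<Prod>i\<in>UNIV. (W t \<omega> - W s \<omega>) $ i ^ p i)
       = (\<Prod>i\<in>UNIV. \<integral>y. normal_density 0 (sqrt (t - s)) y * y ^ p i \<partial>lborel)"
proof -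
  let ?nd = "normal_density 0 (sqrt (t - s))"
  have d: "distributed M lborel (\<lambda>\<omega>. W t \<omega> - W s \<omega>) (\<lambda>x. ennreal (\<Prod>i\<in>UNIV. ?nd (x $ i)))"
    using wiener st by (auto simp: wiener_process_def)
  have i1: "integrable lborel (\<lambda>y. ?nd y * y ^ p i)" for i
    using integrable_normal_moment[of "sqrt (t - s)" 0 "p i"] st by simp
  have nn: "0 \<le> (\<Prod>i\<in>UNIV. ?nd (x $ i))" for x by (intro prod_nonneg) simp
  have m: "(\<lambda>x::real^'n. \<Prod>i\<in>UNIV. x $ i ^ p i) \<in> borel_measurable lborel" by measurable
  show "integrable M (\<lambda>\<omega>. \<Prod>i\<in>UNIV. (W t \<omega> - W s \<omega>) $ i ^ p i)"
    using distributed_integrable[OF d m nn] lborel_integral_vec_prod(1)[where f="\<lambda>i y. ?nd y * y ^ p i", OF i1]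
    by (simp add: prod.distrib)
  show "expectation (\<lambda>\<omega>. \<Prod>i\<in>UNIV. (W t \<omega> - W s \<omega>) $ i ^ p i) = (\<Prod>i\<in>UNIV. \<integral>y. ?nd y * y ^ p i \<partial>lborel)"
    using distributed_integral[OF d m nn] lborel_integral_vec_prod(2)[where f="\<lambda>i y. ?nd y * y ^ p i", OF i1]
    by (simp add: prod.distrib)
qed

lemma increment_moments:
  assumes st: "0 \<le> s" "s < t"
  shows "integrable M (\<lambda>\<omega>. (W t \<omega> - W s \<omega>) $ j)"
    and "expectation (\<lambda>\<omega>. (W t \<omega> - W s \<omega>) $ j) = 0"
    and "integrable M (\<lambda>\<omega>. (W t \<omega> - W s \<omega>) $ j * (W t \<omega> - W s \<omega>) $ k)"
    and "expectation (\<lambda>\<omega>. (W t \<omega> - W s \<omega>) $ j * (W t \<omega> - W s \<omega>) $ k) = (if j = k then t - s else 0)"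
    and "integrable M (\<lambda>\<omega>. (W t \<omega> - W s \<omega>) $ j ^ 4)"
    and "expectation (\<lambda>\<omega>. (W t \<omega> - W s \<omega>) $ j ^ 4) = 3 * (t - s)\<^sup>2"
proof -
  have sg: "sqrt (t - s) > 0" and sq: "(sqrt (t - s))\<^sup>2 = t - s" using st by auto
  have s4: "sqrt (t - s) ^ 4 = (t - s)\<^sup>2" using sq by (metis mult_2 numeral_Bit0 power_add power2_eq_square)
  note mom = normal_moments[OF sg, unfolded sq s4]
  have pr: "(\<Prod>i\<in>UNIV. (x::real^'n) $ i ^ (if i = j then a else 0)) = x $ j ^ a" for x j a
  proof -
    have "(\<Prod>i\<in>UNIV. x $ i ^ (if i = j then a else 0)) = (\<Prod>i\<in>UNIV. if i = j then x $ i ^ a else 1)"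
      by (intro prod.cong) auto
    then show ?thesis by simp
  qed
  have prI: "(\<Prod>i\<in>UNIV. \<integral>y. normal_density 0 (sqrt (t - s)) y * y ^ (if i = j then a else 0) \<partial>lborel)
      = (\<integral>y. normal_density 0 (sqrt (t - s)) y * y ^ a \<partial>lborel)" for j :: 'n and a
  proof -
    have "(\<Prod>i\<in>UNIV. \<integral>y. normal_density 0 (sqrt (t - s)) y * y ^ (if i = j then a else 0) \<partial>lborel)
      = (\<Prod>i\<in>UNIV. if i = j then \<integral>y. normal_density 0 (sqrt (t - s)) y * y ^ a \<partial>lborel else 1)"
      using mom(1) by (intro prod.cong) auto
    then show ?thesis by simp
  qed
  note one = increment_monomial[OF st, of "\<lambda>i. if i = j then a else 0" for j a, unfolded pr prI]
  show "integrable M (\<lambda>\<omega>. (W t \<omega> - W s \<omega>) $ j)" using one(1)[of j 1] by simp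
  show "expectation (\<lambda>\<omega>. (W t \<omega> - W s \<omega>) $ j) = 0" using one(2)[of j 1] mom(2) by simp
  show "integrable M (\<lambda>\<omega>. (W t \<omega> - W s \<omega>) $ j ^ 4)" using one(1)[of j 4] by simp
  show "expectation (\<lambda>\<omega>. (W t \<omega> - W s \<omega>) $ j ^ 4) = 3 * (t - s)\<^sup>2" using one(2)[of j 4] mom(4) by simp
  have pr2: "(\<Prod>i\<in>UNIV. (x::real^'n) $ i ^ ((if i = j then 1 else 0) + (if i = k then 1 else 0))) = x $ j * x $ k" for x
    unfolding power_add prod.distrib pr by simp
  note two = increment_monomial[OF st, of "\<lambda>i. (if i = j then 1 else 0) + (if i = k then 1 else 0)", unfolded pr2]
  show "integrable M (\<lambda>\<omega>. (W t \<omega> - W s \<omega>) $ j * (W t \<omega> - W s \<omega>) $ k)" using two(1) .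
  show "expectation (\<lambda>\<omega>. (W t \<omega> - W s \<omega>) $ j * (W t \<omega> - W s \<omega>) $ k) = (if j = k then t - s else 0)"
  proof (cases "j = k")
    case True
    then have "expectation (\<lambda>\<omega>. (W t \<omega> - W s \<omega>) $ j * (W t \<omega> - W s \<omega>) $ k) = expectation (\<lambda>\<omega>. (W t \<omega> - W s \<omega>) $ j ^ 2)"
      by (simp add: power2_eq_square)
    then show ?thesis using one(2)[of j 2] mom(3) True by simp
  next
    case False
    have "(\<integral>y. normal_density 0 (sqrt (t - s)) y * y ^ ((if j = j then 1 else 0) + (if j = k then 1 else 0)) \<partial>lborel) = 0"
      using False mom(2) by simp
    then have "(\<Prod>i\<in>UNIV. \<integral>y. normal_density 0 (sqrt (t - s)) y * y ^ ((if i = j then 1 else 0) + (if i = k then 1 else 0)) \<partial>lborel) = 0"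
      by (intro prod_zero bexI[of _ j]) auto
    then show ?thesis using two(2) False by simp
  qed
qed

lemma increment_norm_moments:
  assumes st: "0 \<le> s" "s \<le> t"
  shows "integrable M (\<lambda>\<omega>. (norm (W t \<omega> - W s \<omega>))\<^sup>2)"
    and "expectation (\<lambda>\<omega>. (norm (W t \<omega> - W s \<omega>))\<^sup>2) = real CARD('n) * (t - s)"
    and "integrable M (\<lambda>\<omega>. norm (W t \<omega> - W s \<omega>) ^ 4)"
    and "expectation (\<lambda>\<omega>. norm (W t \<omega> - W s \<omega>) ^ 4) \<le> 3 * (real CARD('n))\<^sup>2 * (t - s)\<^sup>2"
proof -
  have n2: "(norm (x::real^'n))\<^sup>2 = (\<Sum>j\<in>UNIV. x $ j * x $ j)" for x
    by (simp add: power2_norm_eq_inner inner_vec_def)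
  have n4: "norm (x::real^'n) ^ 4 \<le> (\<Sum>j\<in>UNIV. real CARD('n) * x $ j ^ 4)" for x
  proof -
    have "norm x ^ 4 = (\<Sum>j\<in>UNIV. x $ j * x $ j)\<^sup>2" unfolding n2[symmetric] by simp
    also have "\<dots> \<le> real CARD('n) * (\<Sum>j\<in>UNIV. (x $ j * x $ j)\<^sup>2)"
      using sum_squared_le_sum_of_squares[of "\<lambda>j. x $ j * x $ j" UNIV] by (simp add: mult.commute)
    also have "\<dots> = (\<Sum>j\<in>UNIV. real CARD('n) * x $ j ^ 4)"
      by (simp add: sum_distrib_left power2_eq_square power4_eq_xxxx mult_ac)
    finally show ?thesis .
  qed
  have "integrable M (\<lambda>\<omega>. (norm (W t \<omega> - W s \<omega>))\<^sup>2) \<and>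
     expectation (\<lambda>\<omega>. (norm (W t \<omega> - W s \<omega>))\<^sup>2) = real CARD('n) * (t - s) \<and>
     integrable M (\<lambda>\<omega>. norm (W t \<omega> - W s \<omega>) ^ 4) \<and>
     expectation (\<lambda>\<omega>. norm (W t \<omega> - W s \<omega>) ^ 4) \<le> 3 * (real CARD('n))\<^sup>2 * (t - s)\<^sup>2"
  proof (cases "s = t")
    case False
    then have "s < t" using st by simp
    note mom = increment_moments[OF st(1) this]
    have [measurable]: "W t \<in> borel_measurable M" "W s \<in> borel_measurable M"
      using st by (auto intro: F_measurable_M[OF _ W_adapted])
    have i4: "integrable M (\<lambda>\<omega>. \<Sum>j\<in>UNIV. real CARD('n) * (W t \<omega> - W s \<omega>) $ j ^ 4)"
      by (intro Bochner_Integration.integrable_sum integrable_mult_right mom)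
    have j4: "integrable M (\<lambda>\<omega>. norm (W t \<omega> - W s \<omega>) ^ 4)"
    proof (rule Bochner_Integration.integrable_bound[OF i4])
      show "AE \<omega> in M. norm (norm (W t \<omega> - W s \<omega>) ^ 4) \<le> norm (\<Sum>j\<in>UNIV. real CARD('n) * (W t \<omega> - W s \<omega>) $ j ^ 4)"
        using order_trans[OF n4 abs_ge_self] by (intro AE_I2) (simp only: real_norm_def abs_of_nonneg zero_le_power norm_ge_zero)
    qed measurable
    have "expectation (\<lambda>\<omega>. norm (W t \<omega> - W s \<omega>) ^ 4) \<le> expectation (\<lambda>\<omega>. \<Sum>j\<in>UNIV. real CARD('n) * (W t \<omega> - W s \<omega>) $ j ^ 4)"
      by (rule integral_mono[OF j4 i4 n4])
    also have "\<dots> = 3 * (real CARD('n))\<^sup>2 * (t - s)\<^sup>2"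
    proof -
      have "expectation (\<lambda>\<omega>. \<Sum>j\<in>UNIV. real CARD('n) * (W t \<omega> - W s \<omega>) $ j ^ 4)
        = (\<Sum>j\<in>(UNIV :: 'n set). real CARD('n) * expectation (\<lambda>\<omega>. (W t \<omega> - W s \<omega>) $ j ^ 4))"
        by (subst Bochner_Integration.integral_sum) (intro integrable_mult_right mom, simp)
      also have "\<dots> = (\<Sum>j\<in>(UNIV :: 'n set). real CARD('n) * (3 * (t - s)\<^sup>2))" unfolding mom(6) ..
      finally show ?thesis by (simp add: power2_eq_square)
    qed
    finally have e4: "expectation (\<lambda>\<omega>. norm (W t \<omega> - W s \<omega>) ^ 4) \<le> 3 * (real CARD('n))\<^sup>2 * (t - s)\<^sup>2" .
    have "integrable M (\<lambda>\<omega>. (norm (W t \<omega> - W s \<omega>))\<^sup>2)"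
      unfolding n2 by (intro Bochner_Integration.integrable_sum mom)
    moreover have "expectation (\<lambda>\<omega>. (norm (W t \<omega> - W s \<omega>))\<^sup>2)
        = (\<Sum>j\<in>(UNIV :: 'n set). expectation (\<lambda>\<omega>. (W t \<omega> - W s \<omega>) $ j * (W t \<omega> - W s \<omega>) $ j))"
      unfolding n2 by (rule Bochner_Integration.integral_sum) (rule mom)
    then have "expectation (\<lambda>\<omega>. (norm (W t \<omega> - W s \<omega>))\<^sup>2) = real CARD('n) * (t - s)"
      unfolding mom(4) by simp
    ultimately show ?thesis using e4 j4 by blast
  qed simp
  then show "integrable M (\<lambda>\<omega>. (norm (W t \<omega> - W s \<omega>))\<^sup>2)"
     "expectation (\<lambda>\<omega>. (norm (W t \<omega> - W s \<omega>))\<^sup>2) = real CARD('n) * (t - s)"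
     "integrable M (\<lambda>\<omega>. norm (W t \<omega> - W s \<omega>) ^ 4)"
     "expectation (\<lambda>\<omega>. norm (W t \<omega> - W s \<omega>) ^ 4) \<le> 3 * (real CARD('n))\<^sup>2 * (t - s)\<^sup>2" by auto
qed

text \<open>The independence of the increment from the past is given for \<open>\<sigma>\<close>-algebras; here
it is used as the factorization of an expectation.\<close>

lemma increment_independent:
  fixes \<phi> :: "real^'n \<Rightarrow> real"
  assumes st: "0 \<le> s" "s < t" and \<xi>: "\<xi> \<in> borel_measurable (\<F> s)" "integrable M \<xi>"
    and \<phi>: "\<phi> \<in> borel_measurable borel" "integrable M (\<lambda>\<omega>. \<phi> (W t \<omega> - W s \<omega>))"
  shows "integrable M (\<lambda>\<omega>. \<xi> \<omega> * \<phi> (W t \<omega> - W s \<omega>))"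
    and "expectation (\<lambda>\<omega>. \<xi> \<omega> * \<phi> (W t \<omega> - W s \<omega>)) = expectation \<xi> * expectation (\<lambda>\<omega>. \<phi> (W t \<omega> - W s \<omega>))"
proof -
  let ?\<Delta> = "\<lambda>\<omega>. W t \<omega> - W s \<omega>"
  have ind: "indep_set (sets (\<F> s)) (sets (vimage_algebra (space M) ?\<Delta> borel))"
    using wiener st by (auto simp: wiener_process_def)
  have [measurable]: "W t \<in> borel_measurable M" "W s \<in> borel_measurable M"
    using st by (auto intro: F_measurable_M[OF _ W_adapted])
  note [measurable] = \<phi>(1)
  have "indep_var borel \<xi> borel (\<lambda>\<omega>. \<phi> (?\<Delta> \<omega>))"
    unfolding indep_var_eq
  proof (intro conjI)
    show "random_variable borel \<xi>" using \<xi>(2) by simp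
    show "random_variable borel (\<lambda>\<omega>. \<phi> (?\<Delta> \<omega>))" by measurable
    have 1: "{\<xi> -` A \<inter> space M |A. A \<in> sets borel} \<subseteq> sets (\<F> s)"
      using measurable_sets[OF \<xi>(1)] space_F[OF st(1)] by auto
    have 2: "{(\<lambda>\<omega>. \<phi> (?\<Delta> \<omega>)) -` A \<inter> space M |A. A \<in> sets borel} \<subseteq> sets (vimage_algebra (space M) ?\<Delta> borel)"
    proof safe
      fix A :: "real set" assume A: "A \<in> sets borel"
      have "\<phi> -` A \<in> sets borel" using measurable_sets[OF \<phi>(1) A] by simp
      then have "?\<Delta> -` (\<phi> -` A) \<inter> space M \<in> sets (vimage_algebra (space M) ?\<Delta> borel)" by (rule in_vimage_algebra)
      then show "(\<lambda>\<omega>. \<phi> (?\<Delta> \<omega>)) -` A \<inter> space M \<in> sets (vimage_algebra (space M) ?\<Delta> borel)"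
        by (simp add: vimage_def)
    qed
    show "indep_set (sigma_sets (space M) {\<xi> -` A \<inter> space M |A. A \<in> sets borel})
       (sigma_sets (space M) {(\<lambda>\<omega>. \<phi> (?\<Delta> \<omega>)) -` A \<inter> space M |A. A \<in> sets borel})"
    proof -
      have "sigma_sets (space M) {\<xi> -` A \<inter> space M |A. A \<in> sets borel} \<subseteq> sets (\<F> s)" (is "?S1 \<subseteq> _")
        using sets.sigma_sets_subset[OF 1] unfolding space_F[OF st(1)] .
      moreover have "sigma_sets (space M) {(\<lambda>\<omega>. \<phi> (?\<Delta> \<omega>)) -` A \<inter> space M |A. A \<in> sets borel}
          \<subseteq> sets (vimage_algebra (space M) ?\<Delta> borel)" (is "?S2 \<subseteq> _")
        using sets.sigma_sets_subset[OF 2] unfolding space_vimage_algebra .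
      ultimately show ?thesis using ind unfolding indep_sets2_eq by (meson subset_iff)
    qed
  qed
  from indep_var_lebesgue_integral[OF this \<xi>(2) \<phi>(2)] indep_var_integrable[OF this \<xi>(2) \<phi>(2)]
  show "integrable M (\<lambda>\<omega>. \<xi> \<omega> * \<phi> (?\<Delta> \<omega>))"
    "expectation (\<lambda>\<omega>. \<xi> \<omega> * \<phi> (?\<Delta> \<omega>)) = expectation \<xi> * expectation (\<lambda>\<omega>. \<phi> (?\<Delta> \<omega>))" by auto
qed

end

section \<open>One particle on a time grid\<close>

lemma absolutely_integrable_cont_inner:
  fixes c w :: "real \<Rightarrow> 'b::euclidean_space"
  assumes c: "continuous_on {a..b} c" and w: "w absolutely_integrable_on {a..b}"
  shows "(\<lambda>r. c r \<bullet> w r) absolutely_integrable_on {a..b}"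
proof (rule absolutely_integrable_bounded_measurable_product[where h="(\<bullet>)" and f=c and g=w])
  show "bilinear ((\<bullet>) :: 'b \<Rightarrow> 'b \<Rightarrow> real)"
    by (simp add: bilinear_def linear_iff inner_add_left inner_add_right)
  show "c \<in> borel_measurable (lebesgue_on {a..b})"
    using c by (intro continuous_imp_measurable_on_sets_lebesgue) auto
  show "bounded (c ` {a..b})" using c by (intro compact_imp_bounded compact_continuous_image) auto
  show "w absolutely_integrable_on {a..b}" by (rule w)
qed auto

text \<open>A particle \<open>x\<close> that moves with velocity \<open>w\<close> and additive noise
\<open>\<sigma> B\<close>, together with a scalar weight \<open>z\<close> that has velocity
\<open>q\<close> and no noise. Both velocities are dominated by a deterministic integrable
\<open>g\<close>; the noise is bounded by \<open>k\<close> up to a time \<open>\<tau>\<close>. All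
statements of this section are about a single path, and all constants depend only on the parameters
of the locale, not on the path.\<close>

locale drifted_particle = space_time_C12 a b f f\<^sub>t Df D2f
  for a b f f\<^sub>t and Df :: "real \<Rightarrow> real^'n::finite \<Rightarrow> real^'n" and D2f +
  fixes s t \<sigma> k :: real and g :: "real \<Rightarrow> real" and x0 :: "real^'n" and z0 :: real
  assumes ast: "a \<le> s" "s < t" "t \<le> b" and \<sigma>: "0 \<le> \<sigma>" and k: "0 \<le> k"
    and g: "g integrable_on {a..b}" and g_nonneg: "\<And>r. r \<in> {a..b} \<Longrightarrow> 0 \<le> g r"
begin

text \<open>\<open>R\<close> and \<open>Z\<close> bound the particle and its weight. The summand
\<open>1\<close> in \<open>k + 1\<close> leaves room for one further noise increment of size at most
1 after a time at which the particle was still alive.\<close>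

definition "R = norm x0 + integral {a..b} g + \<sigma> * (k + 1)"
definition "Z = \<bar>z0\<bar> + integral {a..b} g"

definition admissible :: "real \<Rightarrow> (real \<Rightarrow> real^'n) \<Rightarrow> (real \<Rightarrow> real^'n) \<Rightarrow> (real \<Rightarrow> real) \<Rightarrow> (real \<Rightarrow> real^'n) \<Rightarrow> (real \<Rightarrow> real) \<Rightarrow> bool"
  where "admissible \<tau> B x z w q \<longleftrightarrow>
     \<tau> \<in> {a..b} \<and> continuous_on {a..b} B \<and> (\<forall>r\<in>{a..b}. r \<le> \<tau> \<longrightarrow> norm (B r) \<le> k) \<and>
     w integrable_on {a..b} \<and> q integrable_on {a..b} \<and> (\<forall>r\<in>{a..b}. norm (w r) \<le> g r \<and> \<bar>q r\<bar> \<le> g r) \<and>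
     (\<forall>r\<in>{a..b}. x r = x0 + integral {a..r} w + \<sigma> *\<^sub>R B r \<and> z r = z0 + integral {a..r} q)"

definition "h N = (t - s) / real N"
definition "grid N i = s + real i * h N"
text \<open>A grid step is carried out (\<open>ok\<close>) only while the time \<open>\<tau>\<close> has not
been reached and no noise increment, including that of the step itself, has exceeded 1. Without the
second condition the particle could leave the ball of radius \<open>R\<close> in the step that
passes \<open>\<tau>\<close>. Unlike \<open>ok\<close>, the condition \<open>alive\<close> is known
at the beginning of the step. On a continuous path the second condition holds on all sufficiently
fine grids.\<close>

definition "alive \<tau> B N i \<longleftrightarrow> grid N i < \<tau> \<and> (\<forall>j<i. norm (B (grid N (Suc j)) - B (grid N j) :: real^'n) \<le> 1)"
definition "ok \<tau> B N i \<longleftrightarrow> alive \<tau> B N i \<and> norm (B (grid N (Suc i)) - B (grid N i) :: real^'n) \<le> 1"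
definition "lap r y = trace (D2f r y)"

text \<open>The increment of \<open>f r (x r) * z r\<close> over a grid step is the sum of two parts (lemma
\<open>P_step\<close>). The noise part keeps time, drift and weight fixed and lets only the noise
act; the term with \<open>lap\<close>, the Laplacian of \<open>f\<close>, is its mean to first order
in the time step and is transferred to the transport part. The transport part has finite variation,
uniformly in the path; the noise part is nearly a martingale increment, and
\<open>noise_leading\<close> is its second order Taylor polynomial in the noise.\<close>

definition "transport_step B x z N i =
   (z (grid N (Suc i)) - z (grid N i)) * f (grid N (Suc i)) (x (grid N (Suc i)))
   + z (grid N i) * (f (grid N (Suc i)) (x (grid N (Suc i))) - f (grid N i) (x (grid N i) + \<sigma> *\<^sub>R (B (grid N (Suc i)) - B (grid N i))))
   + z (grid N i) * (\<sigma>\<^sup>2 / 2 * h N * lap (grid N i) (x (grid N i)))"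

definition "noise_step B x z N i =
   z (grid N i) * (f (grid N i) (x (grid N i) + \<sigma> *\<^sub>R (B (grid N (Suc i)) - B (grid N i))) - f (grid N i) (x (grid N i))
     - \<sigma>\<^sup>2 / 2 * h N * lap (grid N i) (x (grid N i)))"

definition "noise_leading B x z N i =
   z (grid N i) * (\<sigma> * (Df (grid N i) (x (grid N i)) \<bullet> (B (grid N (Suc i)) - B (grid N i)))
     + \<sigma>\<^sup>2 / 2 * ((B (grid N (Suc i)) - B (grid N i)) \<bullet> (D2f (grid N i) (x (grid N i)) *v (B (grid N (Suc i)) - B (grid N i)))
         - h N * lap (grid N i) (x (grid N i))))"

definition "P x z r = f r (x r) * z r"

definition "drift x z w q r = z r * (f\<^sub>t r (x r) + \<sigma>\<^sup>2 / 2 * lap r (x r)) + (z r *\<^sub>R Df r (x r)) \<bullet> w r + f r (x r) * q r"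

lemma P_step: "P x z (grid N (Suc i)) - P x z (grid N i) = transport_step B x z N i + noise_step B x z N i"
  by (simp add: P_def transport_step_def noise_step_def algebra_simps)

lemma h_pos: "N > 0 \<Longrightarrow> h N > 0" using ast by (simp add: h_def)
lemma grid_0: "grid N 0 = s" by (simp add: grid_def)
lemma grid_N: "N > 0 \<Longrightarrow> grid N N = t" by (simp add: grid_def h_def)
lemma grid_Suc: "grid N (Suc i) = grid N i + h N" by (simp add: grid_def algebra_simps)
lemma grid_mono: "i \<le> j \<Longrightarrow> grid N i \<le> grid N j"
  using ast by (auto simp: grid_def h_def intro!: mult_right_mono divide_right_mono)
lemma grid_in: "i \<le> N \<Longrightarrow> N > 0 \<Longrightarrow> grid N i \<in> {s..t}"
  using grid_mono[of 0 i N] grid_mono[of i N N] grid_0 grid_N by auto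
lemma grid_in': "i \<le> N \<Longrightarrow> N > 0 \<Longrightarrow> grid N i \<in> {a..b}"
  using grid_in[of i N] ast by auto
lemma h_tendsto: "h \<longlonglongrightarrow> 0"
  unfolding h_def[abs_def] by (rule lim_const_over_n)

lemma lap_cont: "continuous_on ({a..b} \<times> UNIV) (\<lambda>(r, y). lap r y)"
  using cont_xx unfolding lap_def trace_def split_beta by (intro continuous_intros) auto

lemma Z_nonneg: "Z \<ge> 0"
  using Henstock_Kurzweil_Integration.integral_nonneg[OF g g_nonneg] by (simp add: Z_def)

lemma g_sub: "a \<le> u \<Longrightarrow> u \<le> u' \<Longrightarrow> u' \<le> b \<Longrightarrow> g integrable_on {u..u'}"
  by (rule integrable_on_subinterval[OF g]) auto

lemma g_int_nonneg: "a \<le> u \<Longrightarrow> u \<le> u' \<Longrightarrow> u' \<le> b \<Longrightarrow> 0 \<le> integral {u..u'} g"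
  by (rule Henstock_Kurzweil_Integration.integral_nonneg[OF g_sub g_nonneg]) auto

lemma g_int_le: "a \<le> u \<Longrightarrow> u \<le> u' \<Longrightarrow> u' \<le> b \<Longrightarrow> integral {u..u'} g \<le> integral {a..b} g"
  by (rule integral_subset_le[OF _ g_sub g]) (auto intro: g_nonneg)

lemma grid_sum: "N > 0 \<Longrightarrow> I \<le> N \<Longrightarrow> (c :: real \<Rightarrow> real) integrable_on {s..t} \<Longrightarrow>
   (\<Sum>i<I. integral {grid N i..grid N (Suc i)} c) = integral {s..grid N I} c"
  unfolding grid_def by (rule integral_uniform_partition[symmetric, of _ _ t _ N]) (use ast in \<open>auto simp: h_def\<close>)

lemma ok_downward: "ok \<tau> B N i \<Longrightarrow> j \<le> i \<Longrightarrow> ok \<tau> B N j"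
proof (cases "j = i")
  case False
  assume *: "ok \<tau> B N i" "j \<le> i"
  then have "j < i" using False by simp
  then show ?thesis using * grid_mono[of j i N] by (force simp: ok_def alive_def)
qed simp

text \<open>The steps carried out form an initial segment, so sums over them telescope.\<close>

lemma ok_initial: "\<exists>I\<le>N. \<forall>i<N. ok \<tau> B N i \<longleftrightarrow> i < I"
proof -
  define I where "I = (LEAST i. i = N \<or> \<not> ok \<tau> B N i)"
  have I: "I = N \<or> \<not> ok \<tau> B N I" unfolding I_def by (rule LeastI[of _ N]) simp
  have "I \<le> N" unfolding I_def by (rule Least_le) simp
  moreover have "ok \<tau> B N i \<longleftrightarrow> i < I" if "i < N" for i
  proof
    show "i < I" if "ok \<tau> B N i"
      using I ok_downward[OF that, of I] \<open>i < N\<close> by (meson not_le_imp_less linorder_not_less)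
    show "ok \<tau> B N i" if "i < I" using not_less_Least[OF that[unfolded I_def]] by simp
  qed
  ultimately show ?thesis by blast
qed

lemma sum_ok: "I \<le> N \<Longrightarrow> (\<forall>i<N. ok \<tau> B N i \<longleftrightarrow> i < I) \<Longrightarrow> (\<Sum>i<N. if ok \<tau> B N i then c i else 0) = (\<Sum>i<I. c i :: real)"
proof -
  assume I: "I \<le> N" "\<forall>i<N. ok \<tau> B N i \<longleftrightarrow> i < I"
  have "(\<Sum>i<N. if ok \<tau> B N i then c i else 0) = (\<Sum>i<N. if i < I then c i else 0)"
    using I by (intro sum.cong) auto
  also have "\<dots> = (\<Sum>i\<in>{..<N} \<inter> {i. i < I}. c i)" by (subst sum.inter_restrict) auto
  also have "{..<N} \<inter> {i. i < I} = {..<I}" using I by auto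
  finally show ?thesis .
qed

lemma eventually_grid_osc:
  fixes c :: "real \<Rightarrow> 'c::metric_space"
  assumes c: "continuous_on {a..b} c" and e: "\<epsilon> > 0"
  shows "\<forall>\<^sub>F N in sequentially. N > 0 \<and> (\<forall>i<N. \<forall>r\<in>{grid N i..grid N (Suc i)}. \<forall>r'\<in>{grid N i..grid N (Suc i)}. dist (c r') (c r) < \<epsilon>)"
proof -
  have "uniformly_continuous_on {a..b} c" by (rule compact_uniformly_continuous[OF c]) auto
  then obtain d where d: "d > 0" "\<And>r r'. r \<in> {a..b} \<Longrightarrow> r' \<in> {a..b} \<Longrightarrow> dist r' r < d \<Longrightarrow> dist (c r') (c r) < \<epsilon>"
    using e by (metis uniformly_continuous_onE)
  have "\<forall>\<^sub>F N in sequentially. h N < d" using h_tendsto d(1) by (rule order_tendstoD)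
  then show ?thesis
    using eventually_gt_at_top[of "0::nat"]
  proof eventually_elim
    case (elim N)
    show ?case
    proof (intro conjI elim allI impI ballI)
      fix i r r' assume i: "i < N" and r: "r \<in> {grid N i..grid N (Suc i)}" "r' \<in> {grid N i..grid N (Suc i)}"
      have "grid N i \<in> {a..b}" "grid N (Suc i) \<in> {a..b}" using i elim(2) by (simp_all only: grid_in' Suc_leI less_imp_le)
      moreover have "dist r' r \<le> h N" using r by (auto simp: grid_Suc dist_real_def)
      ultimately show "dist (c r') (c r) < \<epsilon>" using r elim by (intro d(2)) auto
    qed
  qed
qed

context
  fixes \<tau> B x z w q
  assumes adm: "admissible \<tau> B x z w q"
begin

lemma adm_facts:
  "\<tau> \<in> {a..b}" "continuous_on {a..b} B" "w integrable_on {a..b}" "q integrable_on {a..b}"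
  "\<And>r. r \<in> {a..b} \<Longrightarrow> r \<le> \<tau> \<Longrightarrow> norm (B r) \<le> k"
  "\<And>r. r \<in> {a..b} \<Longrightarrow> norm (w r) \<le> g r" "\<And>r. r \<in> {a..b} \<Longrightarrow> \<bar>q r\<bar> \<le> g r"
  "\<And>r. r \<in> {a..b} \<Longrightarrow> x r = x0 + integral {a..r} w + \<sigma> *\<^sub>R B r"
  "\<And>r. r \<in> {a..b} \<Longrightarrow> z r = z0 + integral {a..r} q"
  using adm by (auto simp: admissible_def)

lemma w_int_bound: "a \<le> u \<Longrightarrow> u \<le> u' \<Longrightarrow> u' \<le> b \<Longrightarrow> norm (integral {u..u'} w) \<le> integral {u..u'} g"
  by (rule Henstock_Kurzweil_Integration.integral_norm_bound_integral[OF integrable_on_subinterval[OF adm_facts(3)] g_sub])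
    (auto intro: adm_facts(6))

lemma q_int_bound: "a \<le> u \<Longrightarrow> u \<le> u' \<Longrightarrow> u' \<le> b \<Longrightarrow> \<bar>integral {u..u'} q\<bar> \<le> integral {u..u'} g"
  unfolding real_norm_def[symmetric]
  by (rule Henstock_Kurzweil_Integration.integral_norm_bound_integral[OF integrable_on_subinterval[OF adm_facts(4)] g_sub])
    (auto intro: adm_facts(7))

lemma x_increment: "a \<le> u \<Longrightarrow> u \<le> u' \<Longrightarrow> u' \<le> b \<Longrightarrow> x u' = x u + \<sigma> *\<^sub>R (B u' - B u) + integral {u..u'} w"
  using Henstock_Kurzweil_Integration.integral_combine[of a u u' w] integrable_on_subinterval[OF adm_facts(3), of a u']
    adm_facts(8)[of u] adm_facts(8)[of u'] by (auto simp: algebra_simps)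

lemma z_increment: "a \<le> u \<Longrightarrow> u \<le> u' \<Longrightarrow> u' \<le> b \<Longrightarrow> z u' = z u + integral {u..u'} q"
  using Henstock_Kurzweil_Integration.integral_combine[of a u u' q] integrable_on_subinterval[OF adm_facts(4), of a u']
    adm_facts(9)[of u] adm_facts(9)[of u'] by (auto simp: algebra_simps)

lemma x_cont: "continuous_on {a..b} x" and z_cont: "continuous_on {a..b} z"
proof -
  have "continuous_on {a..b} (\<lambda>r. x0 + integral {a..r} w + \<sigma> *\<^sub>R B r)"
    by (intro continuous_intros indefinite_integral_continuous_1 adm_facts)
  then show "continuous_on {a..b} x" by (rule continuous_on_eq) (simp add: adm_facts(8))
  have "continuous_on {a..b} (\<lambda>r. z0 + integral {a..r} q)"
    by (intro continuous_intros indefinite_integral_continuous_1 adm_facts)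
  then show "continuous_on {a..b} z" by (rule continuous_on_eq) (simp add: adm_facts(9))
qed

lemma z_bound: "r \<in> {a..b} \<Longrightarrow> \<bar>z r\<bar> \<le> Z"
  using q_int_bound[of a r] g_int_le[of a r] adm_facts(9)[of r] by (auto simp: Z_def)

lemma x_bound: "r \<in> {a..b} \<Longrightarrow> norm (B r + e) \<le> k + 1 \<Longrightarrow> norm (x r + \<sigma> *\<^sub>R e) \<le> R"
proof -
  assume r: "r \<in> {a..b}" and n: "norm (B r + e) \<le> k + 1"
  have "norm (x r + \<sigma> *\<^sub>R e) = norm (x0 + integral {a..r} w + \<sigma> *\<^sub>R (B r + e))"
    using adm_facts(8)[OF r] by (simp add: algebra_simps)
  also have "\<dots> \<le> norm x0 + norm (integral {a..r} w) + norm (\<sigma> *\<^sub>R (B r + e))"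
    by (intro norm_triangle_le add_right_mono norm_triangle_ineq) simp
  also have "norm (\<sigma> *\<^sub>R (B r + e)) \<le> \<sigma> * (k + 1)" using \<sigma> n by (simp add: mult_left_mono)
  also have "norm (integral {a..r} w) \<le> integral {a..b} g"
    using w_int_bound[of a r] g_int_le[of a r] r by auto
  finally show ?thesis by (simp add: R_def)
qed

lemma alive_bound: "N > 0 \<Longrightarrow> i \<le> N \<Longrightarrow> alive \<tau> B N i \<Longrightarrow> norm (B (grid N i)) \<le> k \<and> norm (x (grid N i)) \<le> R"
  using adm_facts(5)[OF grid_in'[of i N]] x_bound[OF grid_in'[of i N], of 0] by (auto simp: alive_def)

lemma ok_bound:
  assumes N: "N > 0" "i < N" and ok: "ok \<tau> B N i"
  shows "norm (x (grid N i)) \<le> R" "norm (x (grid N i) + \<sigma> *\<^sub>R (B (grid N (Suc i)) - B (grid N i))) \<le> R"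
    "norm (x (grid N (Suc i))) \<le> R"
proof -
  have al: "norm (B (grid N i)) \<le> k" "norm (x (grid N i)) \<le> R"
    and db: "norm (B (grid N (Suc i)) - B (grid N i)) \<le> 1"
    using alive_bound[of N i] N ok by (auto simp: ok_def)
  then have B': "norm (B (grid N (Suc i))) \<le> k + 1"
    using norm_triangle_sub[of "B (grid N (Suc i))" "B (grid N i)"] by linarith
  show "norm (x (grid N i)) \<le> R" by fact
  show "norm (x (grid N i) + \<sigma> *\<^sub>R (B (grid N (Suc i)) - B (grid N i))) \<le> R"
    by (rule x_bound[OF grid_in']) (use N B' in auto)
  show "norm (x (grid N (Suc i))) \<le> R"
    using x_bound[OF grid_in'[of "Suc i" N], of 0] N B' by auto
qed

lemma drift_parts_cont:
  "continuous_on {a..b} (\<lambda>r. z r * (f\<^sub>t r (x r) + \<sigma>\<^sup>2 / 2 * lap r (x r)))"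
  "continuous_on {a..b} (\<lambda>r. z r *\<^sub>R Df r (x r))"
  "continuous_on {a..b} (\<lambda>r. f r (x r))"
proof -
  have along: "continuous_on {a..b} (\<lambda>r. kk r (x r))" if "continuous_on ({a..b} \<times> UNIV) (\<lambda>(r, y). kk r y)"
    for kk :: "real \<Rightarrow> real^'n \<Rightarrow> 'c::topological_space"
  proof -
    have "continuous_on {a..b} (\<lambda>r. (r, x r))" by (intro continuous_intros x_cont)
    from continuous_on_compose2[OF that this] show ?thesis by auto
  qed
  show "continuous_on {a..b} (\<lambda>r. z r * (f\<^sub>t r (x r) + \<sigma>\<^sup>2 / 2 * lap r (x r)))"
    "continuous_on {a..b} (\<lambda>r. z r *\<^sub>R Df r (x r))" "continuous_on {a..b} (\<lambda>r. f r (x r))"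
    by (intro continuous_intros z_cont along cont_t cont_x cont_f lap_cont)+
qed

lemma drift_integrable: "drift x z w q integrable_on {a..b}"
proof -
  have w: "w absolutely_integrable_on {a..b}" and q: "q absolutely_integrable_on {a..b}"
    by (rule absolutely_integrable_integrable_bound[OF _ _ g], use adm_facts in auto)+
  have "(\<lambda>r. (z r *\<^sub>R Df r (x r)) \<bullet> w r) integrable_on {a..b}"
    using absolutely_integrable_cont_inner[OF drift_parts_cont(2) w] by (rule set_lebesgue_integral_eq_integral)
  moreover have "(\<lambda>r. f r (x r) * q r) integrable_on {a..b}"
    using absolutely_integrable_cont_inner[OF drift_parts_cont(3) q, unfolded inner_real_def] by (rule set_lebesgue_integral_eq_integral)
  moreover have "(\<lambda>r. z r * (f\<^sub>t r (x r) + \<sigma>\<^sup>2 / 2 * lap r (x r))) integrable_on {a..b}"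
    by (intro integrable_continuous_interval drift_parts_cont)
  ultimately show ?thesis
    unfolding drift_def[abs_def] by (intro integrable_add)
qed

text \<open>On fine grids exactly the steps that start before \<open>\<tau>\<close> are carried out, so the last
of them ends within one mesh width of $\max(s, \min(t, \tau))$. The maximum covers the case
\<open>\<tau> \<le> s\<close>, in which no step is carried out.\<close>

lemma grid_limit:
  shows "\<forall>\<^sub>F N in sequentially. N > 0 \<and> (\<forall>I\<le>N. (\<forall>i<N. ok \<tau> B N i \<longleftrightarrow> i < I) \<longrightarrow> \<bar>grid N I - max s (min t \<tau>)\<bar> \<le> h N)"
  using eventually_grid_osc[OF adm_facts(2), of 1, simplified]
proof eventually_elim
  case (elim N)
  then have N: "N > 0" by simp
  have small: "norm (B (grid N (Suc i)) - B (grid N i)) \<le> 1" if "i < N" for i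
  proof -
    have "grid N i \<le> grid N (Suc i)" by (rule grid_mono) simp
    then have "dist (B (grid N (Suc i))) (B (grid N i)) < 1" using elim that by auto
    then show ?thesis by (simp add: dist_norm)
  qed
  show ?case
  proof (intro conjI N allI impI)
    fix I assume I: "I \<le> N" and okI: "\<forall>i<N. ok \<tau> B N i \<longleftrightarrow> i < I"
    have iff: "grid N i < \<tau> \<longleftrightarrow> i < I" if "i < N" for i
      using okI small that by (auto simp: ok_def alive_def)
    have hp: "h N > 0" using N by (rule h_pos)
    show "\<bar>grid N I - max s (min t \<tau>)\<bar> \<le> h N"
    proof (cases I)
      case 0
      then have "\<not> grid N 0 < \<tau>" using iff[of 0] N by simp
      then show ?thesis using 0 hp ast by (auto simp: grid_0)
    next
      case (Suc J)
      then have J: "grid N J < \<tau>" using iff[of J] I by simp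
      have gJ: "s \<le> grid N J" "grid N I \<le> t" "grid N I = grid N J + h N"
        using grid_in[of J N] grid_in[of I N] I Suc N by (auto simp: grid_Suc)
      show ?thesis
      proof (cases "I = N")
        case True
        then have "grid N I = t" using grid_N N by simp
        then show ?thesis using J gJ hp by (auto simp: max_def min_def)
      next
        case False
        then have "\<not> grid N I < \<tau>" using iff[of I] I by simp
        then show ?thesis using J gJ hp by (auto simp: max_def min_def)
      qed
    qed
  qed
qed

end

lemma product_sum_bounded:
  obtains C where "\<And>\<tau> B x z w q N. admissible \<tau> B x z w q \<Longrightarrow> N > 0 \<Longrightarrow>
    \<bar>\<Sum>i<N. if ok \<tau> B N i then P x z (grid N (Suc i)) - P x z (grid N i) else 0\<bar> \<le> C"
proof -
  obtain C where C: "C > 0" "\<And>r y. r \<in> {a..b} \<Longrightarrow> norm y \<le> R \<Longrightarrow> norm (f r y) \<le> C"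
    using bounded_on_cball[OF cont_f] by metis
  show thesis
  proof (rule that[of "2 * (C * Z)"])
    fix \<tau> B x z w q N assume adm: "admissible \<tau> B x z w q" and N: "N > (0::nat)"
    obtain I where I: "I \<le> N" "\<forall>i<N. ok \<tau> B N i \<longleftrightarrow> i < I" using ok_initial by blast
    have "(\<Sum>i<N. if ok \<tau> B N i then P x z (grid N (Suc i)) - P x z (grid N i) else 0) = P x z (grid N I) - P x z (grid N 0)"
      unfolding sum_ok[OF I] by (rule sum_lessThan_telescope)
    moreover have "\<bar>P x z (grid N I) - P x z (grid N 0)\<bar> \<le> 2 * (C * Z)"
    proof (cases I)
      case 0 then show ?thesis using C Z_nonneg by simp
    next
      case (Suc J)
      then have okJ: "ok \<tau> B N J" "ok \<tau> B N 0" "J < N" using I by auto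
      have b: "\<bar>P x z r\<bar> \<le> C * Z" if "r \<in> {a..b}" "norm (x r) \<le> R" for r
        unfolding P_def abs_mult using C(2)[OF that] z_bound[OF adm that(1)] C(1) by (intro mult_mono) auto
      have "\<bar>P x z (grid N I)\<bar> \<le> C * Z" "\<bar>P x z (grid N 0)\<bar> \<le> C * Z"
        using ok_bound[OF adm N okJ(3,1)] ok_bound[OF adm N _ okJ(2)] N I(1) Suc
        by (auto intro!: b grid_in')
      then show ?thesis by linarith
    qed
    ultimately show "\<bar>\<Sum>i<N. if ok \<tau> B N i then P x z (grid N (Suc i)) - P x z (grid N i) else 0\<bar> \<le> 2 * (C * Z)" by simp
  qed
qed

text \<open>The telescoped sums evaluate the product at the end of the last step, which converges to $\max(s,
\min(t, \tau))$ by \<open>grid_limit\<close>.\<close>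

lemma product_sum_limit:
  assumes adm: "admissible \<tau> B x z w q"
  shows "(\<lambda>N. \<Sum>i<N. if ok \<tau> B N i then P x z (grid N (Suc i)) - P x z (grid N i) else 0)
    \<longlonglongrightarrow> P x z (max s (min t \<tau>)) - P x z s"
proof -
  have "\<exists>I. \<forall>N. I N \<le> N \<and> (\<forall>i<N. ok \<tau> B N i \<longleftrightarrow> i < I N)" using ok_initial by (intro choice) blast
  then obtain I where I: "\<And>N. I N \<le> N" "\<And>N. \<forall>i<N. ok \<tau> B N i \<longleftrightarrow> i < I N" by blast
  have eq: "(\<Sum>i<N. if ok \<tau> B N i then P x z (grid N (Suc i)) - P x z (grid N i) else 0) = P x z (grid N (I N)) - P x z s" for N
    unfolding sum_ok[OF I] by (subst sum_lessThan_telescope) (simp add: grid_0)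
  have ev: "\<forall>\<^sub>F N in sequentially. \<bar>grid N (I N) - max s (min t \<tau>)\<bar> \<le> h N" and ev0: "\<forall>\<^sub>F N in sequentially. N > 0"
    using grid_limit[OF adm] I by (auto elim!: eventually_mono)
  have "(\<lambda>N. grid N (I N) - max s (min t \<tau>)) \<longlonglongrightarrow> 0"
    by (rule Lim_null_comparison[OF _ h_tendsto]) (use ev in \<open>auto elim: eventually_mono\<close>)
  then have lim: "(\<lambda>N. grid N (I N)) \<longlonglongrightarrow> max s (min t \<tau>)" by (simp add: LIM_zero_iff)
  have "continuous_on {a..b} (P x z)"
    unfolding P_def[abs_def] by (intro continuous_intros drift_parts_cont[OF adm] z_cont[OF adm])
  then have "(\<lambda>N. P x z (grid N (I N))) \<longlonglongrightarrow> P x z (max s (min t \<tau>))"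
  proof (rule continuous_on_tendsto_compose[OF _ lim])
    show "max s (min t \<tau>) \<in> {a..b}" using ast by auto
    show "\<forall>\<^sub>F N in sequentially. grid N (I N) \<in> {a..b}"
      using ev0 by eventually_elim (rule grid_in'[OF I(1)])
  qed
  then show ?thesis unfolding eq by (intro tendsto_diff tendsto_const)
qed


lemma transport_step_bound:
  obtains C where "C > 0" "\<And>\<tau> B x z w q N i. admissible \<tau> B x z w q \<Longrightarrow> N > 0 \<Longrightarrow> i < N \<Longrightarrow> ok \<tau> B N i \<Longrightarrow>
    \<bar>transport_step B x z N i\<bar> \<le> C * integral {grid N i..grid N (Suc i)} (\<lambda>r. 1 + g r)"
proof -
  obtain C1 where C1: "C1 > 0" "\<And>r y. r \<in> {a..b} \<Longrightarrow> norm y \<le> R \<Longrightarrow> norm (f r y) \<le> C1"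
    using bounded_on_cball[OF cont_f] by metis
  obtain C2 where C2: "C2 > 0" "\<And>r y. r \<in> {a..b} \<Longrightarrow> norm y \<le> R \<Longrightarrow> norm (lap r y) \<le> C2"
    using bounded_on_cball[OF lap_cont] by metis
  obtain L where L: "L > 0" "\<And>r r' y y'. \<lbrakk>r \<in> {a..b}; r' \<in> {a..b}; norm y \<le> R; norm y' \<le> R\<rbrakk>
      \<Longrightarrow> \<bar>f r' y' - f r y\<bar> \<le> L * (\<bar>r' - r\<bar> + norm (y' - y))"
    using lipschitz_on_cball by metis
  define C where "C = C1 + Z * L + Z * (\<sigma>\<^sup>2 / 2 * C2)"
  have Cpos: "C > 0" using C1 C2 L Z_nonneg unfolding C_def by (intro add_pos_nonneg) auto
  show thesis
  proof (rule that[OF Cpos])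
    fix \<tau> B x z w q and N i :: nat
    assume adm: "admissible \<tau> B x z w q" and N: "N > 0" "i < N" and ok: "ok \<tau> B N i"
    let ?T = "grid N i" and ?T' = "grid N (Suc i)"
    let ?x'' = "x ?T + \<sigma> *\<^sub>R (B ?T' - B ?T)"
    have T: "?T \<in> {a..b}" "?T' \<in> {a..b}" "?T' = ?T + h N" and hp: "h N > 0"
      using N grid_in'[of i N] grid_in'[of "Suc i" N] h_pos[of N] by (auto simp: grid_Suc)
    have ord: "a \<le> ?T" "?T \<le> ?T'" "?T' \<le> b" using T hp by auto
    define G where "G = integral {?T..?T'} g"
    have I: "integral {?T..?T'} (\<lambda>r. 1 + g r) = h N + G"
      unfolding G_def using ord hp T(3)
      by (subst Henstock_Kurzweil_Integration.integral_add[OF integrable_const_ivl g_sub]) auto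
    have G0: "0 \<le> G" unfolding G_def by (rule g_int_nonneg[OF ord])
    note xb = ok_bound[OF adm N ok] and zb = z_bound[OF adm T(1)]
    have dz: "\<bar>z ?T' - z ?T\<bar> \<le> G" using z_increment[OF adm ord] q_int_bound[OF adm ord] by (simp add: G_def)
    have dx: "norm (x ?T' - ?x'') \<le> G" using x_increment[OF adm ord] w_int_bound[OF adm ord] by (simp add: G_def)
    have 1: "\<bar>(z ?T' - z ?T) * f ?T' (x ?T')\<bar> \<le> G * C1"
      unfolding abs_mult using dz C1(2)[OF T(2) xb(3)] G0 by (intro mult_mono) auto
    have "\<bar>f ?T' (x ?T') - f ?T ?x''\<bar> \<le> L * (\<bar>?T' - ?T\<bar> + norm (x ?T' - ?x''))"
      by (rule L(2)[OF T(1,2) xb(2,3)])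
    also have "\<dots> \<le> L * (h N + G)" using T(3) hp dx L(1) by (intro mult_left_mono add_mono) auto
    finally have 2: "\<bar>z ?T * (f ?T' (x ?T') - f ?T ?x'')\<bar> \<le> Z * (L * (h N + G))"
      unfolding abs_mult using zb Z_nonneg by (intro mult_mono) auto
    have "\<bar>\<sigma>\<^sup>2 / 2 * h N * lap ?T (x ?T)\<bar> \<le> \<sigma>\<^sup>2 / 2 * h N * C2"
      using C2(2)[OF T(1) xb(1)] hp by (simp add: abs_mult mult_left_mono)
    then have 3: "\<bar>z ?T * (\<sigma>\<^sup>2 / 2 * h N * lap ?T (x ?T))\<bar> \<le> Z * (\<sigma>\<^sup>2 / 2 * h N * C2)"
      unfolding abs_mult[of "z ?T"] using zb Z_nonneg by (intro mult_mono) auto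
    have "\<bar>transport_step B x z N i\<bar> \<le> G * C1 + Z * (L * (h N + G)) + Z * (\<sigma>\<^sup>2 / 2 * h N * C2)"
      unfolding transport_step_def using 1 2 3 by linarith
    also have "\<dots> \<le> (h N + G) * C1 + Z * (L * (h N + G)) + Z * (\<sigma>\<^sup>2 / 2 * (h N + G) * C2)"
      using hp G0 C1 C2 Z_nonneg by (intro add_mono mult_right_mono mult_left_mono order_refl) auto
    also have "\<dots> = C * (h N + G)" by (simp add: C_def algebra_simps)
    finally show "\<bar>transport_step B x z N i\<bar> \<le> C * integral {?T..?T'} (\<lambda>r. 1 + g r)" unfolding I .
  qed
qed

lemma one_plus_g: "(\<lambda>r. 1 + g r) integrable_on {s..t}"
  using ast by (intro integrable_add integrable_const_ivl g_sub) auto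

lemma one_plus_g_grid_sum:
  assumes "N > 0" "I \<le> N"
  shows "(\<Sum>i<I. integral {grid N i..grid N (Suc i)} (\<lambda>r. 1 + g r)) \<le> integral {s..t} (\<lambda>r. 1 + g r)"
  unfolding grid_sum[OF assms one_plus_g]
proof (rule integral_subset_le)
  show "{s..grid N I} \<subseteq> {s..t}" using grid_in[OF assms(2,1)] by auto
  then show "(\<lambda>r. 1 + g r) integrable_on {s..grid N I}" by (rule integrable_on_subinterval[OF one_plus_g])
  show "\<forall>r\<in>{s..t}. 0 \<le> 1 + g r" using g_nonneg ast by (simp add: add_nonneg_nonneg)
qed (rule one_plus_g)

lemma transport_sum_bounded:
  obtains C where "\<And>\<tau> B x z w q N. admissible \<tau> B x z w q \<Longrightarrow> N > 0 \<Longrightarrow>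
    \<bar>\<Sum>i<N. if ok \<tau> B N i then transport_step B x z N i else 0\<bar> \<le> C"
proof -
  obtain C where C: "C > 0" "\<And>\<tau> B x z w q N i. admissible \<tau> B x z w q \<Longrightarrow> N > 0 \<Longrightarrow> i < N \<Longrightarrow> ok \<tau> B N i \<Longrightarrow>
    \<bar>transport_step B x z N i\<bar> \<le> C * integral {grid N i..grid N (Suc i)} (\<lambda>r. 1 + g r)"
    by (rule transport_step_bound) blast
  show thesis
  proof (rule that[of "C * integral {s..t} (\<lambda>r. 1 + g r)"])
    fix \<tau> B x z w q N assume adm: "admissible \<tau> B x z w q" and N: "N > (0::nat)"
    obtain I where I: "I \<le> N" "\<forall>i<N. ok \<tau> B N i \<longleftrightarrow> i < I" using ok_initial by blast
    have "\<bar>\<Sum>i<I. transport_step B x z N i\<bar> \<le> (\<Sum>i<I. C * integral {grid N i..grid N (Suc i)} (\<lambda>r. 1 + g r))"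
      using I by (intro order_trans[OF sum_abs] sum_mono C(2)[OF adm N]) auto
    also have "\<dots> \<le> C * integral {s..t} (\<lambda>r. 1 + g r)"
      unfolding sum_distrib_left[symmetric] using C(1) by (intro mult_left_mono one_plus_g_grid_sum N I) auto
    finally show "\<bar>\<Sum>i<N. if ok \<tau> B N i then transport_step B x z N i else 0\<bar> \<le> C * integral {s..t} (\<lambda>r. 1 + g r)"
      unfolding sum_ok[OF I] .
  qed
qed

text \<open>In the transport part the drift displacement is $\int w$ and the change of weight is $\int q$. A
first order expansion with coefficients frozen at one end of the step reproduces the integral of
\<open>drift\<close> over the step, because the coefficients are continuous along the path; the
error is small relative to $\int (1 + g)$ and can be summed.\<close>

lemma transport_step_drift:
  assumes adm: "admissible \<tau> B x z w q" and e: "\<epsilon> > 0"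
  shows "\<forall>\<^sub>F N in sequentially. N > 0 \<and> (\<forall>i<N. ok \<tau> B N i \<longrightarrow>
     \<bar>transport_step B x z N i - integral {grid N i..grid N (Suc i)} (drift x z w q)\<bar>
       \<le> \<epsilon> * (2 + Z) * integral {grid N i..grid N (Suc i)} (\<lambda>r. 1 + g r))"
proof -
  obtain d where d: "d > 0"
    "\<And>r r' y y' y''. \<lbrakk>r \<in> {a..b}; r' \<in> {a..b}; norm y \<le> R; norm y' \<le> R; norm y'' \<le> R;
        \<bar>r' - r\<bar> < d; norm (y' - y) < d; norm (y'' - y) < d\<rbrakk>
      \<Longrightarrow> \<bar>f r' y' - f r y'' - f\<^sub>t r y * (r' - r) - Df r y \<bullet> (y' - y'')\<bar> \<le> \<epsilon> * (\<bar>r' - r\<bar> + norm (y' - y''))"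
    using first_order_expansion[OF e, where R=R] by blast
  let ?c0 = "\<lambda>r. z r * (f\<^sub>t r (x r) + \<sigma>\<^sup>2 / 2 * lap r (x r))"
  let ?c1 = "\<lambda>r. z r *\<^sub>R Df r (x r)" and ?cf = "\<lambda>r. f r (x r)"
  have d2: "d / 2 > 0" using d by simp
  have Gc: "continuous_on {a..b} (\<lambda>r. integral {a..r} g)" by (rule indefinite_integral_continuous_1[OF g])
  have hd: "\<forall>\<^sub>F N in sequentially. h N < d" using h_tendsto d(1) by (rule order_tendstoD)
  show ?thesis
    using eventually_grid_osc[OF drift_parts_cont(1)[OF adm] e] eventually_grid_osc[OF drift_parts_cont(2)[OF adm] e]
      eventually_grid_osc[OF drift_parts_cont(3)[OF adm] e] eventually_grid_osc[OF x_cont[OF adm] d2]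
      eventually_grid_osc[OF Gc d2] hd
  proof eventually_elim
    case (elim N)
    then have N: "N > 0" by simp
    show ?case
    proof (intro conjI N allI impI)
      fix i assume i: "i < N" and ok: "ok \<tau> B N i"
      let ?T = "grid N i" and ?T' = "grid N (Suc i)"
      let ?x'' = "x ?T + \<sigma> *\<^sub>R (B ?T' - B ?T)"
      have T: "?T \<in> {a..b}" "?T' \<in> {a..b}" "?T' = ?T + h N" and hp: "h N > 0"
        using N i grid_in'[of i N] grid_in'[of "Suc i" N] h_pos[of N] by (auto simp: grid_Suc)
      have ord: "a \<le> ?T" "?T \<le> ?T'" "?T' \<le> b" using T hp by auto
      have sub: "{?T..?T'} \<subseteq> {a..b}" using ord by auto
      have ends: "?T \<in> {?T..?T'}" "?T' \<in> {?T..?T'}" using ord by auto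
      define G where "G = integral {?T..?T'} g"
      have I1: "integral {?T..?T'} (\<lambda>r. 1 + g r) = h N + G"
        unfolding G_def using ord hp T(3)
        by (subst Henstock_Kurzweil_Integration.integral_add[OF integrable_const_ivl g_sub]) auto
      have G0: "0 \<le> G" unfolding G_def by (rule g_int_nonneg[OF ord])
      have "integral {a..?T} g + G = integral {a..?T'} g"
        unfolding G_def by (rule Henstock_Kurzweil_Integration.integral_combine) (use ord g_sub in auto)
      moreover have "dist (integral {a..?T'} g) (integral {a..?T} g) < d / 2" using elim i ends by blast
      ultimately have Gd: "G < d / 2" unfolding dist_real_def by linarith
      note xb = ok_bound[OF adm N i ok] and zb = z_bound[OF adm T(1)]
      have dx: "x ?T' - ?x'' = integral {?T..?T'} w" using x_increment[OF adm ord] by simp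
      have dz: "z ?T' - z ?T = integral {?T..?T'} q" using z_increment[OF adm ord] by simp
      have dxG: "norm (x ?T' - ?x'') \<le> G" unfolding dx G_def by (rule w_int_bound[OF adm ord])
      have xT: "norm (x ?T' - x ?T) < d / 2" using elim i ends by (auto simp: dist_norm)
      have "norm (?x'' - x ?T) \<le> norm (x ?T' - x ?T) + norm (x ?T' - ?x'')"
        using norm_triangle_ineq4[of "x ?T' - x ?T" "x ?T' - ?x''"] by simp
      then have x''T: "norm (?x'' - x ?T) < d" using xT dxG Gd by linarith
      define e1 where "e1 = f ?T' (x ?T') - f ?T ?x'' - f\<^sub>t ?T (x ?T) * h N - Df ?T (x ?T) \<bullet> integral {?T..?T'} w"
      have "\<bar>f ?T' (x ?T') - f ?T ?x'' - f\<^sub>t ?T (x ?T) * (?T' - ?T) - Df ?T (x ?T) \<bullet> (x ?T' - ?x'')\<bar>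
          \<le> \<epsilon> * (\<bar>?T' - ?T\<bar> + norm (x ?T' - ?x''))"
        by (rule d(2)[OF T(1,2) xb(1,3,2)]) (use T(3) elim hp xT x''T d(1) in auto)
      also have "\<dots> \<le> \<epsilon> * (h N + G)" using T(3) hp dxG e by (intro mult_left_mono add_mono) auto
      finally have e1: "\<bar>e1\<bar> \<le> \<epsilon> * (h N + G)" using T(3) dx by (simp add: e1_def)
      have U: "transport_step B x z N i = ?cf ?T' * integral {?T..?T'} q + ?c0 ?T * h N + ?c1 ?T \<bullet> integral {?T..?T'} w + z ?T * e1"
        unfolding transport_step_def dz e1_def by (simp add: algebra_simps)
      have wi: "w integrable_on {?T..?T'}" and qi: "q integrable_on {?T..?T'}" and di: "drift x z w q integrable_on {?T..?T'}"
        and gi: "g integrable_on {?T..?T'}"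
        using integrable_on_subinterval[OF _ sub] adm_facts(3,4)[OF adm] drift_integrable[OF adm] g by blast+
      let ?D = "\<lambda>r. (?cf ?T' * q r + ?c0 ?T + ?c1 ?T \<bullet> w r) - drift x z w q r"
      have A: "((\<lambda>r. ?cf ?T' * q r + ?c0 ?T + ?c1 ?T \<bullet> w r) has_integral
          (?cf ?T' * integral {?T..?T'} q + ?c0 ?T * h N + ?c1 ?T \<bullet> integral {?T..?T'} w)) {?T..?T'}"
      proof (intro has_integral_add)
        show "((\<lambda>r. ?cf ?T' * q r) has_integral (?cf ?T' * integral {?T..?T'} q)) {?T..?T'}"
          using qi by (intro has_integral_mult_right integrable_integral)
        show "((\<lambda>r. ?c0 ?T) has_integral (?c0 ?T * h N)) {?T..?T'}"
          using has_integral_const_real[of "?c0 ?T" ?T ?T'] T(3) hp by (simp add: mult.commute)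
        show "((\<lambda>r. ?c1 ?T \<bullet> w r) has_integral (?c1 ?T \<bullet> integral {?T..?T'} w)) {?T..?T'}"
          using has_integral_linear[OF integrable_integral[OF wi] bounded_linear_inner_right[of "?c1 ?T"]] by (simp only: o_def)
      qed
      have Dint: "(?D has_integral (transport_step B x z N i - z ?T * e1 - integral {?T..?T'} (drift x z w q))) {?T..?T'}"
        using has_integral_diff[OF A integrable_integral[OF di]] by (simp add: U)
      have "norm (integral {?T..?T'} ?D) \<le> integral {?T..?T'} (\<lambda>r. 2 * \<epsilon> * (1 + g r))"
      proof (rule Henstock_Kurzweil_Integration.integral_norm_bound_integral)
        show "?D integrable_on {?T..?T'}" using Dint by (rule has_integral_integrable)
        show "(\<lambda>r. 2 * \<epsilon> * (1 + g r)) integrable_on {?T..?T'}"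
          by (intro integrable_on_mult_right integrable_add integrable_const_ivl gi)
        fix r assume r: "r \<in> {?T..?T'}"
        then have r': "r \<in> {a..b}" using sub by blast
        have o: "\<bar>?c0 ?T - ?c0 r\<bar> \<le> \<epsilon>" "norm (?c1 ?T - ?c1 r) \<le> \<epsilon>" "\<bar>?cf ?T' - ?cf r\<bar> \<le> \<epsilon>"
          using elim(1-3) i r ends by (force simp: dist_norm intro: less_imp_le)+
        have "\<bar>(?cf ?T' - ?cf r) * q r\<bar> \<le> \<epsilon> * g r"
          unfolding abs_mult using o(3) adm_facts(7)[OF adm r'] e by (intro mult_mono) auto
        moreover have "\<bar>(?c1 ?T - ?c1 r) \<bullet> w r\<bar> \<le> \<epsilon> * g r"
          using o(2) adm_facts(6)[OF adm r'] e by (intro order_trans[OF Cauchy_Schwarz_ineq2] mult_mono) auto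
        moreover have "?D r = (?c0 ?T - ?c0 r) + (?c1 ?T - ?c1 r) \<bullet> w r + (?cf ?T' - ?cf r) * q r"
          unfolding drift_def by (simp add: inner_diff_left algebra_simps)
        ultimately show "norm (?D r) \<le> 2 * \<epsilon> * (1 + g r)" using o(1) e by (simp add: algebra_simps)
      qed
      also have "integral {?T..?T'} (\<lambda>r. 2 * \<epsilon> * (1 + g r)) = 2 * \<epsilon> * (h N + G)"
        unfolding I1[symmetric] by simp
      finally have "\<bar>transport_step B x z N i - z ?T * e1 - integral {?T..?T'} (drift x z w q)\<bar> \<le> 2 * \<epsilon> * (h N + G)"
        using integral_unique[OF Dint] by simp
      moreover have "\<bar>z ?T * e1\<bar> \<le> Z * (\<epsilon> * (h N + G))"
        unfolding abs_mult using zb e1 Z_nonneg by (intro mult_mono) auto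
      ultimately have "\<bar>transport_step B x z N i - integral {?T..?T'} (drift x z w q)\<bar> \<le> 2 * \<epsilon> * (h N + G) + Z * (\<epsilon> * (h N + G))"
        by linarith
      then show "\<bar>transport_step B x z N i - integral {?T..?T'} (drift x z w q)\<bar>
         \<le> \<epsilon> * (2 + Z) * integral {?T..?T'} (\<lambda>r. 1 + g r)"
        unfolding I1 by (simp add: algebra_simps)
    qed
  qed
qed

lemma transport_sum_limit:
  assumes adm: "admissible \<tau> B x z w q"
  shows "(\<lambda>N. \<Sum>i<N. if ok \<tau> B N i then transport_step B x z N i else 0)
    \<longlonglongrightarrow> integral {s..max s (min t \<tau>)} (drift x z w q)"
proof -
  let ?d = "drift x z w q" and ?th = "max s (min t \<tau>)"
  have "\<exists>I. \<forall>N. I N \<le> N \<and> (\<forall>i<N. ok \<tau> B N i \<longleftrightarrow> i < I N)" using ok_initial by (intro choice) blast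
  then obtain I where I: "\<And>N. I N \<le> N" "\<And>N. \<forall>i<N. ok \<tau> B N i \<longleftrightarrow> i < I N" by blast
  have ev: "\<forall>\<^sub>F N in sequentially. \<bar>grid N (I N) - ?th\<bar> \<le> h N" and ev0: "\<forall>\<^sub>F N in sequentially. N > 0"
    using grid_limit[OF adm] I by (auto elim!: eventually_mono)
  have "(\<lambda>N. grid N (I N) - ?th) \<longlonglongrightarrow> 0"
    by (rule Lim_null_comparison[OF _ h_tendsto]) (use ev in \<open>auto elim: eventually_mono\<close>)
  then have lim: "(\<lambda>N. grid N (I N)) \<longlonglongrightarrow> ?th" by (simp add: LIM_zero_iff)
  have di: "?d integrable_on {s..t}"
    using ast by (intro integrable_on_subinterval[OF drift_integrable[OF adm]]) auto
  have lim1: "(\<lambda>N. integral {s..grid N (I N)} ?d) \<longlonglongrightarrow> integral {s..?th} ?d"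
  proof (rule continuous_on_tendsto_compose[OF indefinite_integral_continuous_1[OF di] lim])
    show "?th \<in> {s..t}" using ast by auto
    show "\<forall>\<^sub>F N in sequentially. grid N (I N) \<in> {s..t}" using ev0 by eventually_elim (rule grid_in[OF I(1)])
  qed
  define K where "K = (2 + Z) * integral {s..t} (\<lambda>r. 1 + g r)"
  have K0: "K \<ge> 0" unfolding K_def using Z_nonneg one_plus_g g_nonneg ast
    by (intro mult_nonneg_nonneg Henstock_Kurzweil_Integration.integral_nonneg) (auto intro: add_nonneg_nonneg)
  have "(\<lambda>N. (\<Sum>i<I N. transport_step B x z N i) - integral {s..grid N (I N)} ?d) \<longlonglongrightarrow> 0"
  proof (rule tendstoI)
    fix e :: real assume e: "e > 0"
    define \<epsilon> where "\<epsilon> = e / (K + 1)"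
    have \<epsilon>: "\<epsilon> > 0" "\<epsilon> * K < e" using e K0 by (auto simp: \<epsilon>_def field_simps)
    show "\<forall>\<^sub>F N in sequentially. dist ((\<Sum>i<I N. transport_step B x z N i) - integral {s..grid N (I N)} ?d) 0 < e"
      using transport_step_drift[OF adm \<epsilon>(1)]
    proof eventually_elim
      case (elim N)
      then have N: "N > 0" by simp
      have "\<bar>(\<Sum>i<I N. transport_step B x z N i) - integral {s..grid N (I N)} ?d\<bar>
          = \<bar>\<Sum>i<I N. transport_step B x z N i - integral {grid N i..grid N (Suc i)} ?d\<bar>"
        by (simp add: grid_sum[OF N I(1) di, symmetric] sum_subtractf)
      also have "\<dots> \<le> (\<Sum>i<I N. \<epsilon> * (2 + Z) * integral {grid N i..grid N (Suc i)} (\<lambda>r. 1 + g r))"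
        using elim I[of N] by (intro order_trans[OF sum_abs] sum_mono) auto
      also have "\<dots> \<le> \<epsilon> * (2 + Z) * integral {s..t} (\<lambda>r. 1 + g r)"
        unfolding sum_distrib_left[symmetric] using \<epsilon> Z_nonneg by (intro mult_left_mono one_plus_g_grid_sum N I) auto
      also have "\<dots> < e" using \<epsilon>(2) by (simp add: K_def mult.assoc)
      finally show ?case by simp
    qed
  qed
  from tendsto_add[OF this lim1] show ?thesis unfolding sum_ok[OF I] by simp
qed

end

section \<open>A stopped Ito formula\<close>

context drifted_particle begin

text \<open>If the step is carried out this is Taylor's theorem. If it is refused, the noise increment exceeds
1, and then its lower powers are dominated by the fourth; so the leading term, whose mean vanishes,
may be kept for all steps that are alive.\<close>

lemma noise_step_expansion:
  assumes e: "\<epsilon> > 0"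
  obtains C where "C > 0"
    "\<And>\<tau> B x z w q N i. admissible \<tau> B x z w q \<Longrightarrow> N > 0 \<Longrightarrow> i < N \<Longrightarrow> alive \<tau> B N i \<Longrightarrow>
      \<bar>(if ok \<tau> B N i then noise_step B x z N i else 0) - noise_leading B x z N i\<bar>
        \<le> \<epsilon> * (norm (B (grid N (Suc i)) - B (grid N i)))\<^sup>2
          + C * norm (B (grid N (Suc i)) - B (grid N i)) ^ 4
          + C * h N * (norm (B (grid N (Suc i)) - B (grid N i)))\<^sup>2"
proof -
  obtain C1 where C1: "C1 > 0" "\<And>r y. r \<in> {a..b} \<Longrightarrow> norm y \<le> R \<Longrightarrow> norm (Df r y) \<le> C1"
    using bounded_on_cball[OF cont_x] by metis
  obtain C2 where C2: "C2 > 0" "\<And>r y. r \<in> {a..b} \<Longrightarrow> norm y \<le> R \<Longrightarrow> norm (lap r y) \<le> C2"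
    using bounded_on_cball[OF lap_cont] by metis
  obtain C3 where C3: "C3 > 0" "\<And>r y. r \<in> {a..b} \<Longrightarrow> norm y \<le> R \<Longrightarrow> norm (D2f r y) \<le> C3"
    using bounded_on_cball[OF cont_xx] by metis
  define \<epsilon>' where "\<epsilon>' = \<epsilon> / (Z * \<sigma>\<^sup>2 + 1)"
  have pos: "Z * \<sigma>\<^sup>2 + 1 > 0" using Z_nonneg by (simp add: add_nonneg_pos)
  have \<epsilon>': "\<epsilon>' > 0" "Z * (\<epsilon>' * \<sigma>\<^sup>2) \<le> \<epsilon>" using e pos Z_nonneg by (auto simp: \<epsilon>'_def field_simps)
  obtain C4 where C4: "C4 > 0"
    "\<And>r y e. \<lbrakk>r \<in> {a..b}; norm y \<le> R; norm (y + e) \<le> R\<rbrakk>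
      \<Longrightarrow> \<bar>f r (y + e) - f r y - Df r y \<bullet> e - e \<bullet> (D2f r y *v e) / 2\<bar> \<le> \<epsilon>' * (norm e)\<^sup>2 + C4 * norm e ^ 4"
    using second_order_expansion[OF \<epsilon>'(1), where R=R] by blast
  define C where "C = 1 + Z * (C4 * \<sigma> ^ 4) + Z * (\<sigma> * C1 + \<sigma>\<^sup>2 / 2 * C3) + Z * (\<sigma>\<^sup>2 / 2 * C2)"
  have parts: "0 \<le> Z * (C4 * \<sigma> ^ 4)" "0 \<le> Z * (\<sigma> * C1 + \<sigma>\<^sup>2 / 2 * C3)" "0 \<le> Z * (\<sigma>\<^sup>2 / 2 * C2)"
    using Z_nonneg \<sigma> C1 C2 C3 C4 by simp_all
  have Cpos: "C > 0" unfolding C_def using parts by linarith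
  show thesis
  proof (rule that[OF Cpos])
    fix \<tau> B x z w q and N i :: nat
    assume adm: "admissible \<tau> B x z w q" and N: "N > 0" "i < N" and al: "alive \<tau> B N i"
    let ?T = "grid N i" and ?T' = "grid N (Suc i)"
    let ?b = "B ?T' - B ?T"
    have T: "?T \<in> {a..b}" and hp: "h N > 0" using N grid_in'[of i N] h_pos[of N] by auto
    have zb: "\<bar>z ?T\<bar> \<le> Z" by (rule z_bound[OF adm T])
    have xR: "norm (x ?T) \<le> R" using alive_bound[OF adm N(1) _ al] N by simp
    show "\<bar>(if ok \<tau> B N i then noise_step B x z N i else 0) - noise_leading B x z N i\<bar>
        \<le> \<epsilon> * (norm ?b)\<^sup>2 + C * norm ?b ^ 4 + C * h N * (norm ?b)\<^sup>2"
    proof (cases "ok \<tau> B N i")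
      case True
      have VL: "noise_step B x z N i - noise_leading B x z N i = z ?T * (f ?T (x ?T + \<sigma> *\<^sub>R ?b) - f ?T (x ?T)
          - Df ?T (x ?T) \<bullet> (\<sigma> *\<^sub>R ?b) - (\<sigma> *\<^sub>R ?b) \<bullet> (D2f ?T (x ?T) *v (\<sigma> *\<^sub>R ?b)) / 2)"
      proof -
        have aux: "c * (F - F' - d / 2 * u * l) - c * (e * L + d / 2 * (Q - u * l)) = c * (F - F' - e * L - d * Q / 2)"
          for c F F' d u l e L Q :: real by (simp add: field_simps)
        have Q: "(\<sigma> *\<^sub>R y) \<bullet> (D2f ?T (x ?T) *v (\<sigma> *\<^sub>R y)) = \<sigma>\<^sup>2 * (y \<bullet> (D2f ?T (x ?T) *v y))" for y
          by (simp add: matrix_vector_mult_scaleR power2_eq_square)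
        have L: "v \<bullet> (\<sigma> *\<^sub>R y) = \<sigma> * (v \<bullet> y)" for v y :: "real^'n" by simp
        show ?thesis unfolding noise_step_def noise_leading_def by (subst Q, subst L, rule aux)
      qed
      have "\<bar>noise_step B x z N i - noise_leading B x z N i\<bar> \<le> Z * (\<epsilon>' * (norm (\<sigma> *\<^sub>R ?b))\<^sup>2 + C4 * norm (\<sigma> *\<^sub>R ?b) ^ 4)"
        unfolding VL abs_mult using zb Z_nonneg
        by (intro mult_mono C4(2)[OF T xR ok_bound(2)[OF adm N True]]) auto
      also have "\<dots> = Z * (\<epsilon>' * \<sigma>\<^sup>2) * (norm ?b)\<^sup>2 + Z * (C4 * \<sigma> ^ 4) * norm ?b ^ 4"
        by (simp only: norm_scaleR abs_of_nonneg[OF \<sigma>] power_mult_distrib) (simp add: algebra_simps)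
      also have "\<dots> \<le> \<epsilon> * (norm ?b)\<^sup>2 + C * norm ?b ^ 4"
        using \<epsilon>'(2) parts by (intro add_mono mult_right_mono) (auto simp: C_def)
      also have "\<dots> \<le> \<epsilon> * (norm ?b)\<^sup>2 + C * norm ?b ^ 4 + C * h N * (norm ?b)\<^sup>2"
        using Cpos hp by simp
      finally show ?thesis using True by simp
    next
      case False
      then have big: "norm ?b > 1" using al by (simp add: ok_def)
      then have b4: "norm ?b \<le> norm ?b ^ 4" "(norm ?b)\<^sup>2 \<le> norm ?b ^ 4" "1 \<le> (norm ?b)\<^sup>2"
        using power_increasing[of 1 4 "norm ?b"] power_increasing[of 2 4 "norm ?b"] one_le_power[of "norm ?b" 2] by auto
      have "\<bar>Df ?T (x ?T) \<bullet> ?b\<bar> \<le> C1 * norm ?b ^ 4"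
        using C1(2)[OF T xR] b4(1) C1(1) by (intro order_trans[OF Cauchy_Schwarz_ineq2] mult_mono) auto
      then have 1: "\<bar>\<sigma> * (Df ?T (x ?T) \<bullet> ?b)\<bar> \<le> \<sigma> * (C1 * norm ?b ^ 4)"
        using \<sigma> by (simp add: abs_mult mult_left_mono)
      have "\<bar>?b \<bullet> (D2f ?T (x ?T) *v ?b)\<bar> \<le> C3 * norm ?b ^ 4"
        using C3(2)[OF T xR] b4(2) C3(1) by (intro order_trans[OF abs_quadratic_form_le] mult_mono) auto
      moreover have "\<bar>h N * lap ?T (x ?T)\<bar> \<le> h N * C2 * (norm ?b)\<^sup>2"
        using C2(2)[OF T xR] hp b4(3) C2(1) mult_mono[of "h N * \<bar>lap ?T (x ?T)\<bar>" "h N * C2" 1 "(norm ?b)\<^sup>2"]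
        by (simp add: abs_mult mult_left_mono)
      ultimately have "\<bar>?b \<bullet> (D2f ?T (x ?T) *v ?b) - h N * lap ?T (x ?T)\<bar> \<le> C3 * norm ?b ^ 4 + h N * C2 * (norm ?b)\<^sup>2"
        by linarith
      then have 2: "\<bar>\<sigma>\<^sup>2 / 2 * (?b \<bullet> (D2f ?T (x ?T) *v ?b) - h N * lap ?T (x ?T))\<bar>
          \<le> \<sigma>\<^sup>2 / 2 * (C3 * norm ?b ^ 4 + h N * C2 * (norm ?b)\<^sup>2)"
        unfolding abs_mult by (intro mult_mono) auto
      have "\<bar>noise_leading B x z N i\<bar> \<le> Z * (\<sigma> * (C1 * norm ?b ^ 4) + \<sigma>\<^sup>2 / 2 * (C3 * norm ?b ^ 4 + h N * C2 * (norm ?b)\<^sup>2))"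
        unfolding noise_leading_def abs_mult[of "z ?T"] using zb Z_nonneg 1 2
        by (intro mult_mono order_trans[OF abs_triangle_ineq] add_mono) auto
      also have "\<dots> = Z * (\<sigma> * C1 + \<sigma>\<^sup>2 / 2 * C3) * norm ?b ^ 4 + Z * (\<sigma>\<^sup>2 / 2 * C2) * (h N * (norm ?b)\<^sup>2)"
        by (simp add: algebra_simps)
      also have "\<dots> \<le> C * norm ?b ^ 4 + C * (h N * (norm ?b)\<^sup>2)"
        using parts hp by (intro add_mono mult_right_mono) (auto simp: C_def)
      finally have "\<bar>noise_leading B x z N i\<bar> \<le> C * norm ?b ^ 4 + C * (h N * (norm ?b)\<^sup>2)" .
      moreover have "0 \<le> \<epsilon> * (norm ?b)\<^sup>2" using e by simp
      ultimately show ?thesis using False by (simp add: mult.assoc)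
    qed
  qed
qed

end

lemma along_measurable:
  fixes kk :: "real \<Rightarrow> real^'n::finite \<Rightarrow> 'c::topological_space"
  assumes "continuous_on ({a..b} \<times> UNIV) (\<lambda>(t, x). kk t x)" "r \<in> {a..b}"
  shows "kk r \<in> borel_measurable borel"
proof (rule borel_measurable_continuous_onI)
  show "continuous_on UNIV (kk r)"
  proof -
    have "continuous_on UNIV (\<lambda>x::real^'n. (r, x))" by (intro continuous_intros)
    moreover have "(\<lambda>x. (r, x)) ` UNIV \<subseteq> {a..b} \<times> (UNIV :: (real^'n) set)" using assms(2) by auto
    ultimately show ?thesis using continuous_on_compose2[OF assms(1)] by fastforce
  qed
qed

text \<open>The random version of \<open>drifted_particle\<close>. Only the positions are adapted processes; the
drift integral is measurable because it is an almost sure limit of sums that involve positions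
alone.\<close>

locale stopped_ito = wiener_basis M \<F> W + drifted_particle a b f f\<^sub>t Df D2f s t \<sigma> k g x0 z0
  for M :: "'a measure" and \<F> :: "real \<Rightarrow> 'a measure" and W :: "real \<Rightarrow> 'a \<Rightarrow> real^'n::finite"
    and a b f f\<^sub>t and Df :: "real \<Rightarrow> real^'n \<Rightarrow> real^'n" and D2f s t \<sigma> k g and x0 :: "real^'n" and z0 +
  fixes \<tau> :: "'a \<Rightarrow> real" and x :: "real \<Rightarrow> 'a \<Rightarrow> real^'n" and z :: "real \<Rightarrow> 'a \<Rightarrow> real"
    and w :: "real \<Rightarrow> 'a \<Rightarrow> real^'n" and q :: "real \<Rightarrow> 'a \<Rightarrow> real" and A :: "'a set"
  assumes a0: "0 \<le> a"
    and stop: "\<And>r. r \<in> {a..b} \<Longrightarrow> Measurable.pred (\<F> r) (\<lambda>\<omega>. r < \<tau> \<omega>)"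
    and x_adapted: "\<And>r. r \<in> {a..b} \<Longrightarrow> x r \<in> borel_measurable (\<F> r)"
    and z_adapted: "\<And>r. r \<in> {a..b} \<Longrightarrow> z r \<in> borel_measurable (\<F> r)"
    and A: "A \<in> sets (\<F> s)"
    and adm: "AE \<omega> in M. admissible (\<tau> \<omega>) (\<lambda>r. W r \<omega> - W a \<omega>) (\<lambda>r. x r \<omega>) (\<lambda>r. z r \<omega>) (\<lambda>r. w r \<omega>) (\<lambda>r. q r \<omega>)"
begin

abbreviation "BB \<omega> r \<equiv> W r \<omega> - W a \<omega>"
abbreviation "aliveW N i \<omega> \<equiv> alive (\<tau> \<omega>) (BB \<omega>) N i"
abbreviation "okW N i \<omega> \<equiv> ok (\<tau> \<omega>) (BB \<omega>) N i"
abbreviation "incr N i \<omega> \<equiv> W (grid N (Suc i)) \<omega> - W (grid N i) \<omega>"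
abbreviation "transportW N i \<omega> \<equiv> transport_step (BB \<omega>) (\<lambda>r. x r \<omega>) (\<lambda>r. z r \<omega>) N i"
abbreviation "noiseW N i \<omega> \<equiv> noise_step (BB \<omega>) (\<lambda>r. x r \<omega>) (\<lambda>r. z r \<omega>) N i"
abbreviation "leadingW N i \<omega> \<equiv> noise_leading (BB \<omega>) (\<lambda>r. x r \<omega>) (\<lambda>r. z r \<omega>) N i"
abbreviation "PW r \<omega> \<equiv> P (\<lambda>r. x r \<omega>) (\<lambda>r. z r \<omega>) r"
abbreviation "\<kappa> N i \<omega> \<equiv> indicator A \<omega> * of_bool (aliveW N i \<omega>) :: real"

lemma grid_nonneg: "i \<le> N \<Longrightarrow> N > 0 \<Longrightarrow> 0 \<le> grid N i"
  using grid_in'[of i N] a0 by auto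

lemma W_at: "j \<le> i \<Longrightarrow> i \<le> N \<Longrightarrow> N > 0 \<Longrightarrow> W (grid N j) \<in> borel_measurable (\<F> (grid N i))"
  by (rule F_measurable_mono[OF _ grid_mono W_adapted]) (auto intro: grid_nonneg)

lemma x_at: "i \<le> N \<Longrightarrow> N > 0 \<Longrightarrow> x (grid N i) \<in> borel_measurable (\<F> (grid N i))"
  and z_at: "i \<le> N \<Longrightarrow> N > 0 \<Longrightarrow> z (grid N i) \<in> borel_measurable (\<F> (grid N i))"
  by (rule x_adapted[OF grid_in'] z_adapted[OF grid_in']; assumption)+

lemma A_at: "i \<le> N \<Longrightarrow> N > 0 \<Longrightarrow> A \<in> sets (\<F> (grid N i))"
  using A filtration_mono[of s "grid N i"] grid_in[of i N] ast a0 by auto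

lemma alive_measurable: "i \<le> N \<Longrightarrow> N > 0 \<Longrightarrow> Measurable.pred (\<F> (grid N i)) (aliveW N i)"
proof -
  assume i: "i \<le> N" "N > 0"
  have "Measurable.pred (\<F> (grid N i)) (\<lambda>\<omega>. j < i \<longrightarrow> norm (BB \<omega> (grid N (Suc j)) - BB \<omega> (grid N j)) \<le> 1)" for j
  proof (cases "j < i")
    case True
    have [measurable]: "W (grid N (Suc j)) \<in> borel_measurable (\<F> (grid N i))" "W (grid N j) \<in> borel_measurable (\<F> (grid N i))"
      using True i by (auto intro!: W_at)
    have "Measurable.pred (\<F> (grid N i)) (\<lambda>\<omega>. norm (W (grid N (Suc j)) \<omega> - W (grid N j) \<omega>) \<le> 1)" by measurable
    then show ?thesis using True by simp
  qed simp
  moreover note stop[OF grid_in'[OF i]]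
  ultimately show ?thesis unfolding alive_def by measurable
qed

lemma kappa_measurable: "i \<le> N \<Longrightarrow> N > 0 \<Longrightarrow> \<kappa> N i \<in> borel_measurable (\<F> (grid N i))"
  using alive_measurable[of i N] A_at[of i N] by measurable

lemma to_M: "i \<le> N \<Longrightarrow> N > 0 \<Longrightarrow> y \<in> measurable (\<F> (grid N i)) L \<Longrightarrow> y \<in> measurable M L"
  by (rule F_measurable_M[OF grid_nonneg])

lemma steps_measurable:
  assumes i: "i < N"
  shows "Measurable.pred M (okW N i)" "(\<lambda>\<omega>. transportW N i \<omega>) \<in> borel_measurable M" "(\<lambda>\<omega>. noiseW N i \<omega>) \<in> borel_measurable M"
    "(\<lambda>\<omega>. PW (grid N (Suc i)) \<omega> - PW (grid N i) \<omega>) \<in> borel_measurable M"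
proof -
  have N: "N > 0" "i \<le> N" "Suc i \<le> N" using i by auto
  have [measurable]: "W (grid N (Suc i)) \<in> borel_measurable M" "W (grid N i) \<in> borel_measurable M"
    "x (grid N (Suc i)) \<in> borel_measurable M" "x (grid N i) \<in> borel_measurable M"
    "z (grid N (Suc i)) \<in> borel_measurable M" "z (grid N i) \<in> borel_measurable M"
    "Measurable.pred M (aliveW N i)"
    using to_M[OF N(2,1) W_at[OF order_refl N(2,1)]] to_M[OF N(3,1) W_at[OF order_refl N(3,1)]]
      to_M[OF N(2,1) x_at[OF N(2,1)]] to_M[OF N(3,1) x_at[OF N(3,1)]]
      to_M[OF N(2,1) z_at[OF N(2,1)]] to_M[OF N(3,1) z_at[OF N(3,1)]] to_M[OF N(2,1) alive_measurable[OF N(2,1)]]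
    by auto
  have [measurable]: "W a \<in> borel_measurable M" by (rule F_measurable_M[OF a0 W_adapted[OF a0]])
  have [measurable]: "f (grid N i) \<in> borel_measurable borel" "f (grid N (Suc i)) \<in> borel_measurable borel"
    "lap (grid N i) \<in> borel_measurable borel"
    by (auto intro!: along_measurable cont_f lap_cont grid_in' simp: N)
  show "Measurable.pred M (okW N i)" unfolding ok_def by measurable
  show "(\<lambda>\<omega>. transportW N i \<omega>) \<in> borel_measurable M" unfolding transport_step_def by measurable
  show "(\<lambda>\<omega>. noiseW N i \<omega>) \<in> borel_measurable M" unfolding noise_step_def by measurable
  show "(\<lambda>\<omega>. PW (grid N (Suc i)) \<omega> - PW (grid N i) \<omega>) \<in> borel_measurable M" unfolding P_def by measurable
qed

text \<open>The coefficients of the quadratic polynomial are known at the beginning of the step, and the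
increment is independent of them, centred, with covariance \<open>h N\<close> times the identity.
The trace in \<open>lap\<close> cancels the quadratic term in the mean.\<close>

lemma noise_leading_mean_zero:
  assumes i: "i < N"
  shows "integrable M (\<lambda>\<omega>. \<kappa> N i \<omega> * leadingW N i \<omega>)" "expectation (\<lambda>\<omega>. \<kappa> N i \<omega> * leadingW N i \<omega>) = 0"
proof -
  have N: "N > 0" "i \<le> N" using i by auto
  let ?T = "grid N i" and ?T' = "grid N (Suc i)"
  have T: "?T \<in> {a..b}" by (rule grid_in'[OF N(2,1)])
  have T0: "0 \<le> ?T" and T': "?T < ?T'" using grid_nonneg[OF N(2,1)] h_pos[OF N(1)] by (auto simp: grid_Suc)
  have hT: "?T' - ?T = h N" by (simp add: grid_Suc)
  obtain C1 where C1: "C1 > 0" "\<And>r y. r \<in> {a..b} \<Longrightarrow> norm y \<le> R \<Longrightarrow> norm (Df r y) \<le> C1"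
    using bounded_on_cball[OF cont_x] by metis
  obtain C3 where C3: "C3 > 0" "\<And>r y. r \<in> {a..b} \<Longrightarrow> norm y \<le> R \<Longrightarrow> norm (D2f r y) \<le> C3"
    using bounded_on_cball[OF cont_xx] by metis
  define \<xi>1 where "\<xi>1 j \<omega> = \<kappa> N i \<omega> * (z ?T \<omega> * (\<sigma> * Df ?T (x ?T \<omega>) $ j))" for j \<omega>
  define \<xi>2 where "\<xi>2 j l \<omega> = \<kappa> N i \<omega> * (z ?T \<omega> * (\<sigma>\<^sup>2 / 2 * D2f ?T (x ?T \<omega>) $ j $ l))" for j l \<omega>
  note [measurable] = x_at[OF N(2,1)] z_at[OF N(2,1)]
  have "continuous_on ({a..b} \<times> UNIV) (\<lambda>(r, y). Df r y $ j)" for j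
    using cont_x unfolding split_beta by (intro continuous_intros) auto
  from along_measurable[OF this T] have [measurable]: "(\<lambda>y. Df ?T y $ j) \<in> borel_measurable borel" for j .
  have "continuous_on ({a..b} \<times> UNIV) (\<lambda>(r, y). D2f r y $ j $ l)" for j l
    using cont_xx unfolding split_beta by (intro continuous_intros) auto
  from along_measurable[OF this T] have [measurable]: "(\<lambda>y. D2f ?T y $ j $ l) \<in> borel_measurable borel" for j l .
  have m1: "\<xi>1 j \<in> borel_measurable (\<F> ?T)" for j
  proof -
    have "(\<lambda>\<omega>. Df ?T (x ?T \<omega>) $ j) \<in> borel_measurable (\<F> ?T)"
      by (rule measurable_compose[where f="x ?T" and g="\<lambda>y. Df ?T y $ j"]) measurable
    note [measurable] = this
    show ?thesis unfolding \<xi>1_def by (rule borel_measurable_times[OF kappa_measurable[OF N(2,1)]]) measurable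
  qed
  have m2: "\<xi>2 j l \<in> borel_measurable (\<F> ?T)" for j l
  proof -
    have "(\<lambda>\<omega>. D2f ?T (x ?T \<omega>) $ j $ l) \<in> borel_measurable (\<F> ?T)"
      by (rule measurable_compose[where f="x ?T" and g="\<lambda>y. D2f ?T y $ j $ l"]) measurable
    note [measurable] = this
    show ?thesis unfolding \<xi>2_def by (rule borel_measurable_times[OF kappa_measurable[OF N(2,1)]]) measurable
  qed
  have i1: "integrable M (\<xi>1 j)" for j
  proof (rule integrable_const_bound[where B="Z * (\<sigma> * C1)"])
    show "\<xi>1 j \<in> borel_measurable M" by (rule F_measurable_M[OF T0 m1])
    show "AE \<omega> in M. norm (\<xi>1 j \<omega>) \<le> Z * (\<sigma> * C1)"
      using adm
    proof eventually_elim
      case (elim \<omega>)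
      show ?case
      proof (cases "\<omega> \<in> A \<and> aliveW N i \<omega>")
        case True
        have "norm (x ?T \<omega>) \<le> R" using alive_bound[OF elim N] True by simp
        then have "\<bar>Df ?T (x ?T \<omega>) $ j\<bar> \<le> C1" using C1(2)[OF T] component_le_norm_cart order_trans by blast
        then have "\<bar>z ?T \<omega>\<bar> * (\<sigma> * \<bar>Df ?T (x ?T \<omega>) $ j\<bar>) \<le> Z * (\<sigma> * C1)"
          using z_bound[OF elim T] \<sigma> Z_nonneg by (intro mult_mono mult_nonneg_nonneg) auto
        then show ?thesis using True \<sigma> by (simp add: \<xi>1_def abs_mult)
      qed (use Z_nonneg \<sigma> C1(1) in \<open>auto simp: \<xi>1_def\<close>)
    qed
  qed
  have i2: "integrable M (\<xi>2 j l)" for j l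
  proof (rule integrable_const_bound[where B="Z * (\<sigma>\<^sup>2 / 2 * C3)"])
    show "\<xi>2 j l \<in> borel_measurable M" by (rule F_measurable_M[OF T0 m2])
    show "AE \<omega> in M. norm (\<xi>2 j l \<omega>) \<le> Z * (\<sigma>\<^sup>2 / 2 * C3)"
      using adm
    proof eventually_elim
      case (elim \<omega>)
      show ?case
      proof (cases "\<omega> \<in> A \<and> aliveW N i \<omega>")
        case True
        have "norm (x ?T \<omega>) \<le> R" using alive_bound[OF elim N] True by simp
        then have "\<bar>D2f ?T (x ?T \<omega>) $ j $ l\<bar> \<le> C3"
          using C3(2)[OF T] component_le_norm_cart[of "D2f ?T (x ?T \<omega>) $ j" l]
            Finite_Cartesian_Product.norm_nth_le[of "D2f ?T (x ?T \<omega>)" j] by fastforce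
        then have "\<bar>z ?T \<omega>\<bar> * (\<sigma>\<^sup>2 / 2 * \<bar>D2f ?T (x ?T \<omega>) $ j $ l\<bar>) \<le> Z * (\<sigma>\<^sup>2 / 2 * C3)"
          using z_bound[OF elim T] Z_nonneg by (intro mult_mono mult_nonneg_nonneg) auto
        then show ?thesis using True by (simp add: \<xi>2_def abs_mult)
      qed (use Z_nonneg C3(1) in \<open>auto simp: \<xi>2_def\<close>)
    qed
  qed
  note mom = increment_moments[OF T0 T']
  have p1: "integrable M (\<lambda>\<omega>. \<xi>1 j \<omega> * incr N i \<omega> $ j)" "expectation (\<lambda>\<omega>. \<xi>1 j \<omega> * incr N i \<omega> $ j) = 0" for j
    using increment_independent[OF T0 T' m1 i1, of "\<lambda>y. y $ j"] mom(1,2)[of j] by simp_all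
  have p2: "integrable M (\<lambda>\<omega>. \<xi>2 j l \<omega> * (incr N i \<omega> $ j * incr N i \<omega> $ l))"
    "expectation (\<lambda>\<omega>. \<xi>2 j l \<omega> * (incr N i \<omega> $ j * incr N i \<omega> $ l)) = (if j = l then h N * expectation (\<xi>2 j l) else 0)" for j l
    using increment_independent[OF T0 T' m2 i2, of "\<lambda>y. y $ j * y $ l"] mom(3,4)[of j l] hT by simp_all
  have eq: "\<kappa> N i \<omega> * leadingW N i \<omega> = (\<Sum>j\<in>UNIV. \<xi>1 j \<omega> * incr N i \<omega> $ j)
      + (\<Sum>j\<in>UNIV. \<Sum>l\<in>UNIV. \<xi>2 j l \<omega> * (incr N i \<omega> $ j * incr N i \<omega> $ l)) - h N * (\<Sum>j\<in>UNIV. \<xi>2 j j \<omega>)" for \<omega>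
  proof -
    have b: "BB \<omega> ?T' - BB \<omega> ?T = incr N i \<omega>" by simp
    have 1: "v \<bullet> y = (\<Sum>j\<in>UNIV. v $ j * y $ j)" for v y :: "real^'n" by (simp add: inner_vec_def)
    have 2: "y \<bullet> (D *v y) = (\<Sum>j\<in>UNIV. \<Sum>l\<in>UNIV. D $ j $ l * (y $ j * y $ l))" for y and D :: "real^'n^'n"
      by (simp add: inner_vec_def matrix_vector_mult_def sum_distrib_left mult_ac)
    let ?D = "Df ?T (x ?T \<omega>)" and ?D2 = "D2f ?T (x ?T \<omega>)" and ?y = "incr N i \<omega>" and ?c = "\<kappa> N i \<omega>" and ?z = "z ?T \<omega>"
    have aux: "c * (u * (d * S1 + e * (S2 - v * S3))) = c * (u * (d * S1)) + c * (u * (e * S2)) - v * (c * (u * (e * S3)))"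
      for c u d e v S1 S2 S3 :: real by (simp add: algebra_simps)
    have t1: "?c * (?z * (\<sigma> * (?D \<bullet> ?y))) = (\<Sum>j\<in>UNIV. \<xi>1 j \<omega> * ?y $ j)"
      unfolding 1 \<xi>1_def sum_distrib_left by (intro sum.cong refl) (simp only: mult.assoc)
    have t2: "?c * (?z * (\<sigma>\<^sup>2 / 2 * (?y \<bullet> (?D2 *v ?y)))) = (\<Sum>j\<in>UNIV. \<Sum>l\<in>UNIV. \<xi>2 j l \<omega> * (?y $ j * ?y $ l))"
      unfolding 2 \<xi>2_def sum_distrib_left by (intro sum.cong refl) (simp only: mult.assoc)
    have t3: "?c * (?z * (\<sigma>\<^sup>2 / 2 * lap ?T (x ?T \<omega>))) = (\<Sum>j\<in>UNIV. \<xi>2 j j \<omega>)"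
      unfolding lap_def trace_def \<xi>2_def sum_distrib_left ..
    show ?thesis unfolding noise_leading_def b aux t1 t2 t3 ..
  qed
  show "integrable M (\<lambda>\<omega>. \<kappa> N i \<omega> * leadingW N i \<omega>)"
    unfolding eq by (intro Bochner_Integration.integrable_add Bochner_Integration.integrable_diff
      Bochner_Integration.integrable_sum p1 p2 integrable_mult_right i2)
  have "expectation (\<lambda>\<omega>. \<kappa> N i \<omega> * leadingW N i \<omega>) = (\<Sum>j\<in>UNIV. expectation (\<lambda>\<omega>. \<xi>1 j \<omega> * incr N i \<omega> $ j))
      + (\<Sum>j\<in>UNIV. \<Sum>l\<in>UNIV. expectation (\<lambda>\<omega>. \<xi>2 j l \<omega> * (incr N i \<omega> $ j * incr N i \<omega> $ l))) - h N * (\<Sum>j\<in>UNIV. expectation (\<xi>2 j j))"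
    unfolding eq
    by (simp only: Bochner_Integration.integral_add Bochner_Integration.integral_diff Bochner_Integration.integral_sum
        Bochner_Integration.integrable_sum Bochner_Integration.integrable_add p1 p2 i2 integrable_mult_right integral_mult_right_zero)
  also have "\<dots> = 0" unfolding p1 p2 by (simp add: sum_distrib_left)
  finally show "expectation (\<lambda>\<omega>. \<kappa> N i \<omega> * leadingW N i \<omega>) = 0" .
qed

lemma noise_step_mean:
  assumes e: "\<epsilon> > 0"
  obtains C where "C > 0" "\<And>N i. i < N \<Longrightarrow> integrable M (\<lambda>\<omega>. indicator A \<omega> * (if okW N i \<omega> then noiseW N i \<omega> else 0))"
    "\<And>N i. i < N \<Longrightarrow> \<bar>expectation (\<lambda>\<omega>. indicator A \<omega> * (if okW N i \<omega> then noiseW N i \<omega> else 0))\<bar>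
        \<le> \<epsilon> * (real CARD('n) * h N) + C * (h N)\<^sup>2"
proof -
  obtain C where C: "C > 0"
    "\<And>\<tau> B x z w q N i. admissible \<tau> B x z w q \<Longrightarrow> N > 0 \<Longrightarrow> i < N \<Longrightarrow> alive \<tau> B N i \<Longrightarrow>
      \<bar>(if ok \<tau> B N i then noise_step B x z N i else 0) - noise_leading B x z N i\<bar>
        \<le> \<epsilon> * (norm (B (grid N (Suc i)) - B (grid N i)))\<^sup>2
          + C * norm (B (grid N (Suc i)) - B (grid N i)) ^ 4
          + C * h N * (norm (B (grid N (Suc i)) - B (grid N i)))\<^sup>2"
    by (rule noise_step_expansion[OF e]) blast
  define n where "n = real CARD('n)"
  have n0: "n > 0" by (simp add: n_def)
  have main: "integrable M (\<lambda>\<omega>. indicator A \<omega> * (if okW N i \<omega> then noiseW N i \<omega> else 0)) \<and>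
    \<bar>expectation (\<lambda>\<omega>. indicator A \<omega> * (if okW N i \<omega> then noiseW N i \<omega> else 0))\<bar>
        \<le> \<epsilon> * (n * h N) + (C * (3 * n\<^sup>2) + C * n) * (h N)\<^sup>2" if i: "i < N" for N i
  proof -
    have N: "N > 0" "i \<le> N" using i by auto
    let ?T = "grid N i" and ?T' = "grid N (Suc i)"
    have T0: "0 \<le> ?T" and T': "?T \<le> ?T'" and hT: "?T' - ?T = h N"
      using grid_nonneg[OF N(2,1)] h_pos[OF N(1)] by (auto simp: grid_Suc)
    have hp: "h N > 0" using N by (intro h_pos)
    note nm = increment_norm_moments[OF T0 T', unfolded hT n_def[symmetric]]
    define X where "X \<omega> = indicator A \<omega> * (if okW N i \<omega> then noiseW N i \<omega> else 0)" for \<omega>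
    define L where "L \<omega> = \<kappa> N i \<omega> * leadingW N i \<omega>" for \<omega>
    define E where "E \<omega> = \<epsilon> * (norm (incr N i \<omega>))\<^sup>2 + C * norm (incr N i \<omega>) ^ 4 + C * h N * (norm (incr N i \<omega>))\<^sup>2" for \<omega>
    note sm = steps_measurable[OF i]
    have "A \<in> sets M" using A_at[OF N(2,1)] sets_F[OF T0] by auto
    then have Xm: "X \<in> borel_measurable M" unfolding X_def using sm(1,3) by measurable
    have Li: "integrable M L" and L0: "expectation L = 0" unfolding L_def by (rule noise_leading_mean_zero[OF i])+
    have Ei: "integrable M E" unfolding E_def by (intro Bochner_Integration.integrable_add integrable_mult_right nm)
    have bound: "AE \<omega> in M. \<bar>X \<omega> - L \<omega>\<bar> \<le> E \<omega>"
      using adm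
    proof eventually_elim
      case (elim \<omega>)
      have E0: "0 \<le> E \<omega>" unfolding E_def using e C(1) hp by simp
      have b: "BB \<omega> ?T' - BB \<omega> ?T = incr N i \<omega>" by simp
      show ?case
      proof (cases "\<omega> \<in> A \<and> aliveW N i \<omega>")
        case True
        then show ?thesis using C(2)[OF elim N(1) i, unfolded b] by (simp add: X_def L_def E_def)
      next
        case False
        then have "X \<omega> = 0" "L \<omega> = 0" by (auto simp: X_def L_def ok_def)
        then show ?thesis using E0 by simp
      qed
    qed
    have Di: "integrable M (\<lambda>\<omega>. X \<omega> - L \<omega>)"
      by (rule Bochner_Integration.integrable_bound[OF Ei])
        (use bound Xm Li in \<open>auto elim!: eventually_mono\<close>)
    have Xi: "integrable M X" using Bochner_Integration.integrable_add[OF Di Li] by simp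
    have "expectation X = expectation (\<lambda>\<omega>. X \<omega> - L \<omega>)" using Xi Li L0 by simp
    then have "\<bar>expectation X\<bar> \<le> expectation (\<lambda>\<omega>. \<bar>X \<omega> - L \<omega>\<bar>)" by simp
    also have "\<dots> \<le> expectation E" by (rule integral_mono_AE) (use Di Ei bound in auto)
    also have "\<dots> = \<epsilon> * (n * h N) + C * expectation (\<lambda>\<omega>. norm (incr N i \<omega>) ^ 4) + C * h N * (n * h N)"
      unfolding E_def using nm by simp
    also have "\<dots> \<le> \<epsilon> * (n * h N) + C * (3 * n\<^sup>2 * (h N)\<^sup>2) + C * h N * (n * h N)"
      using nm(4) C(1) by (intro add_mono mult_left_mono order_refl) auto
    also have "\<dots> = \<epsilon> * (n * h N) + (C * (3 * n\<^sup>2) + C * n) * (h N)\<^sup>2"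
      by (simp add: power2_eq_square algebra_simps)
    finally show ?thesis using Xi unfolding X_def by simp
  qed
  show thesis
    by (rule that[of "C * (3 * n\<^sup>2) + C * n"]) (use main C(1) n0 in \<open>auto simp: n_def intro!: add_pos_pos\<close>)
qed

text \<open>There are \<open>N\<close> steps of length $h = (t-s)/N$, each with mean at most $\epsilon n h + C
h^2$; the sum is at most $\epsilon n (t-s)$ in the limit, for every $\epsilon > 0$.\<close>

lemma noise_sum_mean_tendsto:
  "(\<lambda>N. expectation (\<lambda>\<omega>. \<Sum>i<N. indicator A \<omega> * (if okW N i \<omega> then noiseW N i \<omega> else 0))) \<longlonglongrightarrow> 0"
proof (rule tendstoI)
  fix e :: real assume e: "e > 0"
  define n where "n = real CARD('n)"
  have n0: "n > 0" by (simp add: n_def)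
  define \<epsilon> where "\<epsilon> = e / (2 * n * (t - s))"
  have \<epsilon>: "\<epsilon> > 0" "\<epsilon> * n * (t - s) = e / 2" 
  proof -
    have "d / (2 * m * l) * m * l = d / 2" if "m > 0" "l > 0" for d m l :: real using that by (simp add: field_simps)
    then show "\<epsilon> * n * (t - s) = e / 2" using n0 ast by (simp add: \<epsilon>_def del: right_diff_distrib_numeral)
    show "\<epsilon> > 0" unfolding \<epsilon>_def using e n0 ast by (intro divide_pos_pos mult_pos_pos) auto
  qed
  obtain C where C: "C > 0" "\<And>N i. i < N \<Longrightarrow> integrable M (\<lambda>\<omega>. indicator A \<omega> * (if okW N i \<omega> then noiseW N i \<omega> else 0))"
    "\<And>N i. i < N \<Longrightarrow> \<bar>expectation (\<lambda>\<omega>. indicator A \<omega> * (if okW N i \<omega> then noiseW N i \<omega> else 0))\<bar>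
        \<le> \<epsilon> * (n * h N) + C * (h N)\<^sup>2"
    unfolding n_def by (rule noise_step_mean[OF \<epsilon>(1)]) blast
  have "(\<lambda>N. C * (t - s) * h N) \<longlonglongrightarrow> C * (t - s) * 0" by (intro tendsto_intros h_tendsto)
  then have "\<forall>\<^sub>F N in sequentially. C * (t - s) * h N < e / 2"
    using e by (intro order_tendstoD(2)) auto
  then show "\<forall>\<^sub>F N in sequentially. dist (expectation (\<lambda>\<omega>. \<Sum>i<N. indicator A \<omega> * (if okW N i \<omega> then noiseW N i \<omega> else 0))) 0 < e"
    using eventually_gt_at_top[of "0::nat"]
  proof eventually_elim
    case (elim N)
    have hN: "real N * h N = t - s" using elim by (simp add: h_def)
    have sum: "expectation (\<lambda>\<omega>. \<Sum>i<N. indicator A \<omega> * (if okW N i \<omega> then noiseW N i \<omega> else 0))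
      = (\<Sum>i<N. expectation (\<lambda>\<omega>. indicator A \<omega> * (if okW N i \<omega> then noiseW N i \<omega> else 0)))"
      by (rule Bochner_Integration.integral_sum) (use C(2) in auto)
    have "\<bar>expectation (\<lambda>\<omega>. \<Sum>i<N. indicator A \<omega> * (if okW N i \<omega> then noiseW N i \<omega> else 0))\<bar>
        \<le> (\<Sum>i<N. \<epsilon> * (n * h N) + C * (h N)\<^sup>2)"
      unfolding sum by (intro order_trans[OF sum_abs] sum_mono C(3)) auto
    also have "\<dots> = \<epsilon> * n * (real N * h N) + C * (real N * h N) * h N"
      by (simp add: power2_eq_square algebra_simps)
    also have "\<dots> < e" unfolding hN using \<epsilon>(2) elim by simp
    finally show ?case by simp
  qed
qed

text \<open>The sums of the full increments are bounded and converge to the left-hand side, the sums of the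
transport parts are bounded and converge to the drift integral, and their difference has mean
tending to zero. Testing with the events \<open>A\<close> of the past at time \<open>s\<close> makes
this the martingale property of the difference.\<close>

theorem stopped_ito_formula:
  defines "\<theta> \<equiv> \<lambda>\<omega>. max s (min t (\<tau> \<omega>))"
  shows "integrable M (\<lambda>\<omega>. indicator A \<omega> * (PW (\<theta> \<omega>) \<omega> - PW s \<omega>))" (is ?i1)
    and "integrable M (\<lambda>\<omega>. indicator A \<omega> * integral {s..\<theta> \<omega>} (drift (\<lambda>r. x r \<omega>) (\<lambda>r. z r \<omega>) (\<lambda>r. w r \<omega>) (\<lambda>r. q r \<omega>)))" (is ?i2)
    and "expectation (\<lambda>\<omega>. indicator A \<omega> * (PW (\<theta> \<omega>) \<omega> - PW s \<omega>))
       = expectation (\<lambda>\<omega>. indicator A \<omega> * integral {s..\<theta> \<omega>} (drift (\<lambda>r. x r \<omega>) (\<lambda>r. z r \<omega>) (\<lambda>r. w r \<omega>) (\<lambda>r. q r \<omega>)))" (is ?eq)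
proof -
  define QN where "QN N \<omega> = (\<Sum>i<N. indicator A \<omega> * (if okW N i \<omega> then PW (grid N (Suc i)) \<omega> - PW (grid N i) \<omega> else 0))" for N \<omega>
  define SN where "SN N \<omega> = (\<Sum>i<N. indicator A \<omega> * (if okW N i \<omega> then transportW N i \<omega> else 0))" for N \<omega>
  define VN where "VN N \<omega> = (\<Sum>i<N. indicator A \<omega> * (if okW N i \<omega> then noiseW N i \<omega> else 0))" for N \<omega>
  define Qinf where "Qinf \<omega> = indicator A \<omega> * (PW (\<theta> \<omega>) \<omega> - PW s \<omega>)" for \<omega>
  define Sinf where "Sinf \<omega> = indicator A \<omega> * integral {s..\<theta> \<omega>} (drift (\<lambda>r. x r \<omega>) (\<lambda>r. z r \<omega>) (\<lambda>r. w r \<omega>) (\<lambda>r. q r \<omega>))" for \<omega>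
  have QSV: "QN N \<omega> = SN N \<omega> + VN N \<omega>" for N \<omega>
    unfolding QN_def SN_def VN_def sum.distrib[symmetric] by (intro sum.cong refl) (simp add: P_step[where B="BB \<omega>"] distrib_left)
  have [measurable]: "A \<in> sets M" using A sets_F[of s] a0 ast by auto
  have Qm: "QN N \<in> borel_measurable M" for N
    unfolding QN_def[abs_def]
  proof (rule borel_measurable_sum)
    fix i assume "i \<in> {..<N}"
    then have "i < N" by simp
    note [measurable] = steps_measurable(1,4)[OF this]
    show "(\<lambda>\<omega>. indicator A \<omega> * (if okW N i \<omega> then PW (grid N (Suc i)) \<omega> - PW (grid N i) \<omega> else 0)) \<in> borel_measurable M"
      by (intro borel_measurable_times borel_measurable_indicator measurable_If) (measurable)
  qed
  have Sm: "SN N \<in> borel_measurable M" for N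
    unfolding SN_def[abs_def]
  proof (rule borel_measurable_sum)
    fix i assume "i \<in> {..<N}"
    then have "i < N" by simp
    note [measurable] = steps_measurable(1,2)[OF this]
    show "(\<lambda>\<omega>. indicator A \<omega> * (if okW N i \<omega> then transportW N i \<omega> else 0)) \<in> borel_measurable M"
      by measurable
  qed
  obtain C1 where C1: "\<And>\<tau> B x z w q N. admissible \<tau> B x z w q \<Longrightarrow> N > 0 \<Longrightarrow>
    \<bar>\<Sum>i<N. if ok \<tau> B N i then P x z (grid N (Suc i)) - P x z (grid N i) else 0\<bar> \<le> C1"
    by (rule product_sum_bounded) blast
  obtain C2 where C2: "\<And>\<tau> B x z w q N. admissible \<tau> B x z w q \<Longrightarrow> N > 0 \<Longrightarrow>
    \<bar>\<Sum>i<N. if ok \<tau> B N i then transport_step B x z N i else 0\<bar> \<le> C2"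
    by (rule transport_sum_bounded) blast
  have Qb: "AE \<omega> in M. norm (QN N \<omega>) \<le> \<bar>C1\<bar>" for N
    using adm
  proof eventually_elim
    case (elim \<omega>)
    show ?case
    proof (cases "N = 0")
      case False
      then show ?thesis using C1[OF elim, of N] by (cases "\<omega> \<in> A") (auto simp: QN_def)
    qed (simp add: QN_def)
  qed
  have Sb: "AE \<omega> in M. norm (SN N \<omega>) \<le> \<bar>C2\<bar>" for N
    using adm
  proof eventually_elim
    case (elim \<omega>)
    show ?case
    proof (cases "N = 0")
      case False
      then show ?thesis using C2[OF elim, of N] by (cases "\<omega> \<in> A") (auto simp: SN_def)
    qed (simp add: SN_def)
  qed
  have Ql: "AE \<omega> in M. (\<lambda>N. QN N \<omega>) \<longlonglongrightarrow> Qinf \<omega>"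
    using adm by eventually_elim
      (simp add: QN_def Qinf_def \<theta>_def sum_distrib_left[symmetric], intro tendsto_mult_left product_sum_limit)
  have Sl: "AE \<omega> in M. (\<lambda>N. SN N \<omega>) \<longlonglongrightarrow> Sinf \<omega>"
    using adm by eventually_elim
      (simp add: SN_def Sinf_def \<theta>_def sum_distrib_left[symmetric], intro tendsto_mult_left transport_sum_limit)
  have cm: "complete_measure M" by (rule complete_measure_axioms)
  have Qim: "Qinf \<in> borel_measurable M" and Sim: "Sinf \<in> borel_measurable M"
    by (rule measurable_AE_LIMSEQ_complete[OF cm _ _ _ Qm Ql] measurable_AE_LIMSEQ_complete[OF cm _ _ _ Sm Sl]; auto)+
  note DQ = integrable_dominated_convergence[OF Qim Qm _ Ql Qb] integral_dominated_convergence[OF Qim Qm _ Ql Qb]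
    integrable_dominated_convergence2[OF Qim Qm _ Ql Qb]
  note DS = integrable_dominated_convergence[OF Sim Sm _ Sl Sb] integral_dominated_convergence[OF Sim Sm _ Sl Sb]
    integrable_dominated_convergence2[OF Sim Sm _ Sl Sb]
  show ?i1 using DQ(1) unfolding Qinf_def by simp
  show ?i2 using DS(1) unfolding Sinf_def by simp
  have "expectation (VN N) = expectation (QN N) - expectation (SN N)" for N
  proof -
    have "VN N = (\<lambda>\<omega>. QN N \<omega> - SN N \<omega>)" using QSV by (simp add: fun_eq_iff)
    then show ?thesis using DQ(3) DS(3) by simp
  qed
  moreover have "(\<lambda>N. expectation (VN N)) \<longlonglongrightarrow> 0" unfolding VN_def by (rule noise_sum_mean_tendsto)
  ultimately have "(\<lambda>N. expectation (QN N) - expectation (SN N)) \<longlonglongrightarrow> 0" by simp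
  moreover have "(\<lambda>N. expectation (QN N) - expectation (SN N)) \<longlonglongrightarrow> expectation Qinf - expectation Sinf"
    using DQ(2) DS(2) by (intro tendsto_diff) simp_all
  ultimately have "expectation Qinf - expectation Sinf = 0" by (rule LIMSEQ_unique[rotated])
  then show ?eq unfolding Qinf_def Sinf_def by simp
qed

end

section \<open>Exit times and stopped processes\<close>

context wiener_basis
begin

text \<open>On the exceptional null set \<open>N\<close>, where the path may be discontinuous, the exit time is
put equal to \<open>b\<close>; the element \<open>b\<close> is also added to the set to cover paths
that never reach the level.\<close>

definition exit_time :: "real \<Rightarrow> real \<Rightarrow> 'a set \<Rightarrow> real \<Rightarrow> 'a \<Rightarrow> real" where
  "exit_time a b N \<kappa> \<omega> = (if \<omega> \<in> N then b else Inf ({r \<in> {a..b}. \<kappa> \<le> norm (W r \<omega> - W a \<omega>)} \<union> {b}))"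

context
  fixes a b :: real and N :: "'a set"
  assumes ab: "0 \<le> a" "a \<le> b" and N: "N \<in> null_sets M"
    and cont: "\<And>\<omega>. \<omega> \<in> space M \<Longrightarrow> \<omega> \<notin> N \<Longrightarrow> continuous_on {0..} (\<lambda>t. W t \<omega>)"
begin

lemma path_cont: "\<omega> \<in> space M \<Longrightarrow> \<omega> \<notin> N \<Longrightarrow> continuous_on {a..b} (\<lambda>r. W r \<omega> - W a \<omega>)"
  using ab by (intro continuous_intros continuous_on_subset[OF cont]) auto

lemma exit_time_range: "exit_time a b N \<kappa> \<omega> \<in> {a..b}"
  using ab unfolding exit_time_def by (auto intro!: cInf_lower cInf_greatest bdd_belowI[of _ a])

lemma exit_time_attained:
  assumes \<omega>: "\<omega> \<in> space M" "\<omega> \<notin> N"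
  shows "exit_time a b N \<kappa> \<omega> \<in> {r \<in> {a..b}. \<kappa> \<le> norm (W r \<omega> - W a \<omega>)} \<union> {b}"
proof -
  let ?S = "{r \<in> {a..b}. \<kappa> \<le> norm (W r \<omega> - W a \<omega>)}"
  have "closed ?S"
    by (rule continuous_on_closed_Collect_le[OF continuous_on_const continuous_on_norm[OF path_cont[OF \<omega>]]]) simp
  then have "closed (?S \<union> {b})" by (intro closed_Un) auto
  then have "Inf (?S \<union> {b}) \<in> ?S \<union> {b}"
    using ab by (intro closed_contains_Inf) (auto intro!: bdd_belowI[of _ a])
  then show ?thesis using \<omega> by (simp add: exit_time_def)
qed

lemma exit_time_le_iff:
  assumes \<omega>: "\<omega> \<in> space M" "\<omega> \<notin> N" and t: "a \<le> t" "t < b"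
  shows "exit_time a b N \<kappa> \<omega> \<le> t \<longleftrightarrow> (\<exists>r\<in>{a..t}. \<kappa> \<le> norm (W r \<omega> - W a \<omega>))"
proof
  assume "exit_time a b N \<kappa> \<omega> \<le> t"
  then show "\<exists>r\<in>{a..t}. \<kappa> \<le> norm (W r \<omega> - W a \<omega>)"
    using exit_time_attained[OF \<omega>, of \<kappa>] t by auto
next
  assume "\<exists>r\<in>{a..t}. \<kappa> \<le> norm (W r \<omega> - W a \<omega>)"
  then obtain r where r: "r \<in> {a..t}" "\<kappa> \<le> norm (W r \<omega> - W a \<omega>)" by blast
  have "Inf ({r \<in> {a..b}. \<kappa> \<le> norm (W r \<omega> - W a \<omega>)} \<union> {b}) \<le> r"
    using r t by (intro cInf_lower) (auto intro!: bdd_belowI[of _ a] simp: ab)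
  then show "exit_time a b N \<kappa> \<omega> \<le> t" using r \<omega> by (simp add: exit_time_def)
qed

lemma before_exit_time:
  assumes \<omega>: "\<omega> \<in> space M" "\<omega> \<notin> N" and \<kappa>: "0 < \<kappa>" and r: "r \<in> {a..b}" "r \<le> exit_time a b N \<kappa> \<omega>"
  shows "norm (W r \<omega> - W a \<omega>) \<le> \<kappa>"
proof (rule ccontr)
  assume "\<not> ?thesis"
  then have big: "\<kappa> < norm (W r \<omega> - W a \<omega>)" by simp
  then have ra: "a < r" using \<kappa> r by (cases "r = a") auto
  have c: "continuous_on {a..r} (\<lambda>r. norm (W r \<omega> - W a \<omega>))"
    using r by (intro continuous_on_norm continuous_on_subset[OF path_cont[OF \<omega>]]) auto
  obtain r' where r': "a \<le> r'" "r' \<le> r" "norm (W r' \<omega> - W a \<omega>) = \<kappa>"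
    using IVT'[OF _ less_imp_le[OF big] less_imp_le[OF ra] c] \<kappa> by auto
  have ne: "r' \<noteq> r" using r'(3) big by auto
  have "Inf ({r \<in> {a..b}. \<kappa> \<le> norm (W r \<omega> - W a \<omega>)} \<union> {b}) \<le> r'"
    using r r' by (intro cInf_lower) (auto intro!: bdd_belowI[of _ a] simp: ab)
  then show False using r(2) r'(2) ne \<omega> by (simp add: exit_time_def)
qed

lemma exit_time_mono: "\<kappa> \<le> \<kappa>' \<Longrightarrow> exit_time a b N \<kappa> \<omega> \<le> exit_time a b N \<kappa>' \<omega>"
  unfolding exit_time_def by (auto intro!: cInf_superset_mono bdd_belowI[of _ a] simp: ab)

lemma exit_time_eventually:
  assumes \<omega>: "\<omega> \<in> space M" "\<omega> \<notin> N"
  shows "\<exists>k. exit_time a b N (real k + 1) \<omega> = b"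
proof -
  have "bounded ((\<lambda>r. W r \<omega> - W a \<omega>) ` {a..b})"
    by (intro compact_imp_bounded compact_continuous_image path_cont[OF \<omega>]) auto
  then obtain C where C: "\<And>r. r \<in> {a..b} \<Longrightarrow> norm (W r \<omega> - W a \<omega>) \<le> C"
    unfolding bounded_iff by (meson imageI)
  obtain k :: nat where k: "C < real k + 1" by (metis add.commute less_add_one order.strict_trans reals_Archimedean2)
  have "{r \<in> {a..b}. real k + 1 \<le> norm (W r \<omega> - W a \<omega>)} = {}" using C k by fastforce
  then show ?thesis using \<omega> by (intro exI[of _ k]) (simp only: exit_time_def, simp)
qed

text \<open>A continuous path reaches the level \<open>\<kappa>\<close> on \<open>[a,t]\<close> if and only if
it exceeds every smaller level at some rational fraction of the interval. The right-hand side
involves countably many random variables that are known at time \<open>t\<close>.\<close>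

lemma reaches_level_iff:
  assumes \<omega>: "\<omega> \<in> space M" "\<omega> \<notin> N" and t: "a \<le> t" "t \<le> b"
  shows "(\<exists>r\<in>{a..t}. \<kappa> \<le> norm (W r \<omega> - W a \<omega>)) \<longleftrightarrow>
    (\<forall>m::nat. \<exists>n i::nat. i \<le> n \<and> \<kappa> - 1 / real (Suc m) < norm (W (a + (t - a) * (real i / real n)) \<omega> - W a \<omega>))"
proof
  assume "\<exists>r\<in>{a..t}. \<kappa> \<le> norm (W r \<omega> - W a \<omega>)"
  then obtain r where r: "r \<in> {a..t}" "\<kappa> \<le> norm (W r \<omega> - W a \<omega>)" by blast
  show "\<forall>m::nat. \<exists>n i::nat. i \<le> n \<and> \<kappa> - 1 / real (Suc m) < norm (W (a + (t - a) * (real i / real n)) \<omega> - W a \<omega>)"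
  proof
    fix m :: nat
    have e: "1 / real (Suc m) > 0" by simp
    have "continuous (at r within {a..b}) (\<lambda>r. W r \<omega> - W a \<omega>)"
      using path_cont[OF \<omega>] r t by (auto simp: continuous_on_eq_continuous_within)
    then obtain d where d: "d > 0" "\<And>r'. r' \<in> {a..b} \<Longrightarrow> dist r' r < d \<Longrightarrow>
        dist (W r' \<omega> - W a \<omega>) (W r \<omega> - W a \<omega>) < 1 / real (Suc m)"
      unfolding continuous_within_eps_delta using e by blast
    obtain n :: nat where n: "n > 0" "(t - a) / real n < d"
    proof -
      obtain n :: nat where "(t - a) / d < real n" using reals_Archimedean2 by blast
      then have "(t - a) / d < real (Suc n)" by simp
      then have "(t - a) / real (Suc n) < d" using d(1) by (simp add: field_simps)
      then show thesis by (intro that[of "Suc n"]) auto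
    qed
    define p where "p = (if t = a then 0 else (r - a) / (t - a))"
    have p: "0 \<le> p" "p \<le> 1" "r = a + (t - a) * p" using r by (auto simp: p_def field_simps)
    \<comment> \<open>the grid point to the left of the time at which the level is reached, on a grid so fine that the path changes by less than 1/(m+1)\<close>
    define i where "i = nat \<lfloor>real n * p\<rfloor>"
    have np: "0 \<le> real n * p" "real n * p \<le> real n" using p n by (auto simp: mult_left_le)
    have i: "real i \<le> real n * p" "real n * p < real i + 1" using np by (auto simp: i_def floor_le_iff)
    have in': "i \<le> n" using i np by linarith
    have "p \<le> (real i + 1) / real n" using i(2) n(1) by (simp add: pos_le_divide_eq mult.commute)
    moreover have "real i / real n \<le> p" using i(1) n(1) by (simp add: pos_divide_le_eq mult.commute)
    ultimately have frac: "real i / real n \<le> p" "p - real i / real n \<le> 1 / real n" "0 \<le> real i / real n"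
      by (auto simp: add_divide_distrib)
    let ?r = "a + (t - a) * (real i / real n)"
    have "r - ?r = (t - a) * (p - real i / real n)" using p by (simp add: algebra_simps)
    then have "0 \<le> r - ?r" "r - ?r \<le> (t - a) * (1 / real n)"
      using frac t mult_left_mono[OF frac(2), of "t - a"] by simp_all
    moreover have "a \<le> ?r" using frac t by simp
    ultimately have "?r \<in> {a..b}" "dist ?r r < d" using r t n by (auto simp: dist_real_def)
    then have "dist (W ?r \<omega> - W a \<omega>) (W r \<omega> - W a \<omega>) < 1 / real (Suc m)" by (rule d(2))
    then have "norm (W r \<omega> - W a \<omega>) - norm (W ?r \<omega> - W a \<omega>) < 1 / real (Suc m)"
      using norm_triangle_ineq2[of "W r \<omega> - W a \<omega>" "W ?r \<omega> - W a \<omega>"] by (simp add: dist_norm norm_minus_commute)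
    then have "\<kappa> - 1 / real (Suc m) < norm (W ?r \<omega> - W a \<omega>)" using r(2) by linarith
    then show "\<exists>n i::nat. i \<le> n \<and> \<kappa> - 1 / real (Suc m) < norm (W (a + (t - a) * (real i / real n)) \<omega> - W a \<omega>)"
      using in' by blast
  qed
next
  assume *: "\<forall>m::nat. \<exists>n i::nat. i \<le> n \<and> \<kappa> - 1 / real (Suc m) < norm (W (a + (t - a) * (real i / real n)) \<omega> - W a \<omega>)"
  have "\<exists>r\<in>{a..t}. \<forall>r'\<in>{a..t}. norm (W r' \<omega> - W a \<omega>) \<le> norm (W r \<omega> - W a \<omega>)"
    by (rule continuous_attains_sup)
      (use t in \<open>auto intro!: continuous_on_norm continuous_on_subset[OF path_cont[OF \<omega>]]\<close>)
  then obtain r where r: "r \<in> {a..t}" "\<And>r'. r' \<in> {a..t} \<Longrightarrow> norm (W r' \<omega> - W a \<omega>) \<le> norm (W r \<omega> - W a \<omega>)" by blast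
  have "\<kappa> - 1 / real (Suc m) \<le> norm (W r \<omega> - W a \<omega>)" for m
  proof -
    obtain n i :: nat where i: "i \<le> n" "\<kappa> - 1 / real (Suc m) < norm (W (a + (t - a) * (real i / real n)) \<omega> - W a \<omega>)"
      using * by blast
    have "0 \<le> real i / real n" "real i / real n \<le> 1" using i by (auto simp: divide_simps)
    then have "a + (t - a) * (real i / real n) \<in> {a..t}"
      using t mult_left_le[of "real i / real n" "t - a"] by auto
    then show ?thesis using r(2) i(2) by fastforce
  qed
  then have "\<kappa> \<le> norm (W r \<omega> - W a \<omega>)"
  proof -
    assume le: "\<And>m. \<kappa> - 1 / real (Suc m) \<le> norm (W r \<omega> - W a \<omega>)"
    have "(\<lambda>m. \<kappa> - 1 / real (Suc m)) \<longlonglongrightarrow> \<kappa> - 0"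
      using LIMSEQ_inverse_real_of_nat by (intro tendsto_diff tendsto_const) (simp add: inverse_eq_divide)
    then show ?thesis using LIMSEQ_le_const2[of _ \<kappa>] le by force
  qed
  then show "\<exists>r\<in>{a..t}. \<kappa> \<le> norm (W r \<omega> - W a \<omega>)" using r(1) by blast
qed

lemma exit_time_stopping: "stopping_time \<F> (exit_time a b N \<kappa>)"
proof (rule stopping_timeI)
  fix t
  consider "t < a" | "a \<le> t" "t < b" | "b \<le> t" by linarith
  then show "Measurable.pred (\<F> t) (\<lambda>\<omega>. exit_time a b N \<kappa> \<omega> \<le> t)"
  proof cases
    case 1
    then have "\<not> exit_time a b N \<kappa> \<omega> \<le> t" for \<omega> using exit_time_range[of \<kappa> \<omega>] by auto
    then show ?thesis by simp
  next
    case 3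
    then have "exit_time a b N \<kappa> \<omega> \<le> t" for \<omega> using exit_time_range[of \<kappa> \<omega>] by auto
    then show ?thesis by simp
  next
    case 2
    have t0: "0 \<le> t" using 2 ab by simp
    have Nm [measurable]: "N \<in> sets (\<F> t)" using null_sets_F[OF t0] N by auto
    define Q where "Q m n i \<omega> \<longleftrightarrow> i \<le> n \<and> \<kappa> - 1 / real (Suc m) < norm (W (a + (t - a) * (real i / real n)) \<omega> - W a \<omega>)"
      for m n i :: nat and \<omega>
    have Q: "Measurable.pred (\<F> t) (Q m n i)" for m n i
    proof (cases "i \<le> n")
      case True
      have "0 \<le> real i / real n" "real i / real n \<le> 1" using True by (auto simp: divide_simps)
      then have "a \<le> a + (t - a) * (real i / real n)" "a + (t - a) * (real i / real n) \<le> t"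
        using 2 mult_left_le[of "real i / real n" "t - a"] by auto
      then have [measurable]: "W (a + (t - a) * (real i / real n)) \<in> borel_measurable (\<F> t)"
        using ab by (intro F_measurable_mono[OF _ _ W_adapted]) auto
      have [measurable]: "W a \<in> borel_measurable (\<F> t)"
        using ab 2 by (intro F_measurable_mono[OF _ _ W_adapted]) auto
      show ?thesis unfolding Q_def by measurable
    next
      case False
      then have "Q m n i = (\<lambda>\<omega>. False)" by (simp add: Q_def fun_eq_iff)
      then show ?thesis by simp
    qed
    have m: "Measurable.pred (\<F> t) (\<lambda>\<omega>. \<omega> \<notin> N \<and> (\<forall>m. \<exists>n i. Q m n i \<omega>))"
      using Q Nm by (intro pred_intros_logic pred_intros_countable pred_sets2[OF Nm]) auto
    have iff: "exit_time a b N \<kappa> \<omega> \<le> t \<longleftrightarrow> \<omega> \<notin> N \<and> (\<forall>m. \<exists>n i. Q m n i \<omega>)"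
      if "\<omega> \<in> space (\<F> t)" for \<omega>
    proof (cases "\<omega> \<in> N")
      case True then show ?thesis using 2 by (simp add: exit_time_def)
    next
      case False
      then show ?thesis
        using exit_time_le_iff[of \<omega> t \<kappa>] reaches_level_iff[of \<omega> t \<kappa>] that space_F[OF t0] 2 by (simp add: Q_def)
    qed
    show ?thesis by (rule iffD2[OF measurable_cong[OF iff] m])
  qed
qed

end

lemma measurable_min_stopping:
  assumes ab: "0 \<le> a" and st: "stopping_time \<F> \<tau>" and rng: "\<And>\<omega>. a \<le> \<tau> \<omega>" and t: "a \<le> t"
  shows "(\<lambda>\<omega>. min t (\<tau> \<omega>)) \<in> borel_measurable (\<F> t)"
proof (rule borel_measurableI_le)
  fix r
  consider "r < a" | "a \<le> r" "r < t" | "t \<le> r" by linarith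
  then show "{\<omega> \<in> space (\<F> t). min t (\<tau> \<omega>) \<le> r} \<in> sets (\<F> t)"
  proof cases
    case 1
    have "\<not> min t (\<tau> \<omega>) \<le> r" for \<omega> using 1 rng[of \<omega>] t by (auto simp: min_def)
    then show ?thesis by simp
  next
    case 2
    have "Measurable.pred (\<F> t) (\<lambda>\<omega>. \<tau> \<omega> \<le> r)"
      using stopping_timeD[OF st, of r] 2 ab by (intro F_measurable_mono[of r t]) auto
    then have "{\<omega> \<in> space (\<F> t). \<tau> \<omega> \<le> r} \<in> sets (\<F> t)" by measurable
    moreover have "min t (\<tau> \<omega>) \<le> r \<longleftrightarrow> \<tau> \<omega> \<le> r" for \<omega> using 2 by (auto simp: min_def)
    ultimately show ?thesis by simp
  next
    case 3
    then have "{\<omega> \<in> space (\<F> t). min t (\<tau> \<omega>) \<le> r} = space (\<F> t)" by auto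
    then show ?thesis by simp
  qed
qed

text \<open>The time \<open>min t (\<tau> \<omega>)\<close> is approximated from below by the points of a finite
grid in \<open>[a,t]\<close>. For each grid point the process is known at time \<open>t\<close>, and
path continuity gives the limit.\<close>

lemma stopped_process_adapted:
  fixes Y :: "real \<Rightarrow> 'a \<Rightarrow> real"
  assumes a: "0 \<le> a" and Y: "\<And>r. r \<in> {a..b} \<Longrightarrow> Y r \<in> borel_measurable (\<F> r)"
    and cont: "AE \<omega> in M. continuous_on {a..b} (\<lambda>r. Y r \<omega>)"
    and st: "stopping_time \<F> \<tau>" and rng: "\<And>\<omega>. a \<le> \<tau> \<omega>" and t: "t \<in> {a..b}"
  shows "(\<lambda>\<omega>. Y (min t (\<tau> \<omega>)) \<omega>) \<in> borel_measurable (\<F> t)"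
proof (cases "t = a")
  case True
  then have "min t (\<tau> \<omega>) = a" for \<omega> using rng[of \<omega>] by (simp add: min_def)
  then show ?thesis using Y[OF t] True by simp
next
  case False
  then have ta: "a < t" and t0: "0 \<le> t" using t a by auto
  define l where "l = t - a"
  have l: "l > 0" using ta by (simp add: l_def)
  define I where "I n \<omega> = nat \<lfloor>real (Suc n) * ((min t (\<tau> \<omega>) - a) / l)\<rfloor>" for n \<omega>
  define \<rho> where "\<rho> n i = a + l * (real i / real (Suc n))" for n i :: nat
  have p: "0 \<le> (min t (\<tau> \<omega>) - a) / l" "(min t (\<tau> \<omega>) - a) / l \<le> 1" for \<omega>
    using rng[of \<omega>] ta l by (auto simp: min_def l_def)
  have Ib: "real (I n \<omega>) \<le> real (Suc n) * ((min t (\<tau> \<omega>) - a) / l)" "real (Suc n) * ((min t (\<tau> \<omega>) - a) / l) < real (I n \<omega>) + 1" for n \<omega>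
  proof -
    have "0 \<le> real (Suc n) * ((min t (\<tau> \<omega>) - a) / l)" by (rule mult_nonneg_nonneg) (use p in auto)
    then have "real (I n \<omega>) = of_int \<lfloor>real (Suc n) * ((min t (\<tau> \<omega>) - a) / l)\<rfloor>" unfolding I_def by (simp only: of_nat_nat zero_le_floor)
    then show "real (I n \<omega>) \<le> real (Suc n) * ((min t (\<tau> \<omega>) - a) / l)" "real (Suc n) * ((min t (\<tau> \<omega>) - a) / l) < real (I n \<omega>) + 1"
      by linarith+
  qed
  have \<rho>b: "\<rho> n (I n \<omega>) \<le> min t (\<tau> \<omega>)" "min t (\<tau> \<omega>) - \<rho> n (I n \<omega>) \<le> l / real (Suc n)" "a \<le> \<rho> n (I n \<omega>)" for n \<omega>
  proof -
    have 1: "real (I n \<omega>) / real (Suc n) \<le> (min t (\<tau> \<omega>) - a) / l" "(min t (\<tau> \<omega>) - a) / l \<le> real (I n \<omega>) / real (Suc n) + 1 / real (Suc n)"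
      using Ib[of n \<omega>] by (simp_all add: field_simps del: of_nat_Suc)
    have 2: "l * ((min t (\<tau> \<omega>) - a) / l) = min t (\<tau> \<omega>) - a" using l by simp
    show "\<rho> n (I n \<omega>) \<le> min t (\<tau> \<omega>)" using mult_left_mono[OF 1(1), of l] l unfolding 2 \<rho>_def by linarith
    show "min t (\<tau> \<omega>) - \<rho> n (I n \<omega>) \<le> l / real (Suc n)"
      using mult_left_mono[OF 1(2), of l] l unfolding 2 \<rho>_def by (simp add: distrib_left del: of_nat_Suc)
    show "a \<le> \<rho> n (I n \<omega>)" using l by (simp add: \<rho>_def)
  qed
  show ?thesis
  proof (rule measurable_AE_LIMSEQ_complete[where M=M])
    show "complete_measure M" by (rule complete_measure_axioms)
    show "space (\<F> t) = space M" "sets (\<F> t) \<subseteq> sets M" "null_sets M \<subseteq> sets (\<F> t)"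
      using space_F[OF t0] sets_F[OF t0] null_sets_F[OF t0] by auto
    show "(\<lambda>\<omega>. (if I n \<omega> \<le> Suc n then Y (\<rho> n (I n \<omega>)) \<omega> else 0)) \<in> borel_measurable (\<F> t)" for n
    proof (rule measurable_compose_countable[where f="\<lambda>i \<omega>. if i \<le> Suc n then Y (\<rho> n i) \<omega> else 0"])
      show "(\<lambda>\<omega>. if i \<le> Suc n then Y (\<rho> n i) \<omega> else 0) \<in> borel_measurable (\<F> t)" for i
      proof (cases "i \<le> Suc n")
        case True
        then have "0 \<le> real i / real (Suc n)" "real i / real (Suc n) \<le> 1" by (auto simp: divide_simps)
        then have "a \<le> \<rho> n i" "\<rho> n i \<le> t" using l mult_left_le[of "real i / real (Suc n)" l] by (auto simp: \<rho>_def l_def)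
        then have "Y (\<rho> n i) \<in> borel_measurable (\<F> t)" using t a by (intro F_measurable_mono[OF _ _ Y]) auto
        then show ?thesis using True by simp
      qed simp
      define mt where "mt \<omega> = min t (\<tau> \<omega>)" for \<omega>
      have [measurable]: "mt \<in> borel_measurable (\<F> t)"
        unfolding mt_def using ta by (intro measurable_min_stopping[OF a st rng]) auto
      have "(\<lambda>\<omega>. nat \<lfloor>real (Suc n) * ((mt \<omega> - a) / l)\<rfloor>) \<in> \<F> t \<rightarrow>\<^sub>M count_space UNIV"
        by measurable
      then show "I n \<in> \<F> t \<rightarrow>\<^sub>M count_space UNIV"
        unfolding I_def[abs_def] mt_def .
    qed
    show "AE \<omega> in M. (\<lambda>n. if I n \<omega> \<le> Suc n then Y (\<rho> n (I n \<omega>)) \<omega> else 0) \<longlonglongrightarrow> Y (min t (\<tau> \<omega>)) \<omega>"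
      using cont
    proof eventually_elim
      case (elim \<omega>)
      have le: "I n \<omega> \<le> Suc n" for n
      proof -
        have "real (Suc n) * ((min t (\<tau> \<omega>) - a) / l) \<le> real (Suc n)"
          using p[of \<omega>] by (intro mult_left_le) auto
        then show ?thesis using Ib(1)[of n \<omega>] by linarith
      qed
      have "(\<lambda>n. \<rho> n (I n \<omega>) - min t (\<tau> \<omega>)) \<longlonglongrightarrow> 0"
      proof (rule Lim_null_comparison)
        show "\<forall>\<^sub>F n in sequentially. norm (\<rho> n (I n \<omega>) - min t (\<tau> \<omega>)) \<le> l * inverse (real (Suc n))"
        proof (intro always_eventually allI)
          fix n :: nat show "norm (\<rho> n (I n \<omega>) - min t (\<tau> \<omega>)) \<le> l * inverse (real (Suc n))"
            using \<rho>b(1)[of n \<omega>] \<rho>b(2)[of \<omega> n] unfolding divide_inverse real_norm_def by linarith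
        qed
        show "(\<lambda>n. l * inverse (real (Suc n))) \<longlonglongrightarrow> 0"
          using tendsto_mult_right_zero[OF LIMSEQ_inverse_real_of_nat] .
      qed
      then have lim: "(\<lambda>n. \<rho> n (I n \<omega>)) \<longlonglongrightarrow> min t (\<tau> \<omega>)" by (simp add: LIM_zero_iff)
      have "(\<lambda>n. Y (\<rho> n (I n \<omega>)) \<omega>) \<longlonglongrightarrow> Y (min t (\<tau> \<omega>)) \<omega>"
      proof (rule continuous_on_tendsto_compose[OF elim lim])
        show "min t (\<tau> \<omega>) \<in> {a..b}" using t rng[of \<omega>] by (auto simp: min_def)
        show "\<forall>\<^sub>F n in sequentially. \<rho> n (I n \<omega>) \<in> {a..b}"
        proof (intro always_eventually allI)
          fix n :: nat show "\<rho> n (I n \<omega>) \<in> {a..b}" using \<rho>b(1,3)[of n \<omega>] t by auto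
        qed
      qed
      then show ?case using le by simp
    qed
  qed
qed

end

section \<open>The vector advection equation along a loop\<close>

lemma has_derivative_vec:
  fixes x :: "'x::real_normed_vector" and k :: "'n::finite \<Rightarrow> 'x \<Rightarrow> real"
  assumes "\<And>i. (k i has_derivative k' i) (at x)"
  shows "((\<lambda>y. \<chi> i. k i y) has_derivative (\<lambda>h. \<chi> i. k' i h)) (at x)"
  unfolding has_derivative_componentwise_within[of "\<lambda>y. \<chi> i. k i y"]
  using assms by (auto simp: Basis_vec_def inner_axis)

lemma AE_lebesgue_on_negligible:
  assumes "AE r in lebesgue_on {c<..<d}. Q (r :: real)"
  obtains N where "negligible N" "\<And>r. r \<in> {c<..<d} \<Longrightarrow> r \<notin> N \<Longrightarrow> Q r"
proof -
  have "AE r in lebesgue. r \<in> {c<..<d} \<longrightarrow> Q r"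
    using assms by (subst (asm) AE_restrict_space_iff) auto
  then obtain N where "negligible N" "{r. \<not> (r \<in> {c<..<d} \<longrightarrow> Q r)} \<subseteq> N"
    unfolding eventually_ae_filter_negligible by blast
  then show thesis by (intro that[of N]) auto
qed

locale advected_field =
  fixes T \<nu> \<alpha> s :: real and v F :: "real \<Rightarrow> real^'n::finite \<Rightarrow> real^'n" and F0 :: "real^'n \<Rightarrow> real^'n"
  assumes T: "T > 0" and \<nu>: "\<nu> > 0" and v: "L1_Cb1 T \<alpha> v" and F: "C12 T F"
    and eq: "vector_advection_solution T \<nu> v F0 F" and s: "s \<in> {0..T}"
begin

abbreviation "a \<equiv> T - s"

text \<open>The components of the reversed field $G(r) = F(T-r)$ with their derivatives.\<close>

definition "Fc l r x = F (T - r) x $ l"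
definition "Fc_t l r x = - (time_deriv T F (T - r) x $ l)"
definition "DFc l r x = (\<chi> i. partial i (F (T - r)) x $ l)"
definition "D2Fc l r x = (\<chi> i. \<chi> j. partial j (partial i (F (T - r))) x $ l)"

lemma F_C2:
  assumes "t \<in> {0..T}"
  shows "F t differentiable (at x)" "partial i (F t) differentiable (at x)"
    "continuous_on UNIV (partial j (partial i (F t)))"
proof -
  have "Ck (Suc (Suc 0)) (F t)" using F assms by (simp add: C12_def numeral_2_eq_2)
  then show "F t differentiable (at x)" "partial i (F t) differentiable (at x)"
    "continuous_on UNIV (partial j (partial i (F t)))" by auto
qed

lemma reversed_cont:
  fixes k :: "real \<Rightarrow> real^'n \<Rightarrow> 'c::topological_space"
  assumes "continuous_on ({0..T} \<times> UNIV) (\<lambda>(t, x). k t x)"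
  shows "continuous_on ({a..T} \<times> UNIV) (\<lambda>(r, x). k (T - r) x)"
proof -
  have "continuous_on ({a..T} \<times> (UNIV :: (real^'n) set)) (\<lambda>p. (T - fst p, snd p))"
    by (intro continuous_intros)
  moreover have "(\<lambda>p. (T - fst p, snd p)) ` ({a..T} \<times> (UNIV :: (real^'n) set)) \<subseteq> {0..T} \<times> UNIV"
    using s by auto
  ultimately have "continuous_on ({a..T} \<times> UNIV) (\<lambda>p. (\<lambda>(t, x). k t x) (T - fst p, snd p))"
    by (rule continuous_on_compose2[OF assms])
  then show ?thesis by (simp add: split_beta)
qed

lemma time_slice_cont:
  fixes k :: "real \<Rightarrow> real^'n \<Rightarrow> 'c::topological_space"
  assumes "continuous_on ({0..T} \<times> UNIV) (\<lambda>(t, x). k t x)" "t \<in> {0..T}"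
  shows "continuous_on UNIV (k t)"
proof -
  have "continuous_on (UNIV :: (real^'n) set) (\<lambda>x. (t, x))" by (intro continuous_intros)
  moreover have "(\<lambda>x. (t, x)) ` (UNIV :: (real^'n) set) \<subseteq> {0..T} \<times> UNIV" using assms(2) by auto
  ultimately have "continuous_on UNIV (\<lambda>x. (\<lambda>(t, x). k t x) (t, x))"
    by (rule continuous_on_compose2[OF assms(1)])
  then show ?thesis by simp
qed

lemma F_cont:
  "continuous_on ({0..T} \<times> UNIV) (\<lambda>(t, x). F t x)"
  "continuous_on ({0..T} \<times> UNIV) (\<lambda>(t, x). time_deriv T F t x)"
  "continuous_on ({0..T} \<times> UNIV) (\<lambda>(t, x). partial i (F t) x)"
  "continuous_on ({0..T} \<times> UNIV) (\<lambda>(t, x). partial i (partial j (F t)) x)"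
  using F by (simp_all add: C12_def)

lemma jet: "space_time_C12 a T (Fc l) (Fc_t l) (DFc l) (D2Fc l)"
proof
  fix t x assume t: "t \<in> {a..T}"
  then have t': "T - t \<in> {0..T}" using s by auto
  have "((\<lambda>r. F r x) has_vector_derivative time_deriv T F (T - t) x) (at (T - t) within {0..T})"
    using F t' unfolding C12_def time_deriv_def vector_derivative_works[symmetric] by auto
  then have "((\<lambda>r. F r x) has_vector_derivative time_deriv T F (T - t) x) (at (T - t) within (\<lambda>r. T - r) ` {a..T})"
    by (rule has_vector_derivative_within_subset) (use s in auto)
  moreover have "((\<lambda>r. T - r) has_vector_derivative (- 1)) (at t within {a..T})"
    by (auto intro!: derivative_eq_intros)
  ultimately have "(((\<lambda>r. F r x) \<circ> (\<lambda>r. T - r)) has_vector_derivative (- 1) *\<^sub>R time_deriv T F (T - t) x) (at t within {a..T})"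
    by (intro vector_diff_chain_within)
  from bounded_linear.has_vector_derivative[OF bounded_linear_vec_nth this, of l]
  show "((\<lambda>r. Fc l r x) has_real_derivative Fc_t l t x) (at t within {a..T})"
    by (simp add: has_real_derivative_iff_has_vector_derivative Fc_def Fc_t_def o_def)
  have "((\<lambda>x. F (T - t) x $ l) has_derivative (\<lambda>h. (\<Sum>j\<in>UNIV. h $ j *\<^sub>R partial j (F (T - t)) x) $ l)) (at x)"
    by (rule bounded_linear.has_derivative[OF bounded_linear_vec_nth has_derivative_partial[OF F_C2(1)[OF t']]])
  then show "(Fc l t has_derivative (\<lambda>h. DFc l t x \<bullet> h)) (at x)"
    by (simp add: Fc_def[abs_def] DFc_def inner_vec_def mult.commute)
  have "((\<lambda>x. partial i (F (T - t)) x $ l) has_derivative (\<lambda>h. (\<Sum>j\<in>UNIV. h $ j *\<^sub>R partial j (partial i (F (T - t))) x) $ l)) (at x)" for i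
    by (rule bounded_linear.has_derivative[OF bounded_linear_vec_nth has_derivative_partial[OF F_C2(2)[OF t']]])
  from has_derivative_vec[OF this]
  show "(DFc l t has_derivative (\<lambda>h. D2Fc l t x *v h)) (at x)"
    by (simp add: DFc_def[abs_def] D2Fc_def matrix_vector_mult_def mult.commute)
next
  show "continuous_on ({a..T} \<times> UNIV) (\<lambda>(t, x). Fc l t x)"
    using reversed_cont[OF F_cont(1)] unfolding Fc_def split_beta by (intro continuous_intros)
  show "continuous_on ({a..T} \<times> UNIV) (\<lambda>(t, x). Fc_t l t x)"
    using reversed_cont[OF F_cont(2)] unfolding Fc_t_def split_beta by (intro continuous_intros)
  show "continuous_on ({a..T} \<times> UNIV) (\<lambda>(t, x). DFc l t x)"
    using reversed_cont[OF F_cont(3)] unfolding DFc_def split_beta by (intro continuous_intros)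
  show "continuous_on ({a..T} \<times> UNIV) (\<lambda>(t, x). D2Fc l t x)"
    using reversed_cont[OF F_cont(4)] unfolding D2Fc_def split_beta by (intro continuous_intros)
qed

lemma trace_D2Fc: "trace (D2Fc l r x) = laplacian (F (T - r)) x $ l"
  by (simp add: trace_def D2Fc_def laplacian_def)

text \<open>This is $\partial_r G + \nu\triangle G + (V\nabla)G - \nabla G\,V$ for $G(r) = F(T-r)$; reversing
time changes the sign of the time derivative.\<close>

definition defect :: "real \<Rightarrow> (real^'n \<Rightarrow> real^'n) \<Rightarrow> real^'n \<Rightarrow> real^'n" where
  "defect r V x = \<nu> *\<^sub>R laplacian (F (T - r)) x + (advect V (F (T - r)) x - nabla_apply (F (T - r)) V x) - time_deriv T F (T - r) x"

lemma field_parts_cont: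
  assumes t: "t \<in> {0..T}" and V: "continuous_on UNIV V"
  shows "continuous_on UNIV (laplacian (F t))" "continuous_on UNIV (\<lambda>x. advect V (F t) x - nabla_apply (F t) V x)"
    "continuous_on UNIV (time_deriv T F t)"
proof -
  show "continuous_on UNIV (laplacian (F t))"
    unfolding laplacian_def[abs_def] by (intro continuous_on_sum time_slice_cont[OF F_cont(4) t])
  have p: "continuous_on UNIV (partial j (F t))" for j by (rule time_slice_cont[OF F_cont(3) t])
  show "continuous_on UNIV (\<lambda>x. advect V (F t) x - nabla_apply (F t) V x)"
    unfolding advect_def nabla_apply_def by (intro continuous_intros p V)
  show "continuous_on UNIV (time_deriv T F t)" by (rule time_slice_cont[OF F_cont(2) t])
qed

text \<open>The drift is given only for almost every time, and so is the equation. The set \<open>E\<close>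
collects the times at which everything holds; it depends neither on the loop nor on the path, which
allows the loop to be random later on. The equation at time \<open>t\<close> concerns the velocity
at time \<open>T - t\<close>, hence the reflection of the exceptional set.\<close>

lemma good_times:
  obtains E g where "E \<subseteq> {0<..<T}" "negligible ({0..T} - E)" "g integrable_on {0..T}" "\<And>r. 0 \<le> g r"
    "\<And>r. r \<in> E \<Longrightarrow> continuous_on UNIV (v r)" "\<And>r x. r \<in> E \<Longrightarrow> norm (v r x) \<le> g r"
    "\<And>r x y. r \<in> E \<Longrightarrow> norm (v r x - v r y) \<le> g r * norm (x - y)"
    "\<And>r \<gamma>. r \<in> E \<Longrightarrow> C1_loop \<gamma> \<Longrightarrow> line_integral \<gamma> (defect r (v r)) = 0"
proof -
  obtain g where g: "integrable (lebesgue_on {0<..<T}) g" "\<And>t. 0 \<le> g t"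
    "AE t in lebesgue_on {0<..<T}. continuous_on UNIV (v t) \<and> (\<forall>x. norm (v t x) \<le> g t) \<and>
        (\<forall>x y. norm (v t x - v t y) \<le> g t * norm (x - y))"
    by (rule L1_Cb1_bound[OF v]) blast
  obtain N1 where N1: "negligible N1" "\<And>t. t \<in> {0<..<T} \<Longrightarrow> t \<notin> N1 \<Longrightarrow> continuous_on UNIV (v t) \<and> (\<forall>x. norm (v t x) \<le> g t) \<and>
        (\<forall>x y. norm (v t x - v t y) \<le> g t * norm (x - y))"
    by (rule AE_lebesgue_on_negligible[OF g(3)]) blast
  have "AE t in lebesgue_on {0<..<T}. \<exists>w p. stokes (F t) w \<and>
        helmholtz (\<lambda>x. advect (v (T - t)) (F t) x - nabla_apply (F t) (v (T - t)) x) p \<and>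
        (AE x in lborel. time_deriv T F t x = - \<nu> *\<^sub>R w x + p x)"
    using eq by (simp add: vector_advection_solution_def)
  then obtain N2 where N2: "negligible N2" "\<And>t. t \<in> {0<..<T} \<Longrightarrow> t \<notin> N2 \<Longrightarrow> \<exists>w p. stokes (F t) w \<and>
        helmholtz (\<lambda>x. advect (v (T - t)) (F t) x - nabla_apply (F t) (v (T - t)) x) p \<and>
        (AE x in lborel. time_deriv T F t x = - \<nu> *\<^sub>R w x + p x)"
    by (rule AE_lebesgue_on_negligible) blast
  let ?N3 = "(\<lambda>t. T - t) ` N2"
  have N3: "negligible ?N3"
    by (rule negligible_differentiable_image_negligible[OF _ N2(1)]) (auto intro!: derivative_intros simp: differentiable_on_def)
  define E where "E = {0<..<T} - (N1 \<union> ?N3)"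
  show thesis
  proof (rule that[of E g])
    show "E \<subseteq> {0<..<T}" by (auto simp: E_def)
    have "negligible ({0, T} \<union> (N1 \<union> ?N3))" by (intro negligible_Un[OF negligible_finite negligible_Un[OF N1(1) N3]]) auto
    then show "negligible ({0..T} - E)" by (rule negligible_subset) (auto simp: E_def)
    have "g integrable_on {0<..<T}" by (rule integrable_on_lebesgue_on[OF g(1)]) auto
    then show "g integrable_on {0..T}" by (simp add: integrable_on_Icc_iff_Ioo)
    show "0 \<le> g r" for r by (rule g(2))
    fix r assume r: "r \<in> E"
    then have r1: "r \<in> {0<..<T}" "r \<notin> N1" and r2: "T - r \<notin> N2" "T - r \<in> {0<..<T}" by (auto simp: E_def image_iff)
    from N1(2)[OF r1]
    show c: "continuous_on UNIV (v r)" and "norm (v r x) \<le> g r" and "norm (v r x - v r y) \<le> g r * norm (x - y)" for x y by auto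
    fix \<gamma> :: "real \<Rightarrow> real^'n" assume loop: "C1_loop \<gamma>"
    obtain w p where wp: "stokes (F (T - r)) w"
        "helmholtz (\<lambda>x. advect (v r) (F (T - r)) x - nabla_apply (F (T - r)) (v r) x) p"
        "AE x in lborel. time_deriv T F (T - r) x = - \<nu> *\<^sub>R w x + p x"
      using N2(2)[OF r2(2,1)] by auto
    have t: "T - r \<in> {0..T}" using r2 by auto
    show "line_integral \<gamma> (defect r (v r)) = 0"
      using circulation_of_helmholtz_defect[OF loop wp field_parts_cont[OF t c]] unfolding defect_def[abs_def] .
  qed
qed

text \<open>The drift that the stopped Ito formula assigns to the product of component \<open>l\<close> at the
point \<open>y j\<close> with the \<open>l\<close>-th component of \<open>y (Suc j) - y j\<close>,
when all points move with the velocity field \<open>V\<close>.\<close>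

definition riemann_drift :: "real \<Rightarrow> (real^'n \<Rightarrow> real^'n) \<Rightarrow> (nat \<Rightarrow> real^'n) \<Rightarrow> nat \<Rightarrow> 'n \<Rightarrow> real" where
  "riemann_drift r V y j l = (y (Suc j) - y j) $ l * (Fc_t l r (y j) + \<nu> * trace (D2Fc l r (y j)))
     + ((y (Suc j) - y j) $ l *\<^sub>R DFc l r (y j)) \<bullet> V (y j) + Fc l r (y j) * (V (y (Suc j)) - V (y j)) $ l"

text \<open>Cyclic summation by parts replaces $\sum G(y_j)\cdot(V(y_{j+1}) - V(y_j))$ by $-\sum (G(y_{j+1}) -
G(y_j))\cdot V(y_{j+1})$. To first order this is the contribution of $-\nabla G\,V$, and the second
sum on the right-hand side is the error.\<close>

lemma riemann_drift_rearranged: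
  assumes closed: "y m = y 0"
  shows "(\<Sum>j<m. \<Sum>l\<in>UNIV. riemann_drift r V y j l) =
     (\<Sum>j<m. defect r V (y j) \<bullet> (y (Suc j) - y j))
     + (\<Sum>l\<in>UNIV. \<Sum>j<m. V (y j) $ l * (DFc l r (y j) \<bullet> (y (Suc j) - y j))
          - V (y (Suc j)) $ l * (Fc l r (y (Suc j)) - Fc l r (y j)))"
proof -
  have by_parts: "(\<Sum>j<m. Fc l r (y j) * (V (y (Suc j)) - V (y j)) $ l)
      = - (\<Sum>j<m. V (y (Suc j)) $ l * (Fc l r (y (Suc j)) - Fc l r (y j)))" for l
  proof -
    have "(\<Sum>j<m. Fc l r (y j) * (V (y (Suc j)) - V (y j)) $ l) + (\<Sum>j<m. V (y (Suc j)) $ l * (Fc l r (y (Suc j)) - Fc l r (y j)))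
       = (\<Sum>j<m. Fc l r (y (Suc j)) * V (y (Suc j)) $ l - Fc l r (y j) * V (y j) $ l)"
      unfolding sum.distrib[symmetric] by (intro sum.cong refl) (simp add: algebra_simps)
    also have "\<dots> = 0" by (subst sum_lessThan_telescope) (simp add: closed)
    finally show ?thesis by simp
  qed
  have nab: "nabla_apply (F (T - r)) V x \<bullet> d = (\<Sum>l\<in>UNIV. V x $ l * (DFc l r x \<bullet> d))" for x d
    unfolding nabla_apply_def DFc_def inner_vec_def
    by (simp add: sum_distrib_left sum_distrib_right mult.assoc) (rule sum.swap)
  have adv: "advect V (F (T - r)) x \<bullet> d = (\<Sum>l\<in>UNIV. (d $ l *\<^sub>R DFc l r x) \<bullet> V x)" for x d
    unfolding advect_def DFc_def inner_vec_def
    by (simp add: sum_distrib_left sum_distrib_right mult_ac)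
  have H: "(\<nu> *\<^sub>R laplacian (F (T - r)) x - time_deriv T F (T - r) x) \<bullet> d
      = (\<Sum>l\<in>UNIV. d $ l * (Fc_t l r x + \<nu> * trace (D2Fc l r x)))" for x d
    unfolding trace_D2Fc Fc_t_def inner_vec_def by (simp add: algebra_simps)
  have dfct: "defect r V x \<bullet> d = (\<Sum>l\<in>UNIV. d $ l * (Fc_t l r x + \<nu> * trace (D2Fc l r x)))
       + (\<Sum>l\<in>UNIV. (d $ l *\<^sub>R DFc l r x) \<bullet> V x) - (\<Sum>l\<in>UNIV. V x $ l * (DFc l r x \<bullet> d))" for x d
    unfolding defect_def H[symmetric] adv[symmetric] nab[symmetric] by (simp add: algebra_simps)
  have e1: "(\<Sum>j<m. \<Sum>l\<in>UNIV. riemann_drift r V y j l) =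
      (\<Sum>j<m. defect r V (y j) \<bullet> (y (Suc j) - y j) + (\<Sum>l\<in>UNIV. V (y j) $ l * (DFc l r (y j) \<bullet> (y (Suc j) - y j))))
      + (\<Sum>j<m. \<Sum>l\<in>UNIV. Fc l r (y j) * (V (y (Suc j)) - V (y j)) $ l)"
    unfolding dfct riemann_drift_def sum.distrib[symmetric] by (intro sum.cong refl) (simp add: sum.distrib)
  have e2: "(\<Sum>j<m. \<Sum>l\<in>UNIV. Fc l r (y j) * (V (y (Suc j)) - V (y j)) $ l)
      = (\<Sum>l\<in>UNIV. - (\<Sum>j<m. V (y (Suc j)) $ l * (Fc l r (y (Suc j)) - Fc l r (y j))))"
    unfolding by_parts[symmetric] by (rule sum.swap)
  have e3: "(\<Sum>j<m. defect r V (y j) \<bullet> (y (Suc j) - y j) + (\<Sum>l\<in>UNIV. V (y j) $ l * (DFc l r (y j) \<bullet> (y (Suc j) - y j))))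
      = (\<Sum>j<m. defect r V (y j) \<bullet> (y (Suc j) - y j)) + (\<Sum>l\<in>UNIV. \<Sum>j<m. V (y j) $ l * (DFc l r (y j) \<bullet> (y (Suc j) - y j)))"
    unfolding sum.distrib by (subst sum.swap) simp
  show ?thesis unfolding e1 e2 e3 sum_subtractf sum_negf by simp
qed

lemma riemann_drift_limit:
  assumes r: "r \<in> {a..T}" and V: "continuous_on UNIV V" and c: "C1_curve \<gamma> D" and closed: "\<gamma> 1 = \<gamma> 0"
  shows "(\<lambda>m. \<Sum>j<m. \<Sum>l\<in>UNIV. riemann_drift r V (\<lambda>j. \<gamma> (real j / real m)) j l) \<longlonglongrightarrow> line_integral \<gamma> (defect r V)"
proof -
  interpret C1_curve \<gamma> D by fact
  have t: "T - r \<in> {0..T}" using r s by auto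
  have cd: "continuous_on UNIV (defect r V)"
    unfolding defect_def[abs_def] by (intro continuous_on_add continuous_on_diff continuous_on_scaleR continuous_on_const
      field_parts_cont[OF t V])
  have main: "(\<lambda>m. \<Sum>j<m. defect r V (\<gamma> (real j / real m)) \<bullet> (\<gamma> (real (Suc j) / real m) - \<gamma> (real j / real m)))
      \<longlonglongrightarrow> line_integral \<gamma> (defect r V)" by (rule riemann_stieltjes[OF cd])
  obtain L where L: "L > 0" "\<And>u u'. u \<in> {0..1} \<Longrightarrow> u' \<in> {0..1} \<Longrightarrow> norm (\<gamma> u' - \<gamma> u) \<le> L * \<bar>u' - u\<bar>"
    using lipschitz by metis
  have "bounded (\<gamma> ` {0..1})" by (intro compact_imp_bounded compact_continuous_image cont) auto
  then obtain R where R: "\<And>u. u \<in> {0..1} \<Longrightarrow> norm (\<gamma> u) \<le> R" unfolding bounded_iff by (meson imageI)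
  have cV: "continuous_on {0..1} (\<lambda>u. V (\<gamma> u))" using continuous_on_compose2[OF V cont] by auto
  have "bounded ((\<lambda>u. V (\<gamma> u)) ` {0..1})" by (intro compact_imp_bounded compact_continuous_image cV) auto
  then obtain B where B: "\<And>u. u \<in> {0..1} \<Longrightarrow> norm (V (\<gamma> u)) \<le> B" unfolding bounded_iff by (meson imageI)
  have B0: "B \<ge> 0" using order_trans[OF norm_ge_zero B[of 0]] by simp
  have err: "(\<lambda>m. \<Sum>j<m. V (\<gamma> (real j / real m)) $ l * (DFc l r (\<gamma> (real j / real m)) \<bullet> (\<gamma> (real (Suc j) / real m) - \<gamma> (real j / real m)))
          - V (\<gamma> (real (Suc j) / real m)) $ l * (Fc l r (\<gamma> (real (Suc j) / real m)) - Fc l r (\<gamma> (real j / real m)))) \<longlonglongrightarrow> 0" for l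
  proof (rule tendstoI)
    fix e :: real assume e: "e > 0"
    interpret J: space_time_C12 a T "Fc l" "Fc_t l" "DFc l" "D2Fc l" by (rule jet)
    obtain C where C: "C > 0" "\<And>t x. t \<in> {a..T} \<Longrightarrow> norm x \<le> R \<Longrightarrow> norm (DFc l t x) \<le> C"
      using J.bounded_on_cball[OF J.cont_x] by metis
    define \<epsilon> where "\<epsilon> = e / (2 * (C + B) * L)"
    have CB: "C + B > 0" using C(1) B0 by simp
    have \<epsilon>: "\<epsilon> > 0" unfolding \<epsilon>_def using e CB L(1) by (intro divide_pos_pos mult_pos_pos) auto
    have "K * (d / (2 * K * l)) * l = d / 2" if "K > 0" "l > 0" for K d l :: real using that by (simp add: field_simps)
    note half = this[OF CB L(1), of e]
    have \<epsilon>e: "(C + B) * \<epsilon> * L < e" unfolding \<epsilon>_def half using e by simp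
    obtain d where d: "d > 0"
      "\<And>t t' x x' x''. \<lbrakk>t \<in> {a..T}; t' \<in> {a..T}; norm x \<le> R; norm x' \<le> R; norm x'' \<le> R;
        \<bar>t' - t\<bar> < d; norm (x' - x) < d; norm (x'' - x) < d\<rbrakk>
      \<Longrightarrow> \<bar>Fc l t' x' - Fc l t x'' - Fc_t l t x * (t' - t) - DFc l t x \<bullet> (x' - x'')\<bar> \<le> \<epsilon> * (\<bar>t' - t\<bar> + norm (x' - x''))"
      using J.first_order_expansion[OF \<epsilon>, where R=R] by blast
    have "uniformly_continuous_on {0..1} (\<lambda>u. V (\<gamma> u))" by (rule compact_uniformly_continuous[OF cV]) auto
    then obtain d' where d': "d' > 0" "\<And>u u'. u \<in> {0..1} \<Longrightarrow> u' \<in> {0..1} \<Longrightarrow> dist u' u < d' \<Longrightarrow> dist (V (\<gamma> u')) (V (\<gamma> u)) < \<epsilon>"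
      using \<epsilon> by (metis uniformly_continuous_onE)
    have "(\<lambda>m. 1 / real m) \<longlonglongrightarrow> 0" by (rule lim_1_over_n)
    then have "\<forall>\<^sub>F m in sequentially. 1 / real m < min d' (d / L)"
      using d(1) d'(1) L(1) by (intro order_tendstoD(2)) auto
    then show "\<forall>\<^sub>F m in sequentially. dist (\<Sum>j<m. V (\<gamma> (real j / real m)) $ l * (DFc l r (\<gamma> (real j / real m)) \<bullet> (\<gamma> (real (Suc j) / real m) - \<gamma> (real j / real m)))
          - V (\<gamma> (real (Suc j) / real m)) $ l * (Fc l r (\<gamma> (real (Suc j) / real m)) - Fc l r (\<gamma> (real j / real m)))) 0 < e"
      using eventually_gt_at_top[of "0::nat"]
    proof eventually_elim
      case (elim m)
      have bound: "\<bar>V (\<gamma> (real j / real m)) $ l * (DFc l r (\<gamma> (real j / real m)) \<bullet> (\<gamma> (real (Suc j) / real m) - \<gamma> (real j / real m)))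
          - V (\<gamma> (real (Suc j) / real m)) $ l * (Fc l r (\<gamma> (real (Suc j) / real m)) - Fc l r (\<gamma> (real j / real m)))\<bar>
          \<le> (C + B) * \<epsilon> * (L / real m)" if j: "j < m" for j
      proof -
        let ?u = "real j / real m" and ?u' = "real (Suc j) / real m"
        have u: "?u \<in> {0..1}" "?u' \<in> {0..1}" using j grid_in_unit[of j m] grid_in_unit[of "Suc j" m] by auto
        have du: "\<bar>?u' - ?u\<bar> = 1 / real m" by (simp add: add_divide_distrib)
        have dL: "norm (\<gamma> ?u' - \<gamma> ?u) \<le> L / real m" using L(2)[OF u] unfolding du by simp
        have Lm: "L / real m < d" using elim L(1) by (simp add: field_simps)
        have 1: "\<bar>Fc l r (\<gamma> ?u') - Fc l r (\<gamma> ?u) - DFc l r (\<gamma> ?u) \<bullet> (\<gamma> ?u' - \<gamma> ?u)\<bar> \<le> \<epsilon> * (L / real m)"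
        proof -
          have "\<bar>Fc l r (\<gamma> ?u') - Fc l r (\<gamma> ?u) - Fc_t l r (\<gamma> ?u) * (r - r) - DFc l r (\<gamma> ?u) \<bullet> (\<gamma> ?u' - \<gamma> ?u)\<bar>
              \<le> \<epsilon> * (\<bar>r - r\<bar> + norm (\<gamma> ?u' - \<gamma> ?u))"
            by (rule d(2)) (use r R[OF u(1)] R[OF u(2)] d(1) dL Lm in auto)
          also have "\<dots> \<le> \<epsilon> * (L / real m)" using dL \<epsilon> by (intro mult_left_mono) auto
          finally show ?thesis by simp
        qed
        have "dist (V (\<gamma> ?u')) (V (\<gamma> ?u)) < \<epsilon>" by (rule d'(2)[OF u]) (use du elim in \<open>auto simp: dist_real_def\<close>)
        then have 2: "\<bar>V (\<gamma> ?u) $ l - V (\<gamma> ?u') $ l\<bar> \<le> \<epsilon>"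
          using component_le_norm_cart[of "V (\<gamma> ?u) - V (\<gamma> ?u')" l] by (simp add: dist_norm norm_minus_commute)
        have 3: "\<bar>DFc l r (\<gamma> ?u) \<bullet> (\<gamma> ?u' - \<gamma> ?u)\<bar> \<le> C * (L / real m)"
          using C(2)[OF r R[OF u(1)]] dL C(1) by (intro order_trans[OF Cauchy_Schwarz_ineq2] mult_mono) auto
        have 4: "\<bar>V (\<gamma> ?u') $ l\<bar> \<le> B" using component_le_norm_cart[of "V (\<gamma> ?u')" l] B[OF u(2)] by linarith
        have eq: "V (\<gamma> ?u) $ l * (DFc l r (\<gamma> ?u) \<bullet> (\<gamma> ?u' - \<gamma> ?u)) - V (\<gamma> ?u') $ l * (Fc l r (\<gamma> ?u') - Fc l r (\<gamma> ?u))
          = (V (\<gamma> ?u) $ l - V (\<gamma> ?u') $ l) * (DFc l r (\<gamma> ?u) \<bullet> (\<gamma> ?u' - \<gamma> ?u))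
            - V (\<gamma> ?u') $ l * (Fc l r (\<gamma> ?u') - Fc l r (\<gamma> ?u) - DFc l r (\<gamma> ?u) \<bullet> (\<gamma> ?u' - \<gamma> ?u))"
        proof -
          have "p * P - p' * Q = (p - p') * P - p' * (Q - P)" for p p' P Q :: real by (simp add: algebra_simps)
          then show ?thesis .
        qed
        have "\<bar>(V (\<gamma> ?u) $ l - V (\<gamma> ?u') $ l) * (DFc l r (\<gamma> ?u) \<bullet> (\<gamma> ?u' - \<gamma> ?u))\<bar> \<le> \<epsilon> * (C * (L / real m))"
          unfolding abs_mult using 2 3 \<epsilon> by (intro mult_mono) auto
        moreover have "\<bar>V (\<gamma> ?u') $ l * (Fc l r (\<gamma> ?u') - Fc l r (\<gamma> ?u) - DFc l r (\<gamma> ?u) \<bullet> (\<gamma> ?u' - \<gamma> ?u))\<bar> \<le> B * (\<epsilon> * (L / real m))"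
          unfolding abs_mult using 1 4 B0 by (intro mult_mono) auto
        moreover have "(C + B) * \<epsilon> * (L / real m) = \<epsilon> * (C * (L / real m)) + B * (\<epsilon> * (L / real m))" by (simp add: algebra_simps)
        ultimately show ?thesis unfolding eq by linarith
      qed
      have "\<bar>\<Sum>j<m. V (\<gamma> (real j / real m)) $ l * (DFc l r (\<gamma> (real j / real m)) \<bullet> (\<gamma> (real (Suc j) / real m) - \<gamma> (real j / real m)))
          - V (\<gamma> (real (Suc j) / real m)) $ l * (Fc l r (\<gamma> (real (Suc j) / real m)) - Fc l r (\<gamma> (real j / real m)))\<bar>
          \<le> (\<Sum>j<m. (C + B) * \<epsilon> * (L / real m))"
        by (intro order_trans[OF sum_abs] sum_mono bound) auto
      also have "\<dots> = (C + B) * \<epsilon> * L" using elim by simp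
      also have "\<dots> < e" by (rule \<epsilon>e)
      finally show ?case by simp
    qed
  qed
  have "(\<lambda>m. (\<Sum>j<m. defect r V (\<gamma> (real j / real m)) \<bullet> (\<gamma> (real (Suc j) / real m) - \<gamma> (real j / real m)))
     + (\<Sum>l\<in>UNIV. \<Sum>j<m. V (\<gamma> (real j / real m)) $ l * (DFc l r (\<gamma> (real j / real m)) \<bullet> (\<gamma> (real (Suc j) / real m) - \<gamma> (real j / real m)))
          - V (\<gamma> (real (Suc j) / real m)) $ l * (Fc l r (\<gamma> (real (Suc j) / real m)) - Fc l r (\<gamma> (real j / real m)))))
    \<longlonglongrightarrow> line_integral \<gamma> (defect r V) + (\<Sum>l\<in>(UNIV :: 'n set). 0)"
    by (intro tendsto_add main tendsto_sum err)
  moreover have "\<forall>\<^sub>F m in sequentially. (\<Sum>j<m. \<Sum>l\<in>UNIV. riemann_drift r V (\<lambda>j. \<gamma> (real j / real m)) j l)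
     = (\<Sum>j<m. defect r V (\<gamma> (real j / real m)) \<bullet> (\<gamma> (real (Suc j) / real m) - \<gamma> (real j / real m)))
     + (\<Sum>l\<in>UNIV. \<Sum>j<m. V (\<gamma> (real j / real m)) $ l * (DFc l r (\<gamma> (real j / real m)) \<bullet> (\<gamma> (real (Suc j) / real m) - \<gamma> (real j / real m)))
          - V (\<gamma> (real (Suc j) / real m)) $ l * (Fc l r (\<gamma> (real (Suc j) / real m)) - Fc l r (\<gamma> (real j / real m))))"
    using eventually_gt_at_top[of "0::nat"]
  proof eventually_elim
    case (elim m)
    show ?case by (rule riemann_drift_rearranged) (use closed elim in simp)
  qed
  ultimately show ?thesis by (simp add: tendsto_cong)
qed

end

section \<open>The loop transported by the flow\<close>

lemma continuous_on_imp_cadlag: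
  assumes c: "continuous_on {a..b} f"
  shows "cadlag_on a b f"
  unfolding cadlag_on_def
proof (intro conjI ballI)
  fix t assume t: "t \<in> {a..<b}"
  have "continuous_on {t..b} f" by (rule continuous_on_subset[OF c]) (use t in auto)
  then show "(f \<longlongrightarrow> f t) (at_right t)" using t by (intro continuous_on_Icc_at_rightD) auto
next
  fix t assume t: "t \<in> {a<..b}"
  have "continuous_on {a..t} f" by (rule continuous_on_subset[OF c]) (use t in auto)
  then have "(f \<longlongrightarrow> f t) (at_left t)" using t by (intro continuous_on_Icc_at_leftD) auto
  then show "\<exists>l. (f \<longlongrightarrow> l) (at_left t)" by blast
qed

text \<open>The set \<open>E\<close> and the function \<open>g\<close> are those of lemma
\<open>good_times\<close>.\<close>

locale loop_in_flow = wiener_basis M \<F> W + advected_field T \<nu> \<alpha> s v F F0 + C1_curve \<Gamma> D\<Gamma>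
  for M :: "'a measure" and \<F> :: "real \<Rightarrow> 'a measure" and W :: "real \<Rightarrow> 'a \<Rightarrow> real^'n::finite"
    and T \<nu> \<alpha> s and v F :: "real \<Rightarrow> real^'n \<Rightarrow> real^'n" and F0 and \<Gamma> D\<Gamma> :: "real \<Rightarrow> real^'n" +
  fixes X :: "real \<Rightarrow> real \<Rightarrow> real^'n \<Rightarrow> 'a \<Rightarrow> real^'n" and E :: "real set" and g :: "real \<Rightarrow> real"
  assumes flow: "stochastic_flow M \<F> W T \<nu> v X" and closed: "\<Gamma> 1 = \<Gamma> 0"
    and E: "E \<subseteq> {0<..<T}" "negligible ({0..T} - E)" and g: "g integrable_on {0..T}" "\<And>r. 0 \<le> g r"
    and vE: "\<And>r. r \<in> E \<Longrightarrow> continuous_on UNIV (v r)" "\<And>r x. r \<in> E \<Longrightarrow> norm (v r x) \<le> g r"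
      "\<And>r x y. r \<in> E \<Longrightarrow> norm (v r x - v r y) \<le> g r * norm (x - y)"
    and circulation: "\<And>r \<gamma>. r \<in> E \<Longrightarrow> C1_loop \<gamma> \<Longrightarrow> line_integral \<gamma> (defect r (v r)) = 0"
begin

text \<open>\<open>V\<close> is the drift, replaced by zero outside the good times. This affects no integral
over time, and makes the bounds by \<open>g\<close> valid at every time. \<open>circ_sum\<close> is
the Riemann--Stieltjes sum for the circulation \<open>circ\<close>, and \<open>drift_sum\<close> is
its drift.\<close>

definition "\<sigma> = sqrt (2 * \<nu>)"
definition "x u r \<omega> = X a r (\<Gamma> u) \<omega>"
definition "V r = (if r \<in> E then v r else (\<lambda>_. 0))"
definition "vel u r \<omega> = V r (x u r \<omega>)"
definition "circ r \<omega> = line_integral (\<lambda>u. x u r \<omega>) (F (T - r))"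
definition "circ_sum m r \<omega> = (\<Sum>j<m. F (T - r) (x (real j / real m) r \<omega>) \<bullet> (x (real (Suc j) / real m) r \<omega> - x (real j / real m) r \<omega>))"
definition "drift_sum m r \<omega> = (\<Sum>j<m. \<Sum>l\<in>UNIV. riemann_drift r (V r) (\<lambda>j. x (real j / real m) r \<omega>) j l)"

text \<open>The integral equation is postulated only for the countably many loop points \<open>\<Gamma>
(j/m)\<close>, since for each point it holds up to a null set that may depend on the point.\<close>

definition good :: "'a \<Rightarrow> bool" where
  "good \<omega> \<longleftrightarrow> continuous_on {0..} (\<lambda>t. W t \<omega>) \<and>
    (\<forall>j m :: nat. \<forall>r\<in>{a..T}. set_integrable lebesgue {a..r} (\<lambda>r'. v r' (x (real j / real m) r' \<omega>)) \<and>
       x (real j / real m) r \<omega> = \<Gamma> (real j / real m) + (LINT r':{a..r}|lebesgue. v r' (x (real j / real m) r' \<omega>)) + \<sigma> *\<^sub>R (W r \<omega> - W a \<omega>)) \<and>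
    (\<forall>r\<in>{a..T}. C1_diffeo (\<lambda>y. X a r y \<omega>)) \<and>
    continuous_on ({a..T} \<times> UNIV) (\<lambda>(r, y). X a r y \<omega>) \<and>
    (\<forall>j. continuous_on ({a..T} \<times> UNIV) (\<lambda>(r, y). partial j (\<lambda>y. X a r y \<omega>) y))"

lemma a_bounds: "0 \<le> a" "a \<le> T" using s by auto
lemma sigma: "0 \<le> \<sigma>" "\<sigma>\<^sup>2 / 2 = \<nu>" using \<nu> by (auto simp: \<sigma>_def)
lemma g_a: "g integrable_on {a..T}" by (rule integrable_on_subinterval[OF g(1)]) (use a_bounds in auto)
lemma V: "continuous_on UNIV (V r)" "norm (V r y) \<le> g r" "norm (V r y - V r y') \<le> g r * norm (y - y')"
  using vE[of r] g(2)[of r] by (auto simp: V_def)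

lemma good_AE: "AE \<omega> in M. good \<omega>"
proof -
  have w: "AE \<omega> in M. continuous_on {0..} (\<lambda>t. W t \<omega>)" using wiener by (simp add: wiener_process_def)
  have "AE \<omega> in M. \<forall>t\<in>{a..T}. set_integrable lebesgue {a..t} (\<lambda>r. v r (X a r y \<omega>)) \<and>
        X a t y \<omega> = y + (LINT r:{a..t}|lebesgue. v r (X a r y \<omega>)) + sqrt (2 * \<nu>) *\<^sub>R (W t \<omega> - W a \<omega>)" for y
    using flow s unfolding stochastic_flow_def by auto
  then have ode: "AE \<omega> in M. \<forall>j m :: nat. \<forall>r\<in>{a..T}. set_integrable lebesgue {a..r} (\<lambda>r'. v r' (x (real j / real m) r' \<omega>)) \<and>
       x (real j / real m) r \<omega> = \<Gamma> (real j / real m) + (LINT r':{a..r}|lebesgue. v r' (x (real j / real m) r' \<omega>)) + \<sigma> *\<^sub>R (W r \<omega> - W a \<omega>)"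
    unfolding x_def \<sigma>_def AE_all_countable by blast
  have diffeo: "AE \<omega> in M. \<forall>s t. 0 \<le> s \<and> s \<le> t \<and> t \<le> T \<longrightarrow> C1_diffeo (\<lambda>x. X s t x \<omega>)"
    and c0: "AE \<omega> in M. continuous_on (flow_domain T) (\<lambda>(s, t, x). X s t x \<omega>)"
    and c1: "AE \<omega> in M. \<forall>j. continuous_on (flow_domain T) (\<lambda>(s, t, x). partial j (\<lambda>y. X s t y \<omega>) x)"
    using flow unfolding stochastic_flow_def by auto
  have slice: "continuous_on ({a..T} \<times> UNIV) (\<lambda>(r, y). k a r y)"
    if "continuous_on (flow_domain T) (\<lambda>(s, t, x). k s t x)" for k :: "real \<Rightarrow> real \<Rightarrow> real^'n \<Rightarrow> real^'n"
  proof -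
    have "continuous_on ({a..T} \<times> (UNIV :: (real^'n) set)) (\<lambda>p. (a, fst p, snd p))" by (intro continuous_intros)
    moreover have "(\<lambda>p. (a, fst p, snd p)) ` ({a..T} \<times> (UNIV :: (real^'n) set)) \<subseteq> flow_domain T"
      using a_bounds by (auto simp: flow_domain_def)
    ultimately have "continuous_on ({a..T} \<times> UNIV) (\<lambda>p. (\<lambda>(s, t, x). k s t x) (a, fst p, snd p))"
      by (rule continuous_on_compose2[OF that])
    then show ?thesis by (simp add: split_beta)
  qed
  show ?thesis
    using w ode diffeo c0 c1
  proof eventually_elim
    case (elim \<omega>)
    show ?case unfolding good_def
    proof (intro conjI)
      show "\<forall>r\<in>{a..T}. C1_diffeo (\<lambda>y. X a r y \<omega>)" using elim(3) a_bounds by auto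
      show "continuous_on ({a..T} \<times> UNIV) (\<lambda>(r, y). X a r y \<omega>)" using slice[OF elim(4)] .
      show "\<forall>j. continuous_on ({a..T} \<times> UNIV) (\<lambda>(r, y). partial j (\<lambda>y. X a r y \<omega>) y)"
      proof
        fix j show "continuous_on ({a..T} \<times> UNIV) (\<lambda>(r, y). partial j (\<lambda>y. X a r y \<omega>) y)"
          using slice[of "\<lambda>s t x. partial j (\<lambda>y. X s t y \<omega>) x"] elim(5) by blast
      qed
    qed (use elim(1,2) in auto)
  qed
qed

definition "tangent r \<omega> u = (\<Sum>j\<in>UNIV. D\<Gamma> u $ j *\<^sub>R partial j (\<lambda>y. X a r y \<omega>) (\<Gamma> u))"

lemma transported_curve:
  assumes "good \<omega>" and r: "r \<in> {a..T}"
  shows "C1_curve (\<lambda>u. x u r \<omega>) (tangent r \<omega>)"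
proof
  have "C1_diffeo (\<lambda>y. X a r y \<omega>)" using assms by (auto simp: good_def)
  then have "Ck (Suc 0) (\<lambda>y. X a r y \<omega>)" by (simp add: C1_diffeo_def)
  then have d: "\<And>y. (\<lambda>y. X a r y \<omega>) differentiable (at y)" and c: "\<And>j. continuous_on UNIV (partial j (\<lambda>y. X a r y \<omega>))"
    by auto
  show "((\<lambda>u. x u r \<omega>) has_vector_derivative tangent r \<omega> u) (at u within {0..1})" if "u \<in> {0..1}" for u
  proof -
    have "((\<lambda>u. X a r (\<Gamma> u) \<omega>) has_derivative (\<lambda>h. \<Sum>j\<in>UNIV. ((h *\<^sub>R D\<Gamma> u) $ j) *\<^sub>R partial j (\<lambda>y. X a r y \<omega>) (\<Gamma> u))) (at u within {0..1})"
      using has_derivative_compose[OF deriv[OF that, unfolded has_vector_derivative_def] has_derivative_partial[OF d]] .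
    then show ?thesis
      by (simp add: has_vector_derivative_def x_def tangent_def scaleR_sum_right)
  qed
  show "continuous_on {0..1} (tangent r \<omega>)"
    unfolding tangent_def
    by (intro continuous_on_sum continuous_on_scaleR continuous_on_component cont_D continuous_on_compose2[OF c cont]) auto
qed

lemma transported_closed: "x 1 r \<omega> = x 0 r \<omega>"
  by (simp add: x_def closed)

lemma transported_loop: "good \<omega> \<Longrightarrow> r \<in> {a..T} \<Longrightarrow> C1_loop (\<lambda>u. x u r \<omega>)"
  using C1_curve.deriv[OF transported_curve] C1_curve.cont_D[OF transported_curve] transported_closed
  unfolding C1_loop_def pathfinish_def pathstart_def by blast

lemma x_path_cont:
  assumes "good \<omega>"
  shows "continuous_on {a..T} (\<lambda>r. x u r \<omega>)"
proof -
  have c: "continuous_on ({a..T} \<times> UNIV) (\<lambda>(r, y). X a r y \<omega>)" using assms by (simp add: good_def)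
  have "continuous_on {a..T} (\<lambda>r. (r, \<Gamma> u))" by (intro continuous_intros)
  from continuous_on_compose2[OF c this] show ?thesis by (auto simp: x_def)
qed

lemma velocity_integrable:
  fixes j m :: nat
  assumes "good \<omega>"
  shows "(\<lambda>r. vel (real j / real m) r \<omega>) integrable_on {a..T}"
proof -
  have "set_integrable lebesgue {a..T} (\<lambda>r'. v r' (x (real j / real m) r' \<omega>))"
    using assms a_bounds unfolding good_def by auto
  then have "(\<lambda>r'. v r' (x (real j / real m) r' \<omega>)) integrable_on {a..T}" by (rule set_lebesgue_integral_eq_integral)
  then show ?thesis
    by (rule integrable_spike[OF _ E(2)]) (use a_bounds in \<open>auto simp: vel_def V_def\<close>)
qed

lemma path_equation:
  fixes j m :: nat
  assumes gd: "good \<omega>" and r: "r \<in> {a..T}"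
  shows "x (real j / real m) r \<omega> = \<Gamma> (real j / real m) + integral {a..r} (\<lambda>r. vel (real j / real m) r \<omega>) + \<sigma> *\<^sub>R (W r \<omega> - W a \<omega>)"
proof -
  have i: "set_integrable lebesgue {a..r} (\<lambda>r'. v r' (x (real j / real m) r' \<omega>))"
    and e: "x (real j / real m) r \<omega> = \<Gamma> (real j / real m) + (LINT r':{a..r}|lebesgue. v r' (x (real j / real m) r' \<omega>)) + \<sigma> *\<^sub>R (W r \<omega> - W a \<omega>)"
    using gd r unfolding good_def by blast+
  have "integral {a..r} (\<lambda>r'. v r' (x (real j / real m) r' \<omega>)) = integral {a..r} (\<lambda>r. vel (real j / real m) r \<omega>)"
    by (rule integral_spike[OF E(2)]) (use r a_bounds in \<open>auto simp: vel_def V_def\<close>)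
  then show ?thesis using e set_lebesgue_integral_eq_integral(2)[OF i] by simp
qed

text \<open>The noise cancels in the difference of two particles, so Gronwall's inequality applies to it with
the Lipschitz constant \<open>g\<close>. The resulting constant is deterministic, which makes the
Riemann--Stieltjes sums bounded up to an exit time of the noise.\<close>

lemma spread_bound:
  obtains K where "K > 0" "\<And>\<omega> r (j::nat) m. good \<omega> \<Longrightarrow> r \<in> {a..T} \<Longrightarrow> j < m \<Longrightarrow>
     norm (x (real (Suc j) / real m) r \<omega> - x (real j / real m) r \<omega>) \<le> K / real m"
proof -
  obtain K where K: "K > 0"
    "\<And>\<phi> t. \<lbrakk>continuous_on {a..T} \<phi>; \<And>r. r \<in> {a..T} \<Longrightarrow> 0 \<le> \<phi> r;
        \<And>t t' C. \<lbrakk>a \<le> t; t \<le> t'; t' \<le> T; \<And>r. r \<in> {t..t'} \<Longrightarrow> \<phi> r \<le> C\<rbrakk> \<Longrightarrow> \<phi> t' \<le> \<phi> t + C * integral {t..t'} g;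
        t \<in> {a..T}\<rbrakk> \<Longrightarrow> \<phi> t \<le> K * (\<phi> a :: real)"
    by (rule gronwall_partition[OF a_bounds(2) g_a g(2)]) blast
  obtain L where L: "L > 0" "\<And>u u'. u \<in> {0..1} \<Longrightarrow> u' \<in> {0..1} \<Longrightarrow> norm (\<Gamma> u' - \<Gamma> u) \<le> L * \<bar>u' - u\<bar>"
    using lipschitz by metis
  show thesis
  proof (rule that[of "K * L"])
    show "K * L > 0" using K(1) L(1) by simp
    fix \<omega> r and j m :: nat
    assume gd: "good \<omega>" and r: "r \<in> {a..T}" and j: "j < m"
    let ?u = "real j / real m" and ?u' = "real (Suc j) / real m"
    have u: "?u \<in> {0..1}" "?u' \<in> {0..1}" using j grid_in_unit[of j m] grid_in_unit[of "Suc j" m] by auto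
    define \<phi> where "\<phi> r = norm (x ?u' r \<omega> - x ?u r \<omega>)" for r
    have gron: "\<phi> r \<le> K * \<phi> a"
    proof (rule K(2)[OF _ _ _ r])
      show "continuous_on {a..T} \<phi>" unfolding \<phi>_def by (intro continuous_intros x_path_cont[OF gd])
      show "0 \<le> \<phi> r" for r by (simp add: \<phi>_def)
      fix t t' C assume t: "a \<le> t" "t \<le> t'" "t' \<le> T" and C: "\<And>r. r \<in> {t..t'} \<Longrightarrow> \<phi> r \<le> C"
      have incr: "x (real i / real m) t' \<omega> = x (real i / real m) t \<omega> + integral {t..t'} (\<lambda>r. vel (real i / real m) r \<omega>) + \<sigma> *\<^sub>R (W t' \<omega> - W t \<omega>)" for i :: nat
      proof -
        have "integral {a..t'} (\<lambda>r. vel (real i / real m) r \<omega>)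
            = integral {a..t} (\<lambda>r. vel (real i / real m) r \<omega>) + integral {t..t'} (\<lambda>r. vel (real i / real m) r \<omega>)"
          by (rule Henstock_Kurzweil_Integration.integral_combine[OF t(1,2), symmetric])
            (rule integrable_on_subinterval[OF velocity_integrable[OF gd]], use t in auto)
        moreover have "t \<in> {a..T}" "t' \<in> {a..T}" using t by auto
        note path_equation[OF gd this(1), of i m] path_equation[OF gd this(2), of i m]
        ultimately show ?thesis by (simp add: scaleR_diff_right)
      qed
      have i1: "(\<lambda>r. vel (real i / real m) r \<omega>) integrable_on {t..t'}" for i :: nat
        by (rule integrable_on_subinterval[OF velocity_integrable[OF gd]]) (use t in auto)
      have gi: "g integrable_on {t..t'}" by (rule integrable_on_subinterval[OF g_a]) (use t in auto)
      have "norm (integral {t..t'} (\<lambda>r. vel ?u' r \<omega> - vel ?u r \<omega>)) \<le> integral {t..t'} (\<lambda>r. C * g r)"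
      proof (rule Henstock_Kurzweil_Integration.integral_norm_bound_integral)
        show "(\<lambda>r. vel ?u' r \<omega> - vel ?u r \<omega>) integrable_on {t..t'}" by (intro integrable_diff i1)
        show "(\<lambda>r. C * g r) integrable_on {t..t'}" by (intro integrable_on_mult_right gi)
        fix r assume r: "r \<in> {t..t'}"
        have "norm (vel ?u' r \<omega> - vel ?u r \<omega>) \<le> g r * \<phi> r" unfolding vel_def \<phi>_def by (rule V(3))
        also have "\<dots> \<le> g r * C" using C[OF r] g(2) by (intro mult_left_mono)
        finally show "norm (vel ?u' r \<omega> - vel ?u r \<omega>) \<le> C * g r" by (simp add: mult.commute)
      qed
      then have i2: "norm (integral {t..t'} (\<lambda>r. vel ?u' r \<omega>) - integral {t..t'} (\<lambda>r. vel ?u r \<omega>)) \<le> C * integral {t..t'} g"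
        by (simp add: Henstock_Kurzweil_Integration.integral_diff[OF i1 i1] del: of_nat_Suc)
      have "x ?u' t' \<omega> - x ?u t' \<omega> = (x ?u' t \<omega> - x ?u t \<omega>) + (integral {t..t'} (\<lambda>r. vel ?u' r \<omega>) - integral {t..t'} (\<lambda>r. vel ?u r \<omega>))"
        using incr[of "Suc j"] incr[of j] by simp
      note step = this
      show "\<phi> t' \<le> \<phi> t + C * integral {t..t'} g"
        unfolding \<phi>_def step by (rule order_trans[OF norm_triangle_ineq add_left_mono[OF i2]])
    qed
    have start: "\<phi> a \<le> L * \<bar>?u' - ?u\<bar>"
    proof -
      have "\<phi> a = norm (\<Gamma> ?u' - \<Gamma> ?u)"
        using path_equation[OF gd, of a j m] path_equation[OF gd, of a "Suc j" m] a_bounds by (simp add: \<phi>_def)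
      then show ?thesis using L(2)[OF u] by simp
    qed
    have "\<phi> r \<le> K * (L * \<bar>?u' - ?u\<bar>)"
      using K(1) by (intro order_trans[OF gron mult_left_mono[OF start]]) simp
    moreover have "\<bar>?u' - ?u\<bar> = 1 / real m" by (simp add: add_divide_distrib)
    ultimately show "norm (x ?u' r \<omega> - x ?u r \<omega>) \<le> K * L / real m" by (simp add: \<phi>_def)
  qed
qed

text \<open>The integrand of the line integral is jointly continuous in time and the loop parameter, because the
spatial derivatives of the flow are.\<close>

lemma circ_path_cont:
  assumes gd: "good \<omega>"
  shows "continuous_on {a..T} (\<lambda>r. circ r \<omega>)"
proof -
  have c0: "continuous_on ({a..T} \<times> UNIV) (\<lambda>(r, y). X a r y \<omega>)"
    and c1: "\<And>j. continuous_on ({a..T} \<times> UNIV) (\<lambda>(r, y). partial j (\<lambda>y. X a r y \<omega>) y)" using gd by (auto simp: good_def)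
  have cu: "continuous_on ({a..T} \<times> cbox 0 1) (\<lambda>p. \<Gamma> (snd p))" "continuous_on ({a..T} \<times> cbox 0 1) (\<lambda>p. D\<Gamma> (snd p))"
    by (rule continuous_on_compose2[OF cont] continuous_on_compose2[OF cont_D], auto intro!: continuous_intros)+
  have cp: "continuous_on ({a..T} \<times> cbox (0::real) 1) (\<lambda>p. (fst p, \<Gamma> (snd p)))"
    by (intro continuous_intros cu)
  have along: "continuous_on ({a..T} \<times> cbox (0::real) 1) (\<lambda>p. k (fst p) (\<Gamma> (snd p)))"
    if "continuous_on ({a..T} \<times> UNIV) (\<lambda>(r, y). k r y)" for k :: "real \<Rightarrow> real^'n \<Rightarrow> real^'n"
  proof -
    have "continuous_on ({a..T} \<times> cbox (0::real) 1) (\<lambda>p. (\<lambda>(r, y). k r y) ((\<lambda>p. (fst p, \<Gamma> (snd p))) p))"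
      by (rule continuous_on_compose2[OF that cp]) auto
    then show ?thesis by simp
  qed
  have cX: "continuous_on ({a..T} \<times> cbox (0::real) 1) (\<lambda>p. (fst p, x (snd p) (fst p) \<omega>))"
    unfolding x_def by (intro continuous_intros along[OF c0])
  have "continuous_on ({a..T} \<times> cbox (0::real) 1) (\<lambda>p. (\<lambda>(r, y). F (T - r) y) ((\<lambda>p. (fst p, x (snd p) (fst p) \<omega>)) p))"
    by (rule continuous_on_compose2[OF reversed_cont[OF F_cont(1)] cX]) auto
  then have "continuous_on ({a..T} \<times> cbox (0::real) 1) (\<lambda>p. F (T - fst p) (x (snd p) (fst p) \<omega>))" by simp
  moreover have "continuous_on ({a..T} \<times> cbox (0::real) 1) (\<lambda>p. tangent (fst p) \<omega> (snd p))"
    unfolding tangent_def by (intro continuous_intros cu along[OF c1])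
  ultimately have "continuous_on ({a..T} \<times> cbox 0 1) (\<lambda>(r, u). F (T - r) (x u r \<omega>) \<bullet> tangent r \<omega> u)"
    unfolding split_beta by (intro continuous_on_inner)
  then have "continuous_on {a..T} (\<lambda>r. integral (cbox 0 1) (\<lambda>u. F (T - r) (x u r \<omega>) \<bullet> tangent r \<omega> u))"
    by (rule integral_continuous_on_param)
  then show ?thesis
  proof (rule continuous_on_eq)
    fix r assume "r \<in> {a..T}"
    then show "integral (cbox 0 1) (\<lambda>u. F (T - r) (x u r \<omega>) \<bullet> tangent r \<omega> u) = circ r \<omega>"
      unfolding circ_def using line_integral_eq[OF C1_curve.deriv[OF transported_curve[OF gd]]] by simp
  qed
qed

lemma circ_sum_tendsto:
  assumes "good \<omega>" "r \<in> {a..T}"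
  shows "(\<lambda>m. circ_sum m r \<omega>) \<longlonglongrightarrow> circ r \<omega>"
  unfolding circ_sum_def circ_def
  by (rule C1_curve.riemann_stieltjes[OF transported_curve[OF assms]], rule time_slice_cont[OF F_cont(1)]) (use assms s in auto)

lemma x_adapted: "r \<in> {a..T} \<Longrightarrow> x u r \<in> borel_measurable (\<F> r)"
  unfolding x_def[abs_def] using flow a_bounds unfolding stochastic_flow_def by auto

lemma circ_sum_adapted:
  assumes r: "r \<in> {a..T}"
  shows "circ_sum m r \<in> borel_measurable (\<F> r)"
proof -
  have [measurable]: "F (T - r) \<in> borel_measurable borel"
    by (rule borel_measurable_continuous_onI, rule time_slice_cont[OF F_cont(1)]) (use r s in auto)
  note [measurable] = x_adapted[OF r]
  show ?thesis unfolding circ_sum_def[abs_def] by measurable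
qed

lemma circ_adapted:
  assumes r: "r \<in> {a..T}"
  shows "circ r \<in> borel_measurable (\<F> r)"
proof (rule measurable_AE_LIMSEQ_complete[where M=M and f="\<lambda>m. circ_sum m r"])
  show "complete_measure M" by (rule complete_measure_axioms)
  have r0: "0 \<le> r" using r a_bounds by auto
  show "space (\<F> r) = space M" "sets (\<F> r) \<subseteq> sets M" "null_sets M \<subseteq> sets (\<F> r)"
    using space_F[OF r0] sets_F[OF r0] null_sets_F[OF r0] by auto
  show "AE \<omega> in M. (\<lambda>m. circ_sum m r \<omega>) \<longlonglongrightarrow> circ r \<omega>" using good_AE by eventually_elim (rule circ_sum_tendsto[OF _ r])
qed (rule circ_sum_adapted[OF r])

end

section \<open>The circulation stopped at an exit time\<close>

text \<open>The set \<open>N\<close> is a null set outside which the path properties collected in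
\<open>good\<close> hold; \<open>\<kappa>\<close> is the level at which the noise is stopped.\<close>

locale stopped_loop = loop_in_flow M \<F> W T \<nu> \<alpha> s v F F0 \<Gamma> D\<Gamma> X E g
  for M :: "'a measure" and \<F> :: "real \<Rightarrow> 'a measure" and W :: "real \<Rightarrow> 'a \<Rightarrow> real^'n::finite"
    and T \<nu> \<alpha> s and v F :: "real \<Rightarrow> real^'n \<Rightarrow> real^'n" and F0 and \<Gamma> D\<Gamma> :: "real \<Rightarrow> real^'n" and X E g +
  fixes N :: "'a set" and \<kappa> :: real
  assumes N: "N \<in> null_sets M" and N_good: "\<And>\<omega>. \<omega> \<in> space M \<Longrightarrow> \<omega> \<notin> N \<Longrightarrow> good \<omega>" and \<kappa>: "0 < \<kappa>"
begin

definition "\<tau> = exit_time a T N \<kappa>"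

lemma W_cont: "\<omega> \<in> space M \<Longrightarrow> \<omega> \<notin> N \<Longrightarrow> continuous_on {0..} (\<lambda>t. W t \<omega>)"
  using N_good by (simp add: good_def)

lemma tau_range: "\<tau> \<omega> \<in> {a..T}"
  unfolding \<tau>_def by (rule exit_time_range[OF a_bounds N W_cont])

lemma tau_stopping: "stopping_time \<F> \<tau>"
  unfolding \<tau>_def by (rule exit_time_stopping[OF a_bounds N W_cont])

lemma before_tau: "\<omega> \<in> space M \<Longrightarrow> \<omega> \<notin> N \<Longrightarrow> r \<in> {a..T} \<Longrightarrow> r \<le> \<tau> \<omega> \<Longrightarrow> norm (W r \<omega> - W a \<omega>) \<le> \<kappa>"
  unfolding \<tau>_def by (rule before_exit_time[OF a_bounds N W_cont _ _ \<kappa>])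

lemma AE_regular: "AE \<omega> in M. \<omega> \<in> space M \<and> \<omega> \<notin> N"
  using AE_not_in[OF N] by auto

text \<open>There are \<open>m\<close> terms, and in each of them the difference of neighbouring particles, or
of their velocities, contributes a factor of order \<open>1/m\<close>. So the bounds are uniform in
\<open>m\<close>.\<close>

lemma localized_bounds:
  obtains C where "C > 0"
    "\<And>\<omega> r m. \<omega> \<in> space M \<Longrightarrow> \<omega> \<notin> N \<Longrightarrow> r \<in> {a..T} \<Longrightarrow> r \<le> \<tau> \<omega> \<Longrightarrow> \<bar>circ_sum m r \<omega>\<bar> \<le> C \<and> \<bar>drift_sum m r \<omega>\<bar> \<le> C * (1 + g r)"
proof -
  obtain K where K: "K > 0" "\<And>\<omega> r (j::nat) m. good \<omega> \<Longrightarrow> r \<in> {a..T} \<Longrightarrow> j < m \<Longrightarrow>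
     norm (x (real (Suc j) / real m) r \<omega> - x (real j / real m) r \<omega>) \<le> K / real m"
    by (rule spread_bound) blast
  have "bounded (\<Gamma> ` {0..1})" by (intro compact_imp_bounded compact_continuous_image cont) auto
  then obtain B where B: "\<And>u. u \<in> {0..1} \<Longrightarrow> norm (\<Gamma> u) \<le> B" unfolding bounded_iff by (meson imageI)
  define R where "R = B + integral {a..T} g + \<sigma> * \<kappa>"
  have xR: "norm (x (real j / real m) r \<omega>) \<le> R"
    if \<omega>: "\<omega> \<in> space M" "\<omega> \<notin> N" and r: "r \<in> {a..T}" "r \<le> \<tau> \<omega>" and j: "j < m" for \<omega> r and j m :: nat
  proof -
    have "norm (integral {a..r} (\<lambda>r. vel (real j / real m) r \<omega>)) \<le> integral {a..r} g"
    proof (rule Henstock_Kurzweil_Integration.integral_norm_bound_integral)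
      show "(\<lambda>r. vel (real j / real m) r \<omega>) integrable_on {a..r}"
        by (rule integrable_on_subinterval[OF velocity_integrable[OF N_good[OF \<omega>]]]) (use r in auto)
      show "g integrable_on {a..r}" by (rule integrable_on_subinterval[OF g_a]) (use r in auto)
    qed (simp add: vel_def V)
    also have "\<dots> \<le> integral {a..T} g"
      by (rule integral_subset_le[OF _ integrable_on_subinterval[OF g_a] g_a]) (use r g(2) in auto)
    finally have 1: "norm (integral {a..r} (\<lambda>r. vel (real j / real m) r \<omega>)) \<le> integral {a..T} g" .
    have 2: "norm (\<sigma> *\<^sub>R (W r \<omega> - W a \<omega>)) \<le> \<sigma> * \<kappa>"
      using before_tau[OF \<omega> r] sigma(1) by (simp add: mult_left_mono)
    have 3: "norm (\<Gamma> (real j / real m)) \<le> B" using j by (intro B grid_in_unit) auto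
    show ?thesis
      unfolding path_equation[OF N_good[OF \<omega>] r(1)] R_def
      by (intro norm_triangle_le add_mono 1 2 3)
  qed
  have "\<exists>C. \<forall>r y. r \<in> {a..T} \<longrightarrow> norm y \<le> R \<longrightarrow> \<bar>Fc l r y\<bar> \<le> C \<and> \<bar>Fc_t l r y + \<nu> * trace (D2Fc l r y)\<bar> \<le> C \<and> norm (DFc l r y) \<le> C" for l
  proof -
    interpret J: space_time_C12 a T "Fc l" "Fc_t l" "DFc l" "D2Fc l" by (rule jet)
    have c: "continuous_on ({a..T} \<times> UNIV) (\<lambda>(r, y). Fc_t l r y + \<nu> * trace (D2Fc l r y))"
      using J.cont_t J.cont_xx unfolding split_beta trace_def by (intro continuous_intros) auto
    obtain C1 where C1: "C1 > 0" "\<And>t x. t \<in> {a..T} \<Longrightarrow> norm x \<le> R \<Longrightarrow> norm (Fc l t x) \<le> C1"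
      using J.bounded_on_cball[OF J.cont_f] by metis
    obtain C2 where C2: "C2 > 0" "\<And>t x. t \<in> {a..T} \<Longrightarrow> norm x \<le> R \<Longrightarrow> norm (Fc_t l t x + \<nu> * trace (D2Fc l t x)) \<le> C2"
      using J.bounded_on_cball[OF c] by metis
    obtain C3 where C3: "C3 > 0" "\<And>t x. t \<in> {a..T} \<Longrightarrow> norm x \<le> R \<Longrightarrow> norm (DFc l t x) \<le> C3"
      using J.bounded_on_cball[OF J.cont_x] by metis
    show ?thesis
    proof (intro exI[of _ "max C1 (max C2 C3)"] allI impI)
      fix r :: real and y :: "real^'n" assume "r \<in> {a..T}" "norm y \<le> R"
      from C1(2)[OF this] C2(2)[OF this] C3(2)[OF this]
      show "\<bar>Fc l r y\<bar> \<le> max C1 (max C2 C3) \<and> \<bar>Fc_t l r y + \<nu> * trace (D2Fc l r y)\<bar> \<le> max C1 (max C2 C3) \<and> norm (DFc l r y) \<le> max C1 (max C2 C3)"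
        by (simp add: le_max_iff_disj)
    qed
  qed
  then obtain Cl where Cl: "\<And>l r y. r \<in> {a..T} \<Longrightarrow> norm y \<le> R \<Longrightarrow>
      \<bar>Fc l r y\<bar> \<le> Cl l \<and> \<bar>Fc_t l r y + \<nu> * trace (D2Fc l r y)\<bar> \<le> Cl l \<and> norm (DFc l r y) \<le> Cl l" by metis
  define C where "C = Max (insert 1 (range Cl))"
  have C1: "C \<ge> 1" unfolding C_def by (rule Max_ge) auto
  have ClC: "Cl l \<le> C" for l unfolding C_def by (rule Max_ge) auto
  have C: "\<bar>Fc l r y\<bar> \<le> C" "\<bar>Fc_t l r y + \<nu> * trace (D2Fc l r y)\<bar> \<le> C" "norm (DFc l r y) \<le> C"
    if "r \<in> {a..T}" "norm y \<le> R" for l r y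
    using Cl[OF that, of l] ClC[of l] by auto
  let ?n = "real CARD('n)"
  show thesis
  proof (rule that[of "2 * ?n * K * C"])
    show "2 * ?n * K * C > 0" using K(1) C1 by simp
    fix \<omega> r and m :: nat
    assume \<omega>: "\<omega> \<in> space M" "\<omega> \<notin> N" and r: "r \<in> {a..T}" "r \<le> \<tau> \<omega>"
    define y where "y j = x (real j / real m) r \<omega>" for j :: nat
    have yR: "norm (y j) \<le> R" if "j < m" for j unfolding y_def by (rule xR[OF \<omega> r that])
    have dy: "norm (y (Suc j) - y j) \<le> K / real m" if "j < m" for j
      unfolding y_def by (rule K(2)[OF N_good[OF \<omega>] r(1) that])
    have dyl: "\<bar>(y (Suc j) - y j) $ l\<bar> \<le> K / real m" if "j < m" for j l
      using component_le_norm_cart[of "y (Suc j) - y j" l] dy[OF that] by linarith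
    have Km: "0 \<le> K / real m" using K(1) by simp
    have sumbound: "\<bar>\<Sum>j<m. \<Sum>l\<in>UNIV. c j (l::'n)\<bar> \<le> ?n * K * D" if "\<And>j l. j < m \<Longrightarrow> \<bar>c j l\<bar> \<le> K / real m * D" "D \<ge> 0"
      for c :: "nat \<Rightarrow> 'n \<Rightarrow> real" and D
    proof -
      have "\<bar>\<Sum>j<m. \<Sum>l\<in>UNIV. c j l\<bar> \<le> (\<Sum>j<m. \<Sum>l\<in>(UNIV::'n set). K / real m * D)"
        by (intro order_trans[OF sum_abs] sum_mono that(1)) simp
      also have "\<dots> \<le> ?n * K * D" using K(1) that(2) by (cases "m = 0") auto
      finally show ?thesis .
    qed
    have RSe: "circ_sum m r \<omega> = (\<Sum>j<m. \<Sum>l\<in>UNIV. Fc l r (y j) * (y (Suc j) - y j) $ l)"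
      unfolding circ_sum_def y_def inner_vec_def Fc_def by simp
    have 1: "\<bar>circ_sum m r \<omega>\<bar> \<le> ?n * K * C"
      unfolding RSe
    proof (rule sumbound)
      fix j l assume j: "j < m"
      have "\<bar>Fc l r (y j)\<bar> * \<bar>(y (Suc j) - y j) $ l\<bar> \<le> C * (K / real m)"
        using C(1)[OF r(1) yR[OF j]] dyl[OF j] C1 by (intro mult_mono) auto
      then show "\<bar>Fc l r (y j) * (y (Suc j) - y j) $ l\<bar> \<le> K / real m * C" by (simp only: abs_mult mult.commute)
    qed (use C1 in simp)
    have 2: "\<bar>drift_sum m r \<omega>\<bar> \<le> ?n * K * (C * (1 + 2 * g r))"
      unfolding drift_sum_def y_def[symmetric]
    proof (rule sumbound)
      show "0 \<le> C * (1 + 2 * g r)" using C1 g(2)[of r] by simp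
      fix j l assume j: "j < m"
      have t1: "\<bar>(y (Suc j) - y j) $ l * (Fc_t l r (y j) + \<nu> * trace (D2Fc l r (y j)))\<bar> \<le> K / real m * C"
        unfolding abs_mult using C(2)[OF r(1) yR[OF j]] dyl[OF j] Km by (intro mult_mono) auto
      have "norm ((y (Suc j) - y j) $ l *\<^sub>R DFc l r (y j)) \<le> K / real m * C"
        unfolding norm_scaleR using C(3)[OF r(1) yR[OF j]] dyl[OF j] Km by (intro mult_mono) auto
      then have "norm ((y (Suc j) - y j) $ l *\<^sub>R DFc l r (y j)) * norm (V r (y j)) \<le> K / real m * C * g r"
        using V(2)[of r "y j"] mult_nonneg_nonneg[OF Km, of C] C1 by (intro mult_mono) (auto simp del: times_divide_eq_left)
      then have t2: "\<bar>((y (Suc j) - y j) $ l *\<^sub>R DFc l r (y j)) \<bullet> V r (y j)\<bar> \<le> K / real m * C * g r"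
        by (rule order_trans[OF Cauchy_Schwarz_ineq2])
      have "\<bar>(V r (y (Suc j)) - V r (y j)) $ l\<bar> \<le> g r * (K / real m)"
        using component_le_norm_cart[of "V r (y (Suc j)) - V r (y j)" l] V(3)[of r "y (Suc j)" "y j"]
          mult_left_mono[OF dy[OF j] g(2)[of r]] by linarith
      then have t3: "\<bar>Fc l r (y j) * (V r (y (Suc j)) - V r (y j)) $ l\<bar> \<le> C * (g r * (K / real m))"
        unfolding abs_mult using C(1)[OF r(1) yR[OF j]] C1 by (intro mult_mono) auto
      have eq: "K / real m * (C * (1 + 2 * g r)) = K / real m * C + K / real m * C * g r + C * (g r * (K / real m))"
      proof -
        have "k * (c * (1 + 2 * h)) = k * c + k * c * h + c * (h * k)" for k c h :: real by (simp add: algebra_simps)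
        then show ?thesis .
      qed
      show "\<bar>riemann_drift r (V r) y j l\<bar> \<le> K / real m * (C * (1 + 2 * g r))"
        unfolding riemann_drift_def eq using t1 t2 t3 by linarith
    qed
    have "?n * K * (C * (1 + 2 * g r)) \<le> 2 * ?n * K * C * (1 + g r)"
      using K(1) C1 g(2)[of r] by (simp add: algebra_simps)
    moreover have "?n * K * C \<le> 2 * ?n * K * C" using K(1) C1 by simp
    ultimately show "\<bar>circ_sum m r \<omega>\<bar> \<le> 2 * ?n * K * C \<and> \<bar>drift_sum m r \<omega>\<bar> \<le> 2 * ?n * K * C * (1 + g r)"
      using 1 2 by linarith
  qed
qed

text \<open>At each good time the drift converges to the circulation of the defect around the transported loop,
which is zero; the convergence is dominated by a multiple of \<open>1 + g\<close>.\<close>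

lemma drift_sum_integral_tendsto:
  assumes \<omega>: "\<omega> \<in> space M" "\<omega> \<notin> N" and r: "a \<le> r" "r \<le> r'" "r' \<le> T" "r < r' \<Longrightarrow> r' \<le> \<tau> \<omega>"
    and int: "\<And>m. (\<lambda>r. drift_sum m r \<omega>) integrable_on {r..r'}"
  shows "(\<lambda>m. integral {r..r'} (\<lambda>r. drift_sum m r \<omega>)) \<longlonglongrightarrow> 0"
proof (cases "r = r'")
  case True
  then show ?thesis by simp
next
  case False
  obtain C where C: "C > 0"
    "\<And>\<omega> r m. \<omega> \<in> space M \<Longrightarrow> \<omega> \<notin> N \<Longrightarrow> r \<in> {a..T} \<Longrightarrow> r \<le> \<tau> \<omega> \<Longrightarrow> \<bar>circ_sum m r \<omega>\<bar> \<le> C \<and> \<bar>drift_sum m r \<omega>\<bar> \<le> C * (1 + g r)"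
    by (rule localized_bounds) blast
  let ?d = "\<lambda>m u. if u \<in> E then drift_sum m u \<omega> else 0"
  have neg: "negligible ({0..T} - E)" by (rule E(2))
  have eq: "integral {r..r'} (\<lambda>r. drift_sum m r \<omega>) = integral {r..r'} (?d m)" for m
    by (rule integral_spike[OF neg]) (use r a_bounds in auto)
  have "(\<lambda>m. integral {r..r'} (?d m)) \<longlonglongrightarrow> integral {r..r'} (\<lambda>_. 0)"
  proof (rule dominated_convergence(2))
    show "?d m integrable_on {r..r'}" for m
      by (rule integrable_spike[OF int neg]) (use r a_bounds in auto)
    show "(\<lambda>u. C * (1 + g u)) integrable_on {r..r'}"
      by (intro integrable_on_mult_right integrable_add integrable_const_ivl integrable_on_subinterval[OF g_a]) (use r in auto)
    show "norm (?d m u) \<le> C * (1 + g u)" if "u \<in> {r..r'}" for m u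
    proof (cases "u \<in> E")
      case True
      have "u \<in> {a..T}" "u \<le> \<tau> \<omega>" using that r False by auto
      then show ?thesis using C(2)[OF \<omega>, of u m] True by simp
    next
      case False
      then show ?thesis using C(1) g(2)[of u] by simp
    qed
    show "(\<lambda>m. ?d m u) \<longlonglongrightarrow> 0" if "u \<in> {r..r'}" for u
    proof (cases "u \<in> E")
      case True
      have u: "u \<in> {a..T}" using that r by auto
      have "(\<lambda>m. drift_sum m u \<omega>) \<longlonglongrightarrow> line_integral (\<lambda>w. x w u \<omega>) (defect u (V u))"
        unfolding drift_sum_def by (rule riemann_drift_limit[OF u V(1) transported_curve[OF N_good[OF \<omega>] u] transported_closed])
      moreover have "line_integral (\<lambda>w. x w u \<omega>) (defect u (V u)) = 0"
        using circulation[OF True transported_loop[OF N_good[OF \<omega>] u]] True by (simp add: V_def)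
      ultimately show ?thesis using True by simp
    qed simp
  qed
  then show ?thesis unfolding eq by simp
qed


lemma tau_before_pred: "r \<in> {a..T} \<Longrightarrow> Measurable.pred (\<F> r) (\<lambda>\<omega>. r < \<tau> \<omega>)"
  by (rule stopping_timeD2[OF tau_stopping])

context
  fixes s' t' :: real and A :: "'a set"
  assumes st: "a \<le> s'" "s' < t'" "t' \<le> T" and A: "A \<in> sets (\<F> s')"
begin

definition "\<theta> \<omega> = max s' (min t' (\<tau> \<omega>))"

lemma theta: "s' \<le> \<theta> \<omega>" "\<theta> \<omega> \<le> t'" "s' < \<theta> \<omega> \<Longrightarrow> \<theta> \<omega> \<le> \<tau> \<omega>"
  using st by (auto simp: \<theta>_def max_def min_def split: if_splits)

text \<open>The stopped Ito formula for one summand of \<open>circ_sum\<close> and one component. The weight is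
a component of the difference of two neighbouring particles and has no noise; its velocity is
bounded by \<open>2 * g\<close>.\<close>

lemma particle_ito:
  fixes j m :: nat and l :: 'n
  defines "d \<equiv> \<lambda>\<omega> r. riemann_drift r (V r) (\<lambda>j. x (real j / real m) r \<omega>) j l"
    and "p \<equiv> \<lambda>r \<omega>. Fc l r (x (real j / real m) r \<omega>) * (x (real (Suc j) / real m) r \<omega> - x (real j / real m) r \<omega>) $ l"
  shows "integrable M (\<lambda>\<omega>. indicator A \<omega> * (p (\<theta> \<omega>) \<omega> - p s' \<omega>))"
    and "integrable M (\<lambda>\<omega>. indicator A \<omega> * integral {s'..\<theta> \<omega>} (d \<omega>))"
    and "expectation (\<lambda>\<omega>. indicator A \<omega> * (p (\<theta> \<omega>) \<omega> - p s' \<omega>))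
       = expectation (\<lambda>\<omega>. indicator A \<omega> * integral {s'..\<theta> \<omega>} (d \<omega>))"
    and "\<And>\<omega>. \<omega> \<in> space M \<Longrightarrow> \<omega> \<notin> N \<Longrightarrow> d \<omega> integrable_on {a..T}"
proof -
  interpret J: space_time_C12 a T "Fc l" "Fc_t l" "DFc l" "D2Fc l" by (rule jet)
  let ?z = "\<lambda>r \<omega>. (x (real (Suc j) / real m) r \<omega> - x (real j / real m) r \<omega>) $ l"
  let ?w = "\<lambda>r \<omega>. vel (real j / real m) r \<omega>"
  let ?q = "\<lambda>r \<omega>. (vel (real (Suc j) / real m) r \<omega> - vel (real j / real m) r \<omega>) $ l"
  interpret D: drifted_particle a T "Fc l" "Fc_t l" "DFc l" "D2Fc l" s' t' \<sigma> \<kappa> "\<lambda>r. 2 * g r"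
      "\<Gamma> (real j / real m)" "(\<Gamma> (real (Suc j) / real m) - \<Gamma> (real j / real m)) $ l"
  proof
    show "(\<lambda>r. 2 * g r) integrable_on {a..T}" by (intro integrable_on_mult_right g_a)
  qed (use st sigma \<kappa> g in auto)
  have adm: "D.admissible (\<tau> \<omega>) (\<lambda>r. W r \<omega> - W a \<omega>) (\<lambda>r. x (real j / real m) r \<omega>) (\<lambda>r. ?z r \<omega>) (\<lambda>r. ?w r \<omega>) (\<lambda>r. ?q r \<omega>)"
    if \<omega>: "\<omega> \<in> space M" "\<omega> \<notin> N" for \<omega>
    unfolding D.admissible_def
  proof (intro conjI ballI impI)
    note gd = N_good[OF \<omega>]
    show "\<tau> \<omega> \<in> {a..T}" by (rule tau_range)
    show "continuous_on {a..T} (\<lambda>r. W r \<omega> - W a \<omega>)"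
      by (intro continuous_intros continuous_on_subset[OF W_cont[OF \<omega>]]) (use a_bounds in auto)
    show wi: "(\<lambda>r. ?w r \<omega>) integrable_on {a..T}" by (rule velocity_integrable[OF gd])
    have wi': "(\<lambda>r. vel (real (Suc j) / real m) r \<omega> - vel (real j / real m) r \<omega>) integrable_on {a..T}"
      by (intro integrable_diff velocity_integrable gd)
    have comp_int: "((\<lambda>r. ?q r \<omega>) has_integral (integral {a..r} (\<lambda>r. vel (real (Suc j) / real m) r \<omega> - vel (real j / real m) r \<omega>)) $ l) {a..r}"
      if "r \<in> {a..T}" for r
    proof -
      have "(\<lambda>r. vel (real (Suc j) / real m) r \<omega> - vel (real j / real m) r \<omega>) integrable_on {a..r}"
        by (rule integrable_on_subinterval[OF wi']) (use that in auto)
      from has_integral_linear[OF integrable_integral[OF this] bounded_linear_vec_nth[of l]]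
      show ?thesis by (simp add: o_def del: of_nat_Suc)
    qed
    show "(\<lambda>r. ?q r \<omega>) integrable_on {a..T}"
      using comp_int[of T] a_bounds by (auto intro: has_integral_integrable)
    fix r assume r: "r \<in> {a..T}"
    show "norm (W r \<omega> - W a \<omega>) \<le> \<kappa>" if "r \<le> \<tau> \<omega>" by (rule before_tau[OF \<omega> r that])
    show "norm (?w r \<omega>) \<le> 2 * g r" using V(2)[of r "x (real j / real m) r \<omega>"] g(2)[of r] by (simp add: vel_def)
    have "norm (vel (real (Suc j) / real m) r \<omega> - vel (real j / real m) r \<omega>) \<le> 2 * g r"
      using norm_triangle_ineq4[of "vel (real (Suc j) / real m) r \<omega>" "vel (real j / real m) r \<omega>"]
        V(2)[of r "x (real j / real m) r \<omega>"] V(2)[of r "x (real (Suc j) / real m) r \<omega>"] unfolding vel_def by linarith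
    then show "\<bar>?q r \<omega>\<bar> \<le> 2 * g r"
      using component_le_norm_cart[of "vel (real (Suc j) / real m) r \<omega> - vel (real j / real m) r \<omega>" l] by linarith
    show "x (real j / real m) r \<omega> = \<Gamma> (real j / real m) + integral {a..r} (\<lambda>r. ?w r \<omega>) + \<sigma> *\<^sub>R (W r \<omega> - W a \<omega>)"
      by (rule path_equation[OF gd r])
    have "x (real (Suc j) / real m) r \<omega> - x (real j / real m) r \<omega> = (\<Gamma> (real (Suc j) / real m) - \<Gamma> (real j / real m))
       + (integral {a..r} (\<lambda>r. vel (real (Suc j) / real m) r \<omega>) - integral {a..r} (\<lambda>r. vel (real j / real m) r \<omega>))"
      unfolding path_equation[OF gd r] by simp
    also have "integral {a..r} (\<lambda>r. vel (real (Suc j) / real m) r \<omega>) - integral {a..r} (\<lambda>r. vel (real j / real m) r \<omega>)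
       = integral {a..r} (\<lambda>r. vel (real (Suc j) / real m) r \<omega> - vel (real j / real m) r \<omega>)"
      by (rule Henstock_Kurzweil_Integration.integral_diff[symmetric]; rule integrable_on_subinterval[OF velocity_integrable[OF gd]])
        (use r in auto)
    finally show "?z r \<omega> = (\<Gamma> (real (Suc j) / real m) - \<Gamma> (real j / real m)) $ l + integral {a..r} (\<lambda>r. ?q r \<omega>)"
      using integral_unique[OF comp_int[OF r]] by simp
  qed
  interpret I: stopped_ito M \<F> W a T "Fc l" "Fc_t l" "DFc l" "D2Fc l" s' t' \<sigma> \<kappa> "\<lambda>r. 2 * g r"
      "\<Gamma> (real j / real m)" "(\<Gamma> (real (Suc j) / real m) - \<Gamma> (real j / real m)) $ l" \<tau> "x (real j / real m)" ?z ?w ?q A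
  proof
    show "0 \<le> a" by (rule a_bounds)
    show "A \<in> sets (\<F> s')" by (rule A)
    fix r assume r: "r \<in> {a..T}"
    show "Measurable.pred (\<F> r) (\<lambda>\<omega>. r < \<tau> \<omega>)" by (rule tau_before_pred[OF r])
    show "x (real j / real m) r \<in> borel_measurable (\<F> r)" by (rule x_adapted[OF r])
    note [measurable] = x_adapted[OF r]
    have "(\<lambda>\<omega>. x (real (Suc j) / real m) r \<omega> - x (real j / real m) r \<omega>) \<in> borel_measurable (\<F> r)" by measurable
    then show "?z r \<in> borel_measurable (\<F> r)"
      by (rule measurable_compose[where g="\<lambda>y. y $ l"]) measurable
  next
    show "AE \<omega> in M. D.admissible (\<tau> \<omega>) (\<lambda>r. W r \<omega> - W a \<omega>) (\<lambda>r. x (real j / real m) r \<omega>) (\<lambda>r. ?z r \<omega>) (\<lambda>r. ?w r \<omega>) (\<lambda>r. ?q r \<omega>)"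
      using AE_regular by eventually_elim (blast intro: adm)
  qed
  have dr: "D.drift (\<lambda>r. x (real j / real m) r \<omega>) (\<lambda>r. ?z r \<omega>) (\<lambda>r. ?w r \<omega>) (\<lambda>r. ?q r \<omega>) = d \<omega>" for \<omega>
    by (rule ext) (simp only: D.drift_def D.lap_def d_def riemann_drift_def sigma(2) vel_def)
  have pp: "D.P (\<lambda>r. x (real j / real m) r \<omega>) (\<lambda>r. ?z r \<omega>) r = p r \<omega>" for \<omega> r
    by (simp only: D.P_def p_def)
  note ito = I.stopped_ito_formula[unfolded dr pp, folded \<theta>_def]
  show "integrable M (\<lambda>\<omega>. indicator A \<omega> * (p (\<theta> \<omega>) \<omega> - p s' \<omega>))" by (rule ito(1))
  show "integrable M (\<lambda>\<omega>. indicator A \<omega> * integral {s'..\<theta> \<omega>} (d \<omega>))" by (rule ito(2))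
  show "expectation (\<lambda>\<omega>. indicator A \<omega> * (p (\<theta> \<omega>) \<omega> - p s' \<omega>))
       = expectation (\<lambda>\<omega>. indicator A \<omega> * integral {s'..\<theta> \<omega>} (d \<omega>))" by (rule ito(3))
  show "d \<omega> integrable_on {a..T}" if "\<omega> \<in> space M" "\<omega> \<notin> N" for \<omega>
    using D.drift_integrable[OF adm[OF that]] unfolding dr .
qed

lemma drift_sum_integrable: "\<omega> \<in> space M \<Longrightarrow> \<omega> \<notin> N \<Longrightarrow> (\<lambda>r. drift_sum m r \<omega>) integrable_on {a..T}"
  unfolding drift_sum_def by (intro integrable_sum finite particle_ito(4)) auto

lemma riemann_sum_ito:
  shows "integrable M (\<lambda>\<omega>. indicator A \<omega> * (circ_sum m (\<theta> \<omega>) \<omega> - circ_sum m s' \<omega>))"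
    and "integrable M (\<lambda>\<omega>. \<Sum>j<m. \<Sum>l\<in>UNIV. indicator A \<omega> * integral {s'..\<theta> \<omega>} (\<lambda>r. riemann_drift r (V r) (\<lambda>j. x (real j / real m) r \<omega>) j l))"
    and "expectation (\<lambda>\<omega>. indicator A \<omega> * (circ_sum m (\<theta> \<omega>) \<omega> - circ_sum m s' \<omega>))
       = expectation (\<lambda>\<omega>. \<Sum>j<m. \<Sum>l\<in>UNIV. indicator A \<omega> * integral {s'..\<theta> \<omega>} (\<lambda>r. riemann_drift r (V r) (\<lambda>j. x (real j / real m) r \<omega>) j l))"
proof -
  let ?p = "\<lambda>j l r \<omega>. Fc l r (x (real j / real m) r \<omega>) * (x (real (Suc j) / real m) r \<omega> - x (real j / real m) r \<omega>) $ l"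
  have RSe: "circ_sum m r \<omega> = (\<Sum>j<m. \<Sum>l\<in>UNIV. ?p j l r \<omega>)" for r \<omega>
    unfolding circ_sum_def inner_vec_def Fc_def by simp
  have eq: "indicator A \<omega> * (circ_sum m (\<theta> \<omega>) \<omega> - circ_sum m s' \<omega>) = (\<Sum>j<m. \<Sum>l\<in>UNIV. indicator A \<omega> * (?p j l (\<theta> \<omega>) \<omega> - ?p j l s' \<omega>))" for \<omega>
    unfolding RSe sum_subtractf[symmetric] sum_distrib_left ..
  show "integrable M (\<lambda>\<omega>. indicator A \<omega> * (circ_sum m (\<theta> \<omega>) \<omega> - circ_sum m s' \<omega>))"
    unfolding eq by (intro Bochner_Integration.integrable_sum particle_ito(1))
  show "integrable M (\<lambda>\<omega>. \<Sum>j<m. \<Sum>l\<in>UNIV. indicator A \<omega> * integral {s'..\<theta> \<omega>} (\<lambda>r. riemann_drift r (V r) (\<lambda>j. x (real j / real m) r \<omega>) j l))"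
    by (intro Bochner_Integration.integrable_sum particle_ito(2))
  show "expectation (\<lambda>\<omega>. indicator A \<omega> * (circ_sum m (\<theta> \<omega>) \<omega> - circ_sum m s' \<omega>))
       = expectation (\<lambda>\<omega>. \<Sum>j<m. \<Sum>l\<in>UNIV. indicator A \<omega> * integral {s'..\<theta> \<omega>} (\<lambda>r. riemann_drift r (V r) (\<lambda>j. x (real j / real m) r \<omega>) j l))"
    unfolding eq
    by (simp only: Bochner_Integration.integral_sum Bochner_Integration.integrable_sum particle_ito(1,2,3))
qed

text \<open>The identity for \<open>circ_sum m\<close> is passed to the limit \<open>m \<rightarrow>
\<infinity>\<close>: on one side the sums converge to the circulation, on the other the drift
disappears.\<close>

lemma circulation_increment_mean_zero:
  "expectation (\<lambda>\<omega>. indicator A \<omega> * (circ (\<theta> \<omega>) \<omega> - circ s' \<omega>)) = 0"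
proof -
  obtain C where C: "C > 0"
    "\<And>\<omega> r m. \<omega> \<in> space M \<Longrightarrow> \<omega> \<notin> N \<Longrightarrow> r \<in> {a..T} \<Longrightarrow> r \<le> \<tau> \<omega> \<Longrightarrow> \<bar>circ_sum m r \<omega>\<bar> \<le> C \<and> \<bar>drift_sum m r \<omega>\<bar> \<le> C * (1 + g r)"
    by (rule localized_bounds) blast
  define Q where "Q m \<omega> = indicator A \<omega> * (circ_sum m (\<theta> \<omega>) \<omega> - circ_sum m s' \<omega>)" for m \<omega>
  define S where "S m \<omega> = (\<Sum>j<m. \<Sum>l\<in>UNIV. indicator A \<omega> * integral {s'..\<theta> \<omega>} (\<lambda>r. riemann_drift r (V r) (\<lambda>j. x (real j / real m) r \<omega>) j l))" for m \<omega>
  define Qinf where "Qinf \<omega> = indicator A \<omega> * (circ (\<theta> \<omega>) \<omega> - circ s' \<omega>)" for \<omega>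
  have cm: "complete_measure M" by (rule complete_measure_axioms)
  have Qm: "Q m \<in> borel_measurable M" and Sm: "S m \<in> borel_measurable M" and QS: "expectation (Q m) = expectation (S m)" for m
    unfolding Q_def S_def using riemann_sum_ito[of m] by (auto dest: borel_measurable_integrable)
  have th: "\<theta> \<omega> \<in> {a..T}" for \<omega> using theta[of \<omega>] st by auto
  have s'_in: "s' \<in> {a..T}" using st by auto
  have Se: "S m \<omega> = indicator A \<omega> * integral {s'..\<theta> \<omega>} (\<lambda>r. drift_sum m r \<omega>)" if \<omega>: "\<omega> \<in> space M" "\<omega> \<notin> N" for m \<omega>
  proof -
    have i: "(\<lambda>r. riemann_drift r (V r) (\<lambda>j. x (real j / real m) r \<omega>) j l) integrable_on {s'..\<theta> \<omega>}" for j l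
      by (rule integrable_on_subinterval[OF particle_ito(4)[OF \<omega>]]) (use th[of \<omega>] st in auto)
    have "integral {s'..\<theta> \<omega>} (\<lambda>r. drift_sum m r \<omega>) = (\<Sum>j<m. \<Sum>l\<in>UNIV. integral {s'..\<theta> \<omega>} (\<lambda>r. riemann_drift r (V r) (\<lambda>j. x (real j / real m) r \<omega>) j l))"
      unfolding drift_sum_def
      by (simp only: Henstock_Kurzweil_Integration.integral_sum integrable_sum i finite finite_lessThan)
    then show ?thesis unfolding S_def sum_distrib_left by (simp only: sum_distrib_left)
  qed
  have Ql: "AE \<omega> in M. (\<lambda>m. Q m \<omega>) \<longlonglongrightarrow> Qinf \<omega>"
    using AE_regular
  proof eventually_elim
    case (elim \<omega>)
    then have "good \<omega>" using N_good by blast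
    then show ?case unfolding Q_def Qinf_def by (intro tendsto_intros circ_sum_tendsto th s'_in)
  qed
  have Qb: "AE \<omega> in M. norm (Q m \<omega>) \<le> 2 * C" for m
    using AE_regular
  proof eventually_elim
    case (elim \<omega>)
    show ?case
    proof (cases "s' < \<theta> \<omega>")
      case True
      then have "\<theta> \<omega> \<le> \<tau> \<omega>" by (rule theta)
      then have "\<bar>circ_sum m (\<theta> \<omega>) \<omega>\<bar> \<le> C" "\<bar>circ_sum m s' \<omega>\<bar> \<le> C"
        using C(2)[of \<omega> "\<theta> \<omega>" m] C(2)[of \<omega> s' m] elim th[of \<omega>] s'_in True by auto
      then show ?thesis using C(1) by (auto simp: Q_def indicator_def)
    next
      case False
      then have "\<theta> \<omega> = s'" using theta(1)[of \<omega>] by simp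
      then show ?thesis using C(1) by (simp add: Q_def)
    qed
  qed
  have Sl: "AE \<omega> in M. (\<lambda>m. S m \<omega>) \<longlonglongrightarrow> 0"
    using AE_regular
  proof eventually_elim
    case (elim \<omega>)
    then have \<omega>: "\<omega> \<in> space M" "\<omega> \<notin> N" by auto
    have "(\<lambda>m. integral {s'..\<theta> \<omega>} (\<lambda>r. drift_sum m r \<omega>)) \<longlonglongrightarrow> 0"
      by (rule drift_sum_integral_tendsto[OF \<omega> st(1) theta(1)])
        (use theta[of \<omega>] st th[of \<omega>] in \<open>auto intro!: integrable_on_subinterval[OF drift_sum_integrable[OF \<omega>]]\<close>)
    then have "(\<lambda>m. indicator A \<omega> * integral {s'..\<theta> \<omega>} (\<lambda>r. drift_sum m r \<omega>)) \<longlonglongrightarrow> indicator A \<omega> * 0"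
      by (intro tendsto_mult_left)
    then show ?case by (simp add: Se[OF \<omega>])
  qed
  let ?K = "C * integral {a..T} (\<lambda>r. 1 + g r)"
  have g1: "(\<lambda>r. 1 + g r) integrable_on {u..u'}" if "a \<le> u" "u' \<le> T" for u u'
    by (intro integrable_add integrable_const_ivl integrable_on_subinterval[OF g_a]) (use that in auto)
  have Sb: "AE \<omega> in M. norm (S m \<omega>) \<le> ?K" for m
    using AE_regular
  proof eventually_elim
    case (elim \<omega>)
    then have \<omega>: "\<omega> \<in> space M" "\<omega> \<notin> N" by auto
    have K0: "0 \<le> integral {a..T} (\<lambda>r. 1 + g r)"
      using g(2) g1[of a T] by (intro Henstock_Kurzweil_Integration.integral_nonneg) (auto intro: add_nonneg_nonneg)
    have "norm (integral {s'..\<theta> \<omega>} (\<lambda>r. drift_sum m r \<omega>)) \<le> ?K"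
    proof (cases "s' < \<theta> \<omega>")
      case True
      then have le: "\<theta> \<omega> \<le> \<tau> \<omega>" by (rule theta)
      have "norm (integral {s'..\<theta> \<omega>} (\<lambda>r. drift_sum m r \<omega>)) \<le> integral {s'..\<theta> \<omega>} (\<lambda>r. C * (1 + g r))"
      proof (rule Henstock_Kurzweil_Integration.integral_norm_bound_integral)
        show "(\<lambda>r. drift_sum m r \<omega>) integrable_on {s'..\<theta> \<omega>}"
          by (rule integrable_on_subinterval[OF drift_sum_integrable[OF \<omega>]]) (use th[of \<omega>] st in auto)
        show "(\<lambda>r. C * (1 + g r)) integrable_on {s'..\<theta> \<omega>}"
          by (intro integrable_on_mult_right g1) (use st theta(2)[of \<omega>] in auto)
        fix r assume "r \<in> {s'..\<theta> \<omega>}"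
        then show "norm (drift_sum m r \<omega>) \<le> C * (1 + g r)" using C(2)[OF \<omega>, of r m] le th[of \<omega>] st by auto
      qed
      also have "\<dots> = C * integral {s'..\<theta> \<omega>} (\<lambda>r. 1 + g r)" by simp
      also have "\<dots> \<le> ?K"
      proof (intro mult_left_mono integral_subset_le g1)
        show "{s'..\<theta> \<omega>} \<subseteq> {a..T}" using st theta(2)[of \<omega>] by auto
        show "\<forall>r\<in>{a..T}. 0 \<le> 1 + g r" using g(2) by (auto intro: add_nonneg_nonneg)
      qed (use st theta(2)[of \<omega>] C(1) in auto)
      finally show ?thesis .
    next
      case False
      then have "\<theta> \<omega> = s'" using theta(1)[of \<omega>] by simp
      then show ?thesis using C(1) K0 by simp
    qed
    moreover have "0 \<le> ?K" using C(1) K0 by simp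
    ultimately show ?case unfolding Se[OF \<omega>] by (auto simp: indicator_def)
  qed
  have Qim: "Qinf \<in> borel_measurable M"
    by (rule measurable_AE_LIMSEQ_complete[OF cm _ _ _ Qm Ql]) auto
  have "(\<lambda>m. expectation (Q m)) \<longlonglongrightarrow> expectation Qinf"
    by (rule integral_dominated_convergence[OF Qim Qm _ Ql Qb]) simp
  moreover have "(\<lambda>m. expectation (S m)) \<longlonglongrightarrow> expectation (\<lambda>_. 0 :: real)"
    by (rule integral_dominated_convergence[OF _ Sm _ Sl Sb]) simp_all
  ultimately have "expectation Qinf = 0" unfolding QS using LIMSEQ_unique by fastforce
  then show ?thesis by (simp add: Qinf_def[abs_def])
qed

end

lemma stopped_circulation_martingale: "martingale_on M \<F> {a..T} (\<lambda>t \<omega>. circ (min t (\<tau> \<omega>)) \<omega>)"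
proof -
  obtain C where C: "C > 0"
    "\<And>\<omega> r m. \<omega> \<in> space M \<Longrightarrow> \<omega> \<notin> N \<Longrightarrow> r \<in> {a..T} \<Longrightarrow> r \<le> \<tau> \<omega> \<Longrightarrow> \<bar>circ_sum m r \<omega>\<bar> \<le> C \<and> \<bar>drift_sum m r \<omega>\<bar> \<le> C * (1 + g r)"
    by (rule localized_bounds) blast
  let ?Z = "\<lambda>t \<omega>. circ (min t (\<tau> \<omega>)) \<omega>"
  have adapted: "?Z t \<in> borel_measurable (\<F> t)" if t: "t \<in> {a..T}" for t
  proof (rule stopped_process_adapted[OF a_bounds(1) circ_adapted _ tau_stopping _ t])
    show "AE \<omega> in M. continuous_on {a..T} (\<lambda>r. circ r \<omega>)"
      using good_AE by eventually_elim (rule circ_path_cont)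
    show "a \<le> \<tau> \<omega>" for \<omega> using tau_range[of \<omega>] by simp
  qed
  have int: "integrable M (?Z t)" if t: "t \<in> {a..T}" for t
  proof (rule integrable_const_bound[where B=C])
    show "?Z t \<in> borel_measurable M" using t a_bounds by (intro F_measurable_M[OF _ adapted[OF t]]) auto
    show "AE \<omega> in M. norm (?Z t \<omega>) \<le> C"
      using AE_regular
    proof eventually_elim
      case (elim \<omega>)
      have m: "min t (\<tau> \<omega>) \<in> {a..T}" using t tau_range[of \<omega>] by auto
      have "(\<lambda>m. norm (circ_sum m (min t (\<tau> \<omega>)) \<omega>)) \<longlonglongrightarrow> norm (?Z t \<omega>)"
        using elim N_good by (intro tendsto_norm circ_sum_tendsto m) auto
      then show ?case
        by (rule LIMSEQ_le_const2) (use C(2)[of \<omega> "min t (\<tau> \<omega>)"] elim m in auto)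
    qed
  qed
  show ?thesis unfolding martingale_on_def
  proof (intro conjI ballI impI)
    fix t assume t: "t \<in> {a..T}"
    show "?Z t \<in> borel_measurable (\<F> t)" by (rule adapted[OF t])
    show "integrable M (?Z t)" by (rule int[OF t])
  next
    fix s' t' assume s': "s' \<in> {a..T}" and t': "t' \<in> {a..T}" and le: "s' \<le> t'"
    have s0: "0 \<le> s'" using s' a_bounds by auto
    interpret S: finite_measure_subalgebra M "\<F> s'"
      by unfold_locales (use filtration_subalgebra[OF s0] in auto)
    show "AE \<omega> in M. real_cond_exp M (\<F> s') (?Z t') \<omega> = ?Z s' \<omega>"
    proof (rule S.real_cond_exp_charact[OF _ int[OF t'] int[OF s'] adapted[OF s']])
      fix A assume A: "A \<in> sets (\<F> s')"
      then have AM: "A \<in> sets M" using sets_F[OF s0] by auto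
      show "(LINT \<omega>:A|M. ?Z t' \<omega>) = (LINT \<omega>:A|M. ?Z s' \<omega>)"
      proof (cases "s' = t'")
        case False
        then have lt: "a \<le> s'" "s' < t'" "t' \<le> T" using le s' t' by auto
        have i: "integrable M (\<lambda>\<omega>. indicator A \<omega> * ?Z r \<omega>)" if "r \<in> {a..T}" for r
          using integrable_mult_indicator[OF AM int[OF that]] by simp
        have eq: "indicator A \<omega> * ?Z t' \<omega> - indicator A \<omega> * ?Z s' \<omega> = indicator A \<omega> * (circ (max s' (min t' (\<tau> \<omega>))) \<omega> - circ s' \<omega>)" for \<omega>
          using lt by (cases "s' \<le> \<tau> \<omega>") (auto simp: min_def max_def algebra_simps)
        have "expectation (\<lambda>\<omega>. indicator A \<omega> * ?Z t' \<omega>) - expectation (\<lambda>\<omega>. indicator A \<omega> * ?Z s' \<omega>)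
            = expectation (\<lambda>\<omega>. indicator A \<omega> * (circ (max s' (min t' (\<tau> \<omega>))) \<omega> - circ s' \<omega>))"
          unfolding eq[symmetric] by (rule Bochner_Integration.integral_diff[symmetric, OF i[OF t'] i[OF s']])
        also have "\<dots> = 0"
          using circulation_increment_mean_zero[OF lt A] unfolding \<theta>_def[OF lt A] .
        finally show ?thesis by (simp add: set_lebesgue_integral_def)
      qed simp
    qed
  qed
qed

end

context loop_in_flow
begin

text \<open>The levels \<open>k + 1\<close> are positive, and a continuous path on a compact interval stays
below one of them, so the exit times reach the end of the interval.\<close>

theorem circulation_local_martingale: "local_martingale_on M \<F> a T circ"
proof -
  obtain N where N: "N \<in> null_sets M" "{\<omega> \<in> space M. \<not> good \<omega>} \<subseteq> N"
    using good_AE by (auto elim!: AE_E simp: null_sets_def)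
  have N_good: "\<omega> \<in> space M \<Longrightarrow> \<omega> \<notin> N \<Longrightarrow> good \<omega>" for \<omega> using N(2) by auto
  have Wc: "\<omega> \<in> space M \<Longrightarrow> \<omega> \<notin> N \<Longrightarrow> continuous_on {0..} (\<lambda>t. W t \<omega>)" for \<omega> using N_good by (simp add: good_def)
  have sl: "stopped_loop M \<F> W T \<nu> \<alpha> s v F F0 \<Gamma> D\<Gamma> X E g N (real k + 1)" for k :: nat
    by unfold_locales (use N(1) N_good in auto)
  let ?\<tau> = "\<lambda>k::nat. exit_time a T N (real k + 1)"
  show ?thesis unfolding local_martingale_on_def
  proof (intro conjI exI[of _ ?\<tau>] allI ballI)
    show "circ t \<in> borel_measurable (\<F> t)" if "t \<in> {a..T}" for t by (rule circ_adapted[OF that])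
    show "AE \<omega> in M. cadlag_on a T (\<lambda>t. circ t \<omega>)"
      using good_AE by eventually_elim (rule continuous_on_imp_cadlag[OF circ_path_cont])
    show "stopping_time \<F> (?\<tau> k)" for k by (rule exit_time_stopping[OF a_bounds N(1) Wc])
    show "?\<tau> k \<omega> \<in> {a..T}" for k \<omega> by (rule exit_time_range[OF a_bounds N(1) Wc])
    show "AE \<omega> in M. incseq (\<lambda>k. ?\<tau> k \<omega>)"
      by (intro AE_I2 incseq_SucI exit_time_mono[OF a_bounds N(1) Wc]) auto
    show "AE \<omega> in M. \<exists>k. ?\<tau> k \<omega> = T"
    proof -
      have "AE \<omega> in M. \<omega> \<in> space M \<and> \<omega> \<notin> N" using AE_not_in[OF N(1)] by auto
      then show ?thesis by eventually_elim (blast intro: exit_time_eventually[OF a_bounds N(1) Wc])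
    qed
    show "martingale_on M \<F> {a..T} (\<lambda>t \<omega>. circ (min t (?\<tau> k \<omega>)) \<omega>)" for k
      using stopped_loop.stopped_circulation_martingale[OF sl[of k]]
      unfolding stopped_loop.\<tau>_def[OF sl[of k]] .
  qed
qed

end

theorem corollary3p3:
  fixes M :: "'a measure"
    and \<F> :: "real \<Rightarrow> 'a measure"
    and W :: "real \<Rightarrow> 'a \<Rightarrow> real^'n"
    and T \<nu> \<alpha> s :: real
    and v F :: "real \<Rightarrow> real^'n \<Rightarrow> real^'n"
    and F0 :: "real^'n \<Rightarrow> real^'n"
    and X :: "real \<Rightarrow> real \<Rightarrow> real^'n \<Rightarrow> 'a \<Rightarrow> real^'n"
    and \<Gamma> :: "real \<Rightarrow> real^'n"
  assumes "complete_filtered_prob_space M \<F>"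
    and "wiener_process M \<F> W"
    and "T > 0" and "\<nu> > 0" and "0 < \<alpha>" and "\<alpha> < 1"
    and "L1_Cb1 T \<alpha> v"
    and "stochastic_flow M \<F> W T \<nu> v X"
    and "Ck 2 F0"
    and "C12 T F"
    and "vector_advection_solution T \<nu> v F0 F"
    and "C1_loop \<Gamma>"
    and "s \<in> {0..T}"
  shows "local_martingale_on M \<F> (T - s) T
           (\<lambda>t \<omega>. line_integral (\<lambda>u. X (T - s) t (\<Gamma> u) \<omega>) (F (T - t)))"
proof -
  interpret advected_field T \<nu> \<alpha> s v F F0
    by unfold_locales (use assms in auto)
  obtain E g where Eg: "E \<subseteq> {0<..<T}" "negligible ({0..T} - E)" "g integrable_on {0..T}" "\<And>r. 0 \<le> g r"
    "\<And>r. r \<in> E \<Longrightarrow> continuous_on UNIV (v r)" "\<And>r x. r \<in> E \<Longrightarrow> norm (v r x) \<le> g r"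
    "\<And>r x y. r \<in> E \<Longrightarrow> norm (v r x - v r y) \<le> g r * norm (x - y)"
    "\<And>r \<gamma>. r \<in> E \<Longrightarrow> C1_loop \<gamma> \<Longrightarrow> line_integral \<gamma> (defect r (v r)) = 0"
    by (rule good_times) blast
  from \<open>C1_loop \<Gamma>\<close> obtain D where D: "\<And>u. u \<in> {0..1} \<Longrightarrow> (\<Gamma> has_vector_derivative D u) (at u within {0..1})"
    "continuous_on {0..1} D" and closed: "\<Gamma> 1 = \<Gamma> 0"
    unfolding C1_loop_def pathfinish_def pathstart_def by blast
  interpret complete_filtered_prob_space M \<F> by fact
  interpret L: loop_in_flow M \<F> W T \<nu> \<alpha> s v F F0 \<Gamma> D X E g
    by unfold_locales (fact assms D closed Eg)+
  show ?thesis
    using L.circulation_local_martingale unfolding L.circ_def[abs_def] L.x_def .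
qed

end
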